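(* Let $U\subseteq\mathbb{R}^m$, $D\subseteq\mathbb{R}^q$ be convex sets with $0\in U$, $0\in D$, let $r>0$, and consider the time-delay system $$\dot x(t)=f(x_t,u(t),d(t)),\qquad y(t)=h(x_t)+\xi(t),\qquad x(t)\in\mathbb{R}^n,\ u(t)\in U,\ d(t)\in D,\ y(t),\xi(t)\in\mathbb{R}^k. \qquad ( * )$$ Suppose the following. (1) The mappings $f:C^0([-r,0];\mathbb{R}^n)\times U\times D\to\mathbb{R}^n$ and $h:C^0([-r,0];\mathbb{R}^n)\to\mathbb{R}^k$ are continuous, $f(0,0,0)=0$, $h(0)=0$, $f$ and $h$ map bounded sets to bounded sets, and for every bounded $S\subset C^0([-r,0];\mathbb{R}^n)\times U\times D$ there is a constant $L_S\ge 0$ such that $(x(0)-\bar x(0))^T(f(x,u,d)-f(\bar x,u,d))\le L_S\|x-\bar x\|^2$ for all $(x,u,d)\in S$, $(\bar x,u,d)\in S$. (2) For every $x_0\in C^0([-r,0];\mathbb{R}^n)$, $u\in L^\infty_{loc}(\mathbb{R}_+;U)$, $d\in L^\infty_{loc}(\mathbb{R}_+;D)$ the solution of $( * )$ with initial condition $x_0$ corresponding to inputs $u,d$ exists for all $t\ge 0$. (3) There exists a continuous mapping $R:C^0([-r,0];\mathbb{R}^n)\times U\times D\to\mathbb{R}^k$ such that for every $x_0\in C^0([-r,0];\mathbb{R}^n)$, $u\in L^\infty_{loc}(\mathbb{R}_+;U)$, $d\in L^\infty_{loc}(\mathbb{R}_+;D)$ the unique solution $x$ of $( * )$ satisfies $\frac{d}{dt}(h(x_t))=R(x_t,u(t),d(t))$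 for almost every $t\ge 0$. Moreover, there exist a constant $L\ge 0$ and $\kappa\in K$ such that $|R(\bar x,u,0)-R(x,u,d)|\le L\|\bar x-x\|+\kappa(|d|)$ for all $x,\bar x\in C^0([-r,0];\mathbb{R}^n)$, $(u,d)\in U\times D$. (4) The system $\dot z(t)=F(z_t,y(t),u(t))$, $\hat x_t=\Psi(z_t)$, with $z(t)\in\mathbb{R}^l$, is a Robust Exponential Observer (REO) for $( * )$, with associated constants $\gamma,\sigma>0$ and functions $g\in K$, $a\in K_\infty$ (see context). (5) For every bounded $S\subset C^0([-r,0];\mathbb{R}^l)\times U$ there exists a constant $L_S\ge 0$ such that $|R(\Psi(z),u,0)-R(\Psi(\bar z),u,0)|\le L_S\|z-\bar z\|$ for all $(z,u)\in S$, $(\bar z,u)\in S$. Let $\delta>0$ and $\omega\in(0,\sigma]$ be constants that satisfy $$\delta<\frac1\omega\ln\left(1+\frac{\omega}{\gamma L}\right)$$ (no restriction if $L=0$). Then for every sampling sequence $\{\tau_i\}_{i=0}^\infty$ with $\tau_0=0$, $\lim(\tau_i)=+\infty$, $0<\tau_{i+1}-\tau_i\le\delta$ for $i=0,1,\ldots$, and for every $(x_0,z_0)\in C^0([-r,0];\mathbb{R}^n)\times C^0([-r,0];\mathbb{R}^l)$, $u\in L^\infty_{loc}(\mathbb{R}_+;U)$, $d\in L^\infty_{loc}(\mathbb{R}_+;D)$, $\xi\in L^\infty_{loc}(\mathbb{R}_+;\mathbb{R}^k)$, the solution $(x(t),z(t),w(t))$ of $( * )$ together with $$\dot z(t)=F(z_t,w(t),u(t)),\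 t\ge 0;\qquad \dot w(t)=R(\Psi(z_t),u(t),0),\ t\in[\tau_i,\tau_{i+1});\qquad \hat x_t=\Psi(z_t),\ t\ge 0;$$ $$w(\tau_i)=h(x_{\tau_i})+\xi(\tau_i),\quad i=0,1,\ldots$$ with initial condition $(x_0,z_0)$, corresponding to inputs $u,d,\xi$, exists for all $t\ge 0$ and satisfies for all $t\geq 0$ the estimate $$\|\hat x_t-x_t\|\le(1-B)^{-1}\exp(-\omega t)\,a(\|x_0\|+\|z_0\|)+(1-B)^{-1}\gamma\exp(\omega\delta)\sup_{0\le s\le t}\left(|\xi(s)|\exp(-\omega(t-s))\right)+\sup_{0\le s\le t}\left(\tilde g(|d(s)|)\right),$$ where $\tilde g(s):=(1-B)^{-1}(g(s)+\gamma\delta\kappa(s))$ and $B:=\gamma L\,\frac{\exp(\omega\delta)-1}{\omega}<1$.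
   Context: Notation. $|\cdot|$ is the Euclidean norm; for $x\in C^0([-r,0];\mathbb{R}^n)$, $\|x\|:=\max_{\theta\in[-r,0]}|x(\theta)|$. For a continuous $x:[a-r,b)\to\mathbb{R}^n$ and $t\in[a,b)$, $x_t\in C^0([-r,0];\mathbb{R}^n)$ is the history $x_t(\theta)=x(t+\theta)$. $K$ is the set of increasing continuous functions $\rho:\mathbb{R}_+\to\mathbb{R}_+$ with $\rho(0)=0$; $K_\infty$ is the set of $\rho\in K$ with $\lim_{s\to+\infty}\rho(s)=+\infty$. $L^\infty_{loc}(\mathbb{R}_+;D)$ is the class of Lebesgue measurable, locally bounded mappings $d:\mathbb{R}_+\to D$; suprema of such mappings are actual (not essential) suprema. Solutions of delay systems are continuous mappings, absolutely continuous for $t\ge0$, satisfying the differential equation almost everywhere and having the prescribed initial history on $[-r,0]$. The signal $w$ is reset at each sampling time $\tau_i$ and evolves by its differential equation on $[\tau_i,\tau_{i+1})$. Robust Exponential Observer (REO). Let $F:C^0([-r,0];\mathbb{R}^l)\times\mathbb{R}^k\times U\to\mathbb{R}^l$ and $\Psi:C^0([-r,0];\mathbb{R}^l)\to C^0([-r,0];\mathbb{R}^n)$ be continuous with $F(0,0,0)=0$, $\Psi(0)=0$, and suppose that for every bounded $\Omega\subset C^0([-r,0];\mathbb{R}^l)\times\mathbb{R}^k\times U$ the set $F(\Omega)$ is bounded and there is $L_\Omega\ge0$ with $(z(0)-\bar z(0))^T(F(z,y,u)-F(\bar z,y,u))\le L_\Omega\|z-\bar z\|^2$ for all $(z,y,u),(\bar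 z,y,u)\in\Omega$. The system $\dot z=F(z_t,y,u)$, $\hat x_t=\Psi(z_t)$ is called an REO for the system $\dot x=f(x_t,u,d)$, $y=h(x_t)+\xi$ if there exist constants $\gamma,\sigma>0$ and functions $g\in K$, $a\in K_\infty$ such that for every $(x_0,z_0)\in C^0([-r,0];\mathbb{R}^n)\times C^0([-r,0];\mathbb{R}^l)$, $u\in L^\infty_{loc}(\mathbb{R}_+;U)$, $d\in L^\infty_{loc}(\mathbb{R}_+;D)$, $\xi\in L^\infty_{loc}(\mathbb{R}_+;\mathbb{R}^k)$, the solution $(x(t),z(t))$ of $\dot x=f(x_t,u,d)$, $\dot z=F(z_t,h(x_t)+\xi,u)$, $\hat x_t=\Psi(z_t)$ with initial condition $(x_0,z_0)$ exists for all $t\ge0$ and satisfies, for all $t\ge 0$, $$\|\hat x_t-x_t\|\le\exp(-\sigma t)a(\|x_0\|+\|z_0\|)+\gamma\sup_{0\le s\le t}\left(|\xi(s)|\exp(-\sigma(t-s))\right)+\sup_{0\le s\le t}\left(g(|d(s)|)\right).$$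
   Formalization: In (3), t ↦ h(x_t) is also assumed locally absolutely continuous; with a.e. differentiability alone the claim fails (h with a Cantor-type part). "The solution exists and satisfies" is read as: a solution on [0,∞) exists and every such solution satisfies the estimate. *)

theory Defs
  imports "HOL-Analysis.Analysis"
begin

text \<open>
  The Banach space of continuous functions on \<open>[-r, 0]\<close> is realised inside the library type of
  bounded continuous functions on the real line: a function on \<open>[-r, 0]\<close> is extended by the
  constants given by its values at the two end points. The extension is an isometry for the maximum
  norm (see \<open>norm_C0\<close>), so norm, topology, boundedness and linear structure are those of the library.
\<close>

definition C0 :: "real \<Rightarrow> (real \<Rightarrow>\<^sub>C 'a::euclidean_space) set" where
  "C0 r = {Bcontfun (ext_cont \<phi> (-r) 0) | \<phi>. continuous_on {-r..0} \<phi>}"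

definition history :: "real \<Rightarrow> (real \<Rightarrow> 'a::euclidean_space) \<Rightarrow> real \<Rightarrow> (real \<Rightarrow>\<^sub>C 'a)" where
  "history r x t = Bcontfun (ext_cont (\<lambda>\<theta>. x (t + \<theta>)) (-r) 0)"

lemma apply_ext_cont:
  fixes \<phi> :: "real \<Rightarrow> 'a::euclidean_space"
  assumes "continuous_on {-r..0} \<phi>" "0 < r"
  shows "apply_bcontfun (Bcontfun (ext_cont \<phi> (-r) 0)) = (\<lambda>\<theta>. \<phi> (max (-r) (min \<theta> 0)))"
proof -
  have c: "clamp (-r) 0 \<theta> = max (-r) (min \<theta> 0)" for \<theta>
    using assms(2) by (simp add: clamp_def max_def min_def)
  have "compact (\<phi> ` {-r..0})"
    using assms(1) by (intro compact_continuous_image) auto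
  moreover have "range (ext_cont \<phi> (-r) 0) \<subseteq> \<phi> ` {-r..0}"
    using assms(2) by (auto simp: ext_cont_def c)
  ultimately have "bounded (range (ext_cont \<phi> (-r) 0))"
    using bounded_subset compact_imp_bounded by blast
  moreover have "continuous_on UNIV (ext_cont \<phi> (-r) 0)"
    using assms by (intro continuous_on_ext_cont) (auto simp: cbox_interval)
  ultimately show ?thesis
    by (subst Bcontfun_inverse) (auto simp: bcontfun_def ext_cont_def c)
qed

lemma norm_C0:
  assumes "0 < r" "\<phi> \<in> C0 r"
  shows "norm \<phi> = (SUP \<theta>\<in>{-r..0}. norm (apply_bcontfun \<phi> \<theta>))"
proof -
  obtain \<psi> where \<psi>: "continuous_on {-r..0} \<psi>" "\<phi> = Bcontfun (ext_cont \<psi> (-r) 0)"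
    using assms(2) by (auto simp: C0_def)
  note a = apply_ext_cont[OF \<psi>(1) assms(1)]
  have "range (\<lambda>\<theta>. norm (apply_bcontfun \<phi> \<theta>)) = (\<lambda>\<theta>. norm (apply_bcontfun \<phi> \<theta>)) ` {-r..0}"
  proof (intro equalityI subsetI)
    fix v assume "v \<in> range (\<lambda>\<theta>. norm (apply_bcontfun \<phi> \<theta>))"
    then obtain \<theta> where "v = norm (apply_bcontfun \<phi> \<theta>)" by auto
    then have "v = norm (apply_bcontfun \<phi> (max (-r) (min \<theta> 0)))"
      unfolding \<psi>(2) a using assms(1) by (simp add: min_def max_def)
    moreover have "max (-r) (min \<theta> 0) \<in> {-r..0}" using assms(1) by auto
    ultimately show "v \<in> (\<lambda>\<theta>. norm (apply_bcontfun \<phi> \<theta>)) ` {-r..0}" by blast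
  qed auto
  then show ?thesis
    unfolding norm_bcontfun_def dist_bcontfun_def by simp
qed

text \<open>``Increasing'' is strict, as usual for comparison functions.\<close>

definition class_K :: "(real \<Rightarrow> real) set" where
  "class_K = {\<rho>. continuous_on {0..} \<rho> \<and> strict_mono_on {0..} \<rho> \<and> \<rho> 0 = 0}"

definition class_K_infinity :: "(real \<Rightarrow> real) set" where
  "class_K_infinity = {\<rho> \<in> class_K. filterlim \<rho> at_top at_top}"

text \<open>Only the values on \<open>[0, \<infinity>)\<close> matter.\<close>

definition Linf_loc :: "'a::euclidean_space set \<Rightarrow> (real \<Rightarrow> 'a) set" where
  "Linf_loc D = {d. d \<in> borel_measurable (lebesgue_on {0..}) \<and> (\<forall>t\<ge>0. d t \<in> D) \<and>
     (\<forall>T\<ge>0. bounded (d ` {0..T}))}"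

text \<open>
  The usual epsilon-delta notion; the finite families of non-overlapping compact intervals are the
  library's divisions, an interval \<open>k\<close> having end points \<open>Inf k\<close> and \<open>Sup k\<close>.
\<close>

definition abs_continuous_on :: "real set \<Rightarrow> (real \<Rightarrow> 'a::real_normed_vector) \<Rightarrow> bool" where
  "abs_continuous_on S y \<longleftrightarrow>
     (\<forall>\<epsilon>>0. \<exists>\<delta>>0. \<forall>\<D>. \<D> division_of \<Union>\<D> \<longrightarrow> \<Union>\<D> \<subseteq> S \<longrightarrow> (\<Sum>k\<in>\<D>. Sup k - Inf k) < \<delta> \<longrightarrow>
        (\<Sum>k\<in>\<D>. norm (y (Sup k) - y (Inf k))) < \<epsilon>)"

text \<open>
  \<open>has_ac_derivative_on I y v\<close>: \<open>y\<close> is absolutely continuous (on compact subintervals of \<open>I\<close>)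
  and \<open>y' = v\<close> almost everywhere on \<open>I\<close>.
\<close>

definition has_ac_derivative_on ::
    "real set \<Rightarrow> (real \<Rightarrow> 'a::real_normed_vector) \<Rightarrow> (real \<Rightarrow> 'a) \<Rightarrow> bool" where
  "has_ac_derivative_on I y v \<longleftrightarrow>
     (\<forall>a b. {a..b} \<subseteq> I \<longrightarrow> abs_continuous_on {a..b} y) \<and>
     (AE t in lebesgue_on I. (y has_vector_derivative v t) (at t within I))"

text \<open>
  \<open>x\<close> is defined on \<open>[-r, \<infinity>)\<close> (its values elsewhere are irrelevant), has initial history
  \<open>x0\<close> and solves \<open>x'(t) = G(x_t, t)\<close> for \<open>t \<ge> 0\<close>.
\<close>

definition delay_solution ::
    "real \<Rightarrow> ((real \<Rightarrow>\<^sub>C 'a) \<Rightarrow> real \<Rightarrow> 'a) \<Rightarrow> (real \<Rightarrow>\<^sub>C 'a) \<Rightarrow> (real \<Rightarrow> 'a::euclidean_space) \<Rightarrow> bool" where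
  "delay_solution r G x0 x \<longleftrightarrow>
     continuous_on {-r..} x \<and> history r x 0 = x0 \<and>
     has_ac_derivative_on {0..} x (\<lambda>t. G (history r x t) t)"

definition bounded_on_bounded :: "'a::metric_space set \<Rightarrow> ('a \<Rightarrow> 'b::metric_space) \<Rightarrow> bool" where
  "bounded_on_bounded A G \<longleftrightarrow> (\<forall>S. S \<subseteq> A \<and> bounded S \<longrightarrow> bounded (G ` S))"

text \<open>The parameter \<open>p\<close> collects all arguments besides the history.\<close>

definition one_sided_lipschitz_on_bounded ::
    "((real \<Rightarrow>\<^sub>C 'a) \<times> 'p::real_normed_vector) set \<Rightarrow> ((real \<Rightarrow>\<^sub>C 'a) \<times> 'p \<Rightarrow> 'a::euclidean_space) \<Rightarrow> bool" where
  "one_sided_lipschitz_on_bounded A G \<longleftrightarrow>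
     (\<forall>S. S \<subseteq> A \<and> bounded S \<longrightarrow>
        (\<exists>L\<ge>0. \<forall>\<phi> \<psi> p. (\<phi>, p) \<in> S \<longrightarrow> (\<psi>, p) \<in> S \<longrightarrow>
           inner (apply_bcontfun \<phi> 0 - apply_bcontfun \<psi> 0) (G (\<phi>, p) - G (\<psi>, p)) \<le> L * (norm (\<phi> - \<psi>))\<^sup>2))"

text \<open>
  Robust exponential observer \<open>z' = F(z_t, y, u)\<close>, \<open>xhat_t = \<Psi>(z_t)\<close> for \<open>x' = f(x_t, u, d)\<close>,
  \<open>y = h(x_t) + \<xi>\<close>, with the constants and comparison functions of its error estimate made explicit.
\<close>

definition robust_exponential_observer ::
    "real \<Rightarrow> (real^'m) set \<Rightarrow> (real^'q) set \<Rightarrow>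
     ((real \<Rightarrow>\<^sub>C (real^'n)) \<times> (real^'m) \<times> (real^'q) \<Rightarrow> (real^'n)) \<Rightarrow> ((real \<Rightarrow>\<^sub>C (real^'n)) \<Rightarrow> (real^'k)) \<Rightarrow>
     ((real \<Rightarrow>\<^sub>C (real^'l)) \<times> (real^'k) \<times> (real^'m) \<Rightarrow> (real^'l)) \<Rightarrow> ((real \<Rightarrow>\<^sub>C (real^'l)) \<Rightarrow> (real \<Rightarrow>\<^sub>C (real^'n))) \<Rightarrow>
     real \<Rightarrow> real \<Rightarrow> (real \<Rightarrow> real) \<Rightarrow> (real \<Rightarrow> real) \<Rightarrow> bool" where
  "robust_exponential_observer r U D f h F \<Psi> \<gamma> \<sigma> g a \<longleftrightarrow>
     continuous_on (C0 r \<times> UNIV \<times> U) F \<and> F (0, 0, 0) = 0 \<and>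
     continuous_on (C0 r) \<Psi> \<and> \<Psi> ` C0 r \<subseteq> C0 r \<and> \<Psi> 0 = 0 \<and>
     bounded_on_bounded (C0 r \<times> UNIV \<times> U) F \<and>
     one_sided_lipschitz_on_bounded (C0 r \<times> UNIV \<times> U) F \<and>
     \<gamma> > 0 \<and> \<sigma> > 0 \<and> g \<in> class_K \<and> a \<in> class_K_infinity \<and>
     (\<forall>x0\<in>C0 r. \<forall>z0\<in>C0 r. \<forall>u\<in>Linf_loc U. \<forall>d\<in>Linf_loc D. \<forall>\<xi>\<in>Linf_loc UNIV.
        let sol = (\<lambda>x z. delay_solution r (\<lambda>\<phi> t. f (\<phi>, u t, d t)) x0 x \<and>
                         delay_solution r (\<lambda>\<phi> t. F (\<phi>, h (history r x t) + \<xi> t, u t)) z0 z)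
        in (\<exists>x z. sol x z) \<and>
           (\<forall>x z. sol x z \<longrightarrow> (\<forall>t\<ge>0.
              norm (\<Psi> (history r z t) - history r x t)
                \<le> exp (- \<sigma> * t) * a (norm x0 + norm z0)
                  + \<gamma> * (SUP s\<in>{0..t}. norm (\<xi> s) * exp (- \<sigma> * (t - s)))
                  + (SUP s\<in>{0..t}. g (norm (d s))))))"

text \<open>
  The closed loop of the plant, the observer and the inter-sample predictor \<open>w\<close>, which is reset at
  the sampling times \<open>\<tau> i\<close> and may jump there.
\<close>

definition sampled_solution ::
    "real \<Rightarrow> ((real \<Rightarrow>\<^sub>C (real^'n)) \<times> (real^'m) \<times> (real^'q) \<Rightarrow> (real^'n)) \<Rightarrow> ((real \<Rightarrow>\<^sub>C (real^'n)) \<Rightarrow> (real^'k)) \<Rightarrow>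
     ((real \<Rightarrow>\<^sub>C (real^'l)) \<times> (real^'k) \<times> (real^'m) \<Rightarrow> (real^'l)) \<Rightarrow> ((real \<Rightarrow>\<^sub>C (real^'l)) \<Rightarrow> (real \<Rightarrow>\<^sub>C (real^'n))) \<Rightarrow>
     ((real \<Rightarrow>\<^sub>C (real^'n)) \<times> (real^'m) \<times> (real^'q) \<Rightarrow> (real^'k)) \<Rightarrow> (nat \<Rightarrow> real) \<Rightarrow>
     (real \<Rightarrow> (real^'m)) \<Rightarrow> (real \<Rightarrow> (real^'q)) \<Rightarrow> (real \<Rightarrow> (real^'k)) \<Rightarrow>
     (real \<Rightarrow>\<^sub>C (real^'n)) \<Rightarrow> (real \<Rightarrow>\<^sub>C (real^'l)) \<Rightarrow>
     (real \<Rightarrow> (real^'n)) \<Rightarrow> (real \<Rightarrow> (real^'l)) \<Rightarrow> (real \<Rightarrow> (real^'k)) \<Rightarrow> bool" where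
  "sampled_solution r f h F \<Psi> R \<tau> u d \<xi> x0 z0 x z w \<longleftrightarrow>
     delay_solution r (\<lambda>\<phi> t. f (\<phi>, u t, d t)) x0 x \<and>
     delay_solution r (\<lambda>\<phi> t. F (\<phi>, w t, u t)) z0 z \<and>
     (\<forall>i. has_ac_derivative_on {\<tau> i..<\<tau> (Suc i)} w (\<lambda>t. R (\<Psi> (history r z t), u t, 0))) \<and>
     (\<forall>i. w (\<tau> i) = h (history r x (\<tau> i)) + \<xi> (\<tau> i))"

end

theory Submission
  imports Defs "HOL-Complex_Analysis.Great_Picard"
begin

text \<open>
  Everything is expressed through the error \<open>e t = w t - h (x_t)\<close> of the predicted output. Driving
  the observer with \<open>w\<close> is the same as driving it with the output \<open>h (x_t)\<close> corrupted by the noise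
  \<open>e\<close>, so the observer property, applied with \<open>e\<close> in the role of the measurement noise, bounds the
  estimation error \<open>E t = norm (\<Psi> (z_t) - x_t)\<close> by \<open>e\<close>. Conversely \<open>E\<close> bounds \<open>e\<close>: at a sampling
  time \<open>e\<close> equals the measurement noise \<open>\<xi>\<close>, and until the next sampling time it grows at the
  rate \<open>R (\<Psi> (z_t), u, 0) - R (x_t, u, d)\<close>, which is at most \<open>L * E + \<kappa> (norm d)\<close>. When all signals
  are weighted with \<open>exp (\<omega> * t)\<close>, going once around this loop multiplies \<open>E\<close> by
  \<open>\<gamma> * L * (exp (\<omega> * \<delta>) - 1) / \<omega> = B\<close>. The bound on \<open>\<delta>\<close> says \<open>B < 1\<close>, so the loop inequality can
  be solved for \<open>E\<close>, which is the asserted estimate (\<open>sampled_small_gain_estimate\<close>,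
  \<open>sampled_error_estimate\<close>).

  For existence, a given \<open>e\<close> determines an observer trajectory: it exists by the observer
  property and is unique by the one-sided Lipschitz condition. So a fixed point \<open>e\<close> of the map
  ``run the observer with \<open>e\<close>, then integrate the rate since the last sample'' is sought. As \<open>F\<close> is
  merely continuous in the output, this map need not be a contraction, and the fixed point is obtained
  by compactness. If the integral is stopped at time \<open>t - \<epsilon>\<close>, the new value of \<open>e\<close> at \<open>t\<close>
  depends only on the past before \<open>t - \<epsilon>\<close>, and a fixed point arises step by step
  (\<open>causal_fixed_point\<close>, \<open>ex_delayed_prediction\<close>). The small-gain estimate holds for these
  approximations too, with the same right-hand side for every \<open>\<epsilon>\<close>; hence the integrals
  are locally equi-Lipschitz and a subsequence converges for \<open>\<epsilon> \<rightarrow> 0\<close>. The limit solves the original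
  equation because the observer state depends continuously on its input under bounded pointwise
  convergence (\<open>delay_solution_continuous_dependence\<close>, \<open>ex_prediction\<close>).

  The link between almost everywhere derivatives and integrals is the fundamental theorem of calculus
  for absolutely continuous functions, in both directions (\<open>has_integral_ac_derivative\<close>,
  \<open>indefinite_integral_ae_differentiable\<close>).
\<close>

section \<open>Absolutely continuous functions and their derivatives\<close>

lemma open_cover_negligible:
  fixes N :: "'a::euclidean_space set"
  assumes "negligible N" "0 < \<eta>"
  obtains T where "open T" "N \<subseteq> T" "T \<in> lmeasurable" "measure lebesgue T < \<eta>"
proof -
  have N: "N \<in> null_sets lebesgue" using assms by (simp add: negligible_iff_null_sets)
  obtain T where T: "open T" "N \<subseteq> T" "T - N \<in> lmeasurable" "emeasure lebesgue (T - N) < ennreal \<eta>"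
    using sets_lebesgue_outer_open[of N \<eta>] N \<open>0 < \<eta>\<close> by blast
  have "emeasure lebesgue T = emeasure lebesgue (T - N)"
    using N T(1) by (intro emeasure_Diff_null_set[symmetric]) (auto simp: borel_open)
  then have "emeasure lebesgue T < ennreal \<eta>" using T by simp
  moreover have "T \<in> sets lebesgue" using T(1) by (simp add: borel_open)
  ultimately have Tm: "T \<in> lmeasurable"
    by (intro fmeasurableI) (auto intro: order.strict_trans)
  then have "measure lebesgue T < \<eta>"
    using \<open>emeasure lebesgue T < ennreal \<eta>\<close> by (simp add: emeasure_eq_measure2 ennreal_less_iff)
  with T Tm show ?thesis by (intro that[of T])
qed

text \<open>
  The fundamental theorem of calculus for absolutely continuous functions. In a Henstock-Kurzweil sum
  the intervals tagged outside \<open>N\<close> are controlled by differentiability at the tag, as for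
  differentiable functions. For tags in \<open>N\<close> the gauge is an open set of small measure around \<open>N\<close>:
  their intervals have small total length, so absolute continuity makes the increments of \<open>y\<close> over
  them negligible.
\<close>

lemma has_integral_ac_derivative:
  fixes y :: "real \<Rightarrow> 'a::euclidean_space"
  assumes "a \<le> b" and ac: "abs_continuous_on {a..b} y" and N: "negligible N"
    and der: "\<And>t. t \<in> {a..b} - N \<Longrightarrow> (y has_vector_derivative v t) (at t within {a..b})"
  shows "(v has_integral (y b - y a)) {a..b}"
proof -
  \<comment> \<open>Setting the integrand to zero on the null set leaves the integral unchanged.\<close>
  define v0 where "v0 t = (if t \<in> N then 0 else v t)" for t
  have "(v0 has_integral (y b - y a)) (cbox a b)"
    unfolding has_integral
  proof (intro allI impI)
    fix e0 :: real assume "e0 > 0"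
    define e where "e = e0 / (2 * (b - a + 1))"
    have e: "e > 0" "e * (b - a) < e0 / 2"
      using \<open>e0 > 0\<close> \<open>a \<le> b\<close> by (auto simp: e_def field_simps)
    obtain \<eta> where \<eta>: "\<eta> > 0" and small: "\<And>\<D>. \<lbrakk>\<D> division_of \<Union>\<D>; \<Union>\<D> \<subseteq> {a..b};
        (\<Sum>k\<in>\<D>. Sup k - Inf k) < \<eta>\<rbrakk> \<Longrightarrow> (\<Sum>k\<in>\<D>. norm (y (Sup k) - y (Inf k))) < e0 / 2"
      using ac[unfolded abs_continuous_on_def, rule_format, of "e0 / 2"] \<open>e0 > 0\<close> by auto
    obtain T where T: "open T" "N \<subseteq> T" "T \<in> lmeasurable" "measure lebesgue T < \<eta>"
      by (rule open_cover_negligible[OF N \<eta>])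
    have "\<forall>x. \<exists>d>0. x \<in> {a..b} - N \<longrightarrow>
         (\<forall>s\<in>{a..b}. norm (s-x) < d \<longrightarrow> norm (y s - y x - (s-x) *\<^sub>R v x) \<le> e * norm (s-x))"
      using der[unfolded has_vector_derivative_def has_derivative_within_alt] e(1) by blast
    then obtain d where d: "\<And>x. 0 < d x"
                 "\<And>x s. \<lbrakk>x \<in> {a..b} - N; s \<in> {a..b}; norm (s-x) < d x\<rbrakk>
                        \<Longrightarrow> norm (y s - y x - (s-x) *\<^sub>R v x) \<le> e * norm (s-x)"
      by metis
    define G where "G x = (if x \<in> N then T else ball x (d x))" for x
    have G: "gauge G" unfolding gauge_def G_def using T d by auto
    have main: "norm ((\<Sum>(x,k)\<in>p. measure lborel k *\<^sub>R v0 x) - (y b - y a)) < e0"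
      if p: "p tagged_division_of cbox a b" and fine: "G fine p" for p
    proof -
      define q where "q = {(x,k) \<in> p. x \<in> N}"
      have "finite p" using p by auto
      have qp: "q \<subseteq> p" "finite q" using \<open>finite p\<close> by (auto simp: q_def intro: finite_subset[of _ p])
      have part: "q tagged_partial_division_of cbox a b"
        using p qp(1) tagged_partial_division_subset unfolding tagged_division_of_def by blast
      have div: "snd ` q division_of \<Union>(snd ` q)"
        using part by (rule partial_division_of_tagged_division)
      have td: "q tagged_division_of \<Union>(snd ` q)"
        using part by (rule tagged_partial_division_of_Union_self)
      have sub: "\<Union>(snd ` q) \<subseteq> {a..b}" using p qp by fastforce
      have subT: "\<Union>(snd ` q) \<subseteq> T"
        using fine qp by (fastforce simp: fine_def G_def q_def)
      have len: "Sup k - Inf k = measure lebesgue k" if "k \<in> snd ` q" for k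
        using division_ofD(3,4)[OF div that] by (force simp: that)
      have "(\<Sum>k\<in>snd ` q. Sup k - Inf k) = measure lebesgue (\<Union>(snd ` q))"
        using content_division[OF div] len by (metis (no_types, lifting) sum.cong)
      also have "\<dots> \<le> measure lebesgue T"
        using subT T(3) lmeasurable_division[OF div] by (intro measure_mono_fmeasurable) auto
      finally have "(\<Sum>k\<in>snd ` q. norm (y (Sup k) - y (Inf k))) < e0 / 2"
        using T(4) small[OF div sub] by linarith
      moreover have "(\<Sum>(_,k)\<in>q. norm (y (Sup k) - y (Inf k))) = (\<Sum>k\<in>snd ` q. norm (y (Sup k) - y (Inf k)))"
      proof -
        let ?g = "\<lambda>k. if k = {} then 0 else norm (y (Sup k) - y (Inf k))"
        have ne: "k \<noteq> {}" if "(x, k) \<in> q" for x k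
          using tagged_partial_division_ofD(2)[OF part that] by auto
        have "(\<Sum>(_,k)\<in>q. norm (y (Sup k) - y (Inf k))) = (\<Sum>(_,k)\<in>q. ?g k)"
          using ne by (intro sum.cong) auto
        also have "\<dots> = sum ?g (snd ` q)"
        proof (rule sum.over_tagged_division_lemma[OF td])
          fix u w :: real assume "box u w = {}"
          then have "w \<le> u" by (simp add: box_real)
          then show "?g (cbox u w) = 0" by (cases "u = w") auto
        qed
        also have "\<dots> = (\<Sum>k\<in>snd ` q. norm (y (Sup k) - y (Inf k)))"
          using ne by (intro sum.cong) auto
        finally show ?thesis .
      qed
      ultimately have A: "(\<Sum>(_,k)\<in>q. norm (y (Sup k) - y (Inf k))) < e0 / 2" by simp
      have B: "norm (measure lborel K *\<^sub>R v0 x - (y (Sup K) - y (Inf K))) \<le> e * (Sup K - Inf K)"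
        if xK: "(x, K) \<in> p - q" for x K
      proof -
        have "x \<in> K" "x \<notin> N" and kab: "K \<subseteq> cbox a b"
          using p xK by (auto simp: q_def)
        obtain u w where k: "K = cbox u w"
          using tagged_division_ofD(4)[OF p, of x K] xK by auto
        have "u \<le> w"
          using \<open>x \<in> K\<close> unfolding k by auto
        have ball: "\<forall>y\<in>K. y \<in> ball x (d x)"
          using fine xK \<open>x \<notin> N\<close> by (fastforce simp: fine_def G_def)
        have uw: "u \<in> K" "w \<in> K"
          by (simp_all add: \<open>u \<le> w\<close> k)
        have "norm ((w - u) *\<^sub>R v x - (y w - y u)) = norm (y u - y x - (u - x) *\<^sub>R v x - (y w - y x - (w - x) *\<^sub>R v x))"
          by (auto simp: algebra_simps)
        also have "\<dots> \<le> norm (y u - y x - (u - x) *\<^sub>R v x) + norm (y w - y x - (w - x) *\<^sub>R v x)"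
          by (rule norm_triangle_ineq4)
        also have "\<dots> \<le> e * norm (u - x) + e * norm (w - x)"
          using uw \<open>x \<in> K\<close> \<open>x \<notin> N\<close> kab ball by (intro add_mono d) (auto simp: dist_real_def)
        also have "\<dots> \<le> e * (Sup K - Inf K)"
          using \<open>x \<in> K\<close> by (auto simp: k interval_bounds_real[OF \<open>u \<le> w\<close>] field_simps)
        finally show ?thesis
          using \<open>u \<le> w\<close> \<open>x \<notin> N\<close> by (simp add: k v0_def)
      qed
      have nn: "0 \<le> Sup K - Inf K" if xK: "(x, K) \<in> p" for x K
      proof -
        obtain u w where "K = cbox u w" "x \<in> K"
          using tagged_division_ofD(2,4)[OF p xK] by auto
        then show ?thesis by (auto simp: interval_bounds_real)
      qed
      have tot: "(\<Sum>(x,K)\<in>p. Sup K - Inf K) = b - a"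
        using additive_tagged_division_1[OF \<open>a \<le> b\<close>, where f= "\<lambda>x. x"] p by auto
      have split: "sum F p = sum F q + sum F (p - q)" for F :: "(real \<times> real set) \<Rightarrow> 'b::comm_monoid_add"
        using qp \<open>finite p\<close> by (metis add.commute sum.subset_diff)
      have "(\<Sum>(x,k)\<in>p. measure lborel k *\<^sub>R v0 x) - (y b - y a) =
          (\<Sum>(x,k)\<in>p. measure lborel k *\<^sub>R v0 x - (y (Sup k) - y (Inf k)))"
        using additive_tagged_division_1[OF \<open>a \<le> b\<close>, where f= y] p
        by (auto simp: split_def sum_subtractf)
      also have "norm \<dots> \<le> (\<Sum>(x,k)\<in>p. norm (measure lborel k *\<^sub>R v0 x - (y (Sup k) - y (Inf k))))"
        unfolding split_def by (rule norm_sum)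
      also have "\<dots> = (\<Sum>(x,k)\<in>q. norm (measure lborel k *\<^sub>R v0 x - (y (Sup k) - y (Inf k))))
           + (\<Sum>(x,k)\<in>p - q. norm (measure lborel k *\<^sub>R v0 x - (y (Sup k) - y (Inf k))))"
        by (rule split)
      also have "(\<Sum>(x,k)\<in>q. norm (measure lborel k *\<^sub>R v0 x - (y (Sup k) - y (Inf k))))
          = (\<Sum>(x,k)\<in>q. norm (y (Sup k) - y (Inf k)))"
        by (rule sum.cong) (auto simp: q_def v0_def norm_minus_commute)
      also have "(\<Sum>(x,k)\<in>p - q. norm (measure lborel k *\<^sub>R v0 x - (y (Sup k) - y (Inf k))))
          \<le> (\<Sum>(x,k)\<in>p - q. e * (Sup k - Inf k))"
        using B by (intro sum_mono) auto
      also have "\<dots> \<le> (\<Sum>(x,k)\<in>p. e * (Sup k - Inf k))"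
        using \<open>finite p\<close> nn e(1) by (intro sum_mono2) auto
      also have "\<dots> = e * (b - a)"
        unfolding tot[symmetric] by (simp add: sum_distrib_left split_def)
      finally show ?thesis using A e(2) by linarith
    qed
    show "\<exists>\<gamma>. gauge \<gamma> \<and> (\<forall>\<D>. \<D> tagged_division_of cbox a b \<and> \<gamma> fine \<D> \<longrightarrow>
        norm ((\<Sum>(x,k)\<in>\<D>. measure lborel k *\<^sub>R v0 x) - (y b - y a)) < e0)"
      by (intro exI[of _ G] conjI allI impI G main) simp_all
  qed
  then have "(v0 has_integral (y b - y a)) {a..b}" by simp
  then show ?thesis
    by (rule has_integral_spike[OF N, rotated]) (auto simp: v0_def)
qed

text \<open>
  A Lebesgue differentiation theorem. At a point of \<open>bad \<eta>\<close>, arbitrarily short intervals ending at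
  that point violate the derivative approximation by more than \<open>\<eta>\<close> times their length. By Vitali
  these intervals contain a disjoint family covering \<open>bad \<eta>\<close> up to a null set; tagged at the bad
  points, its finite subfamilies are fine partial divisions, and Henstock's lemma makes the sum of
  their defects, hence their total length, arbitrarily small.
\<close>

lemma indefinite_integral_ae_differentiable:
  fixes v :: "real \<Rightarrow> 'a::euclidean_space"
  assumes v: "v integrable_on {a..b}"
  shows "negligible {t \<in> {a<..<b}. \<not> ((\<lambda>t. integral {a..t} v) has_vector_derivative v t) (at t)}"
proof -
  define J where "J t s = integral {a..s} v - integral {a..t} v - (s - t) *\<^sub>R v t" for t s
  define bad where "bad \<eta> = {t \<in> {a<..<b}. \<forall>d>0. \<exists>s\<in>{a..b}. s \<noteq> t \<and> \<bar>s - t\<bar> < d \<and> norm (J t s) > \<eta> * \<bar>s - t\<bar>}"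
    for \<eta> :: real
  have neg: "negligible (bad \<eta>)" if "\<eta> > 0" for \<eta>
    unfolding negligible_outer_le
  proof (intro allI impI)
    fix e :: real assume "e > 0"
    have vc: "v integrable_on cbox a b" using v by simp
    have e\<eta>: "e * \<eta> > 0" using that \<open>e > 0\<close> by simp
    obtain G where G: "gauge G" and hen: "\<And>p. \<lbrakk>p tagged_partial_division_of (cbox a b); G fine p\<rbrakk> \<Longrightarrow>
             sum (\<lambda>(x,k). norm(measure lborel k *\<^sub>R v x - integral k v)) p < e * \<eta>"
    proof (rule Henstock_lemma[OF vc e\<eta>])
      fix G' assume "gauge G'" and G': "\<And>p. \<lbrakk>p tagged_partial_division_of (cbox a b); G' fine p\<rbrakk> \<Longrightarrow>
             sum (\<lambda>(x,k). norm(measure lborel k *\<^sub>R v x - integral k v)) p < e * \<eta>"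
      show ?thesis
      proof (rule that)
        show "gauge G'" by fact
        show "sum (\<lambda>(x,k). norm(measure lborel k *\<^sub>R v x - integral k v)) p < e * \<eta>"
          if "p tagged_partial_division_of (cbox a b)" "G' fine p" for p
          using that by (rule G')
      qed
    qed
    have "\<forall>t. \<exists>\<rho>>0. ball t \<rho> \<subseteq> G t"
      using G by (meson gauge_def openE)
    then obtain \<rho> where \<rho>: "\<And>t. \<rho> t > 0" "\<And>t. ball t (\<rho> t) \<subseteq> G t" by metis
    define K where "K = {(t, s). t \<in> {a<..<b} \<and> s \<in> {a..b} \<and> s \<noteq> t \<and> \<bar>s - t\<bar> < \<rho> t \<and> norm (J t s) > \<eta> * \<bar>s - t\<bar>}"
    \<comment> \<open>The interval between \<open>t\<close> and \<open>s\<close>, written as a ball for the covering theorem.\<close>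
    define c where "c = (\<lambda>(t, s). (t + s) / 2 :: real)"
    define R where "R = (\<lambda>(t, s). \<bar>s - t\<bar> / 2 :: real)"
    have cb: "cball (c (t,s)) (R (t,s)) = cbox (min t s) (max t s)" for t s
      by (auto simp: c_def R_def cball_def dist_real_def abs_if field_simps min_def max_def)
    obtain C where C: "countable C" "C \<subseteq> K"
       "pairwise (\<lambda>i j. disjnt (cball (c i) (R i)) (cball (c j) (R j))) C"
       "negligible (bad \<eta> - (\<Union>i\<in>C. cball (c i) (R i)))"
    proof (rule Vitali_covering_theorem_cballs)
      show "0 < R i" if "i \<in> K" for i using that by (auto simp: K_def R_def)
      show "\<exists>i. i \<in> K \<and> x \<in> cball (c i) (R i) \<and> R i < d" if x: "x \<in> bad \<eta>" and d: "0 < d" for x d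
      proof -
        obtain s where "s \<in> {a..b}" "s \<noteq> x" "\<bar>s - x\<bar> < min d (\<rho> x)" "norm (J x s) > \<eta> * \<bar>s - x\<bar>"
          using x d \<rho>(1)[of x] unfolding bad_def by (auto dest!: spec[of _ "min d (\<rho> x)"])
        then show ?thesis
          using x by (intro exI[of _ "(x,s)"]) (auto simp: K_def cb bad_def, simp add: R_def)
      qed
    qed auto
    have fin: "measure lebesgue (\<Union>i\<in>C'. cball (c i) (R i)) \<le> e" if C': "C' \<subseteq> C" "finite C'" for C'
    proof -
      define P where "P = (\<lambda>i. (fst i, cball (c i) (R i)))"
      have K': "i \<in> K" if "i \<in> C'" for i using that C C' by auto
      have disj: "cball (c i) (R i) \<inter> cball (c j) (R j) = {}" if "i \<in> C'" "j \<in> C'" "i \<noteq> j" for i j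
        using C(3) C' that unfolding pairwise_def disjnt_def by blast
      have mem: "fst i \<in> cball (c i) (R i)" for i
        using cb[of "fst i" "snd i"] by simp
      have inj: "inj_on P C'"
      proof (rule inj_onI)
        fix i j assume ij: "i \<in> C'" "j \<in> C'" "P i = P j"
        then show "i = j" using disj[of i j] mem[of i] unfolding P_def by (metis Int_iff empty_iff prod.inject)
      qed
      have td: "P ` C' tagged_partial_division_of cbox a b"
        unfolding tagged_partial_division_of_def
      proof (intro conjI allI impI; (elim conjE)?)
        show "finite (P ` C')" using C' by simp
      next
        fix x k assume "(x, k) \<in> P ` C'"
        then obtain i where i: "i \<in> C'" "x = fst i" "k = cball (c i) (R i)" by (auto simp: P_def)
        show "x \<in> k" using i mem by simp
        show "\<exists>a b. k = cbox a b" using i cb[of "fst i" "snd i"] by auto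
        show "k \<subseteq> cbox a b" using i K'[OF i(1)] cb[of "fst i" "snd i"] by (auto simp: K_def)
      next
        fix x1 k1 x2 k2 assume "(x1, k1) \<in> P ` C'" "(x2, k2) \<in> P ` C'" "(x1, k1) \<noteq> (x2, k2)"
        then obtain i j where "i \<in> C'" "j \<in> C'" "i \<noteq> j" "k1 = cball (c i) (R i)" "k2 = cball (c j) (R j)"
          by (auto simp: P_def)
        then show "interior k1 \<inter> interior k2 = {}"
          using disj[of i j] interior_subset by blast
      qed
      have fine: "G fine P ` C'"
      proof (rule fineI)
        fix x k assume "(x, k) \<in> P ` C'"
        then obtain i where i: "i \<in> C'" "x = fst i" "k = cball (c i) (R i)" by (auto simp: P_def)
        obtain s where s: "i = (x, s)" using i by (cases i) auto
        have "k \<subseteq> ball x (\<rho> x)"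
          unfolding i(3) s cb using K'[OF i(1)] s by (auto simp: K_def dist_real_def)
        then show "k \<subseteq> G x" using \<rho>(2) by blast
      qed
      have key: "\<eta> * measure lebesgue (cball (c i) (R i))
          \<le> norm (measure lborel (cball (c i) (R i)) *\<^sub>R v (fst i) - integral (cball (c i) (R i)) v)" if i: "i \<in> C'" for i
      proof -
        obtain t s where ts: "i = (t, s)" by (cases i)
        have k: "t \<in> {a<..<b}" "s \<in> {a..b}" "norm (J t s) > \<eta> * \<bar>s - t\<bar>"
          using K'[OF i] ts by (auto simp: K_def)
        have comb: "integral {p..q} v = integral {a..q} v - integral {a..p} v" if "a \<le> p" "p \<le> q" "q \<le> b" for p q
          using Henstock_Kurzweil_Integration.integral_combine[OF that(1,2), of v]
            integrable_on_subinterval[OF v, of a q] that by (auto simp: algebra_simps)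
        have "norm (measure lborel (cbox (min t s) (max t s)) *\<^sub>R v t - integral (cbox (min t s) (max t s)) v) = norm (J t s)"
        proof (cases "t \<le> s")
          case True
          then show ?thesis using k comb[of t s]
            by (simp add: J_def min_def max_def norm_minus_commute)
        next
          case False
          then have "integral {s..t} v = integral {a..t} v - integral {a..s} v" using k comb[of s t] by simp
          then have "(t - s) *\<^sub>R v t - integral {s..t} v = J t s"
            unfolding J_def by (simp add: algebra_simps)
          then show ?thesis using False
            by (simp add: min_def max_def)
        qed
        moreover have "measure lebesgue (cbox (min t s) (max t s)) = \<bar>s - t\<bar>"
          by (simp add: min_def max_def)
        ultimately show ?thesis using k unfolding ts cb by auto
      qed
      have "\<eta> * measure lebesgue (\<Union>i\<in>C'. cball (c i) (R i)) \<le> \<eta> * (\<Sum>i\<in>C'. measure lebesgue (cball (c i) (R i)))"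
        using that \<open>\<eta> > 0\<close> by (intro mult_left_mono measure_UNION_le) auto
      also have "\<dots> \<le> (\<Sum>i\<in>C'. norm (measure lborel (cball (c i) (R i)) *\<^sub>R v (fst i) - integral (cball (c i) (R i)) v))"
        unfolding sum_distrib_left by (intro sum_mono key)
      also have "\<dots> = sum (\<lambda>(x,k). norm(measure lborel k *\<^sub>R v x - integral k v)) (P ` C')"
        using inj by (simp add: sum.reindex P_def)
      also have "\<dots> < e * \<eta>" by (rule hen[OF td fine])
      finally show ?thesis using \<open>\<eta> > 0\<close> by (simp add: mult.commute)
    qed
    define W where "W = (\<Union>i\<in>C. cball (c i) (R i))"
    have W: "W \<in> lmeasurable" "measure lebesgue W \<le> e"
      unfolding W_def
      using fmeasurable_UN_bound[OF C(1), of "\<lambda>i. cball (c i) (R i)" lebesgue e]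
        measure_UN_bound[OF C(1), of "\<lambda>i. cball (c i) (R i)" lebesgue e] fin by auto
    show "\<exists>T. bad \<eta> \<subseteq> T \<and> T \<in> lmeasurable \<and> measure lebesgue T \<le> e"
    proof (intro exI conjI)
      show "bad \<eta> \<subseteq> W \<union> (bad \<eta> - W)" by auto
      have n: "negligible (bad \<eta> - W)" using C(4) by (simp add: W_def)
      then show "W \<union> (bad \<eta> - W) \<in> lmeasurable"
        using W negligible_imp_measurable by blast
      show "measure lebesgue (W \<union> (bad \<eta> - W)) \<le> e"
        using W n measure_Un_le[of W lebesgue "bad \<eta> - W"] negligible_imp_measure0[OF n]
          negligible_imp_measurable[OF n] by (auto simp: fmeasurableD)
    qed
  qed
  have "{t \<in> {a<..<b}. \<not> ((\<lambda>t. integral {a..t} v) has_vector_derivative v t) (at t)} \<subseteq> (\<Union>n. bad (1 / real (Suc n)))"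
  proof (rule subsetI, rule ccontr)
    fix t assume t: "t \<in> {t \<in> {a<..<b}. \<not> ((\<lambda>t. integral {a..t} v) has_vector_derivative v t) (at t)}"
      and nb: "t \<notin> (\<Union>n. bad (1 / real (Suc n)))"
    have "((\<lambda>t. integral {a..t} v) has_vector_derivative v t) (at t)"
      unfolding has_vector_derivative_def has_derivative_at_alt
    proof (intro conjI allI impI)
      show "bounded_linear (\<lambda>x. x *\<^sub>R v t)" by (rule bounded_linear_scaleR_left)
      fix e :: real assume "e > 0"
      then obtain n where n: "1 / real (Suc n) < e" using nat_approx_posE by blast
      obtain d where d: "d > 0" "\<And>s. s \<in> {a..b} \<Longrightarrow> s \<noteq> t \<Longrightarrow> \<bar>s - t\<bar> < d \<Longrightarrow> norm (J t s) \<le> 1 / real (Suc n) * \<bar>s - t\<bar>"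
      proof -
        have "t \<notin> bad (1 / real (Suc n))" using nb by blast
        then show ?thesis using t that unfolding bad_def mem_Collect_eq by (auto simp: not_less; metis not_less)
      qed
      show "\<exists>d>0. \<forall>s. norm (s - t) < d \<longrightarrow>
         norm (integral {a..s} v - integral {a..t} v - (s - t) *\<^sub>R v t) \<le> e * norm (s - t)"
      proof (intro exI[of _ "min d (min (t - a) (b - t))"] conjI allI impI)
        show "0 < min d (min (t - a) (b - t))" using d t by auto
        fix s assume s: "norm (s - t) < min d (min (t - a) (b - t))"
        show "norm (integral {a..s} v - integral {a..t} v - (s - t) *\<^sub>R v t) \<le> e * norm (s - t)"
        proof (cases "s = t")
          case False
          have "norm (J t s) \<le> 1 / real (Suc n) * \<bar>s - t\<bar>" using s False by (intro d) auto
          also have "\<dots> \<le> e * \<bar>s - t\<bar>" using n by (intro mult_right_mono) auto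
          finally show ?thesis by (simp add: J_def)
        qed simp
      qed
    qed
    then show False using t by simp
  qed
  moreover have "negligible (\<Union>n. bad (1 / real (Suc n)))"
    by (intro negligible_countable_Union) (auto intro: neg)
  ultimately show ?thesis by (rule negligible_subset[rotated])
qed

lemma abs_continuous_on_ident: "abs_continuous_on S (\<lambda>t::real. t)"
  unfolding abs_continuous_on_def
proof (intro allI impI exI conjI)
  fix e :: real and \<D> assume "0 < e" and D: "\<D> division_of \<Union>\<D>" and le: "(\<Sum>k\<in>\<D>. Sup k - Inf k) < e"
  have "norm (Sup k - Inf k) = Sup k - Inf k" if k: "k \<in> \<D>" for k
  proof -
    obtain u v where "k = cbox u v" "k \<noteq> {}" using division_ofD(3,4)[OF D k] by auto
    then show ?thesis by (auto simp: interval_bounds_real)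
  qed
  with le show "(\<Sum>k\<in>\<D>. norm (Sup k - Inf k)) < e" by (simp cong: sum.cong)
qed auto

text \<open>
  One comparison covers sums, differences, squares of norms and, with the identity in place of
  \<open>y1\<close> and \<open>y2\<close>, Lipschitz functions.
\<close>

lemma abs_continuous_on_dominated:
  assumes y1: "abs_continuous_on S y1" and y2: "abs_continuous_on S y2" and "C \<ge> 0"
    and le: "\<And>s t. s \<in> S \<Longrightarrow> t \<in> S \<Longrightarrow> norm (z s - z t) \<le> C * (norm (y1 s - y1 t) + norm (y2 s - y2 t))"
  shows "abs_continuous_on S z"
  unfolding abs_continuous_on_def
proof (intro allI impI)
  fix e :: real assume "0 < e"
  define e' where "e' = e / (C + 1) / 2"
  have e': "e' > 0" "C * (e' + e') < e"
  proof -
    have "e' + e' = e / (C + 1)" unfolding e'_def by (rule field_sum_of_halves)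
    then show "C * (e' + e') < e" using \<open>0 < e\<close> \<open>C \<ge> 0\<close> by (simp add: divide_less_eq algebra_simps)
    show "e' > 0" using \<open>0 < e\<close> \<open>C \<ge> 0\<close> by (simp add: e'_def)
  qed
  obtain d1 where d1: "d1 > 0" "\<And>\<D>. \<lbrakk>\<D> division_of \<Union>\<D>; \<Union>\<D> \<subseteq> S; (\<Sum>k\<in>\<D>. Sup k - Inf k) < d1\<rbrakk>
      \<Longrightarrow> (\<Sum>k\<in>\<D>. norm (y1 (Sup k) - y1 (Inf k))) < e'"
    using y1[unfolded abs_continuous_on_def, rule_format, OF e'(1)] by auto
  obtain d2 where d2: "d2 > 0" "\<And>\<D>. \<lbrakk>\<D> division_of \<Union>\<D>; \<Union>\<D> \<subseteq> S; (\<Sum>k\<in>\<D>. Sup k - Inf k) < d2\<rbrakk>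
      \<Longrightarrow> (\<Sum>k\<in>\<D>. norm (y2 (Sup k) - y2 (Inf k))) < e'"
    using y2[unfolded abs_continuous_on_def, rule_format, OF e'(1)] by auto
  show "\<exists>\<delta>>0. \<forall>\<D>. \<D> division_of \<Union>\<D> \<longrightarrow> \<Union>\<D> \<subseteq> S \<longrightarrow> (\<Sum>k\<in>\<D>. Sup k - Inf k) < \<delta> \<longrightarrow>
        (\<Sum>k\<in>\<D>. norm (z (Sup k) - z (Inf k))) < e"
  proof (intro exI[of _ "min d1 d2"] conjI allI impI)
    fix \<D> assume D: "\<D> division_of \<Union>\<D>" "\<Union>\<D> \<subseteq> S" and len: "(\<Sum>k\<in>\<D>. Sup k - Inf k) < min d1 d2"
    have "(\<Sum>k\<in>\<D>. norm (z (Sup k) - z (Inf k)))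
        \<le> (\<Sum>k\<in>\<D>. C * (norm (y1 (Sup k) - y1 (Inf k)) + norm (y2 (Sup k) - y2 (Inf k))))"
    proof (rule sum_mono)
      fix k assume k: "k \<in> \<D>"
      obtain u v where "k = cbox u v" "k \<noteq> {}" using division_ofD(3,4)[OF D(1) k] by auto
      then have "Sup k \<in> k" "Inf k \<in> k" by (auto simp: interval_bounds_real)
      then show "norm (z (Sup k) - z (Inf k)) \<le> C * (norm (y1 (Sup k) - y1 (Inf k)) + norm (y2 (Sup k) - y2 (Inf k)))"
        using k D(2) by (intro le) auto
    qed
    also have "\<dots> = C * ((\<Sum>k\<in>\<D>. norm (y1 (Sup k) - y1 (Inf k))) + (\<Sum>k\<in>\<D>. norm (y2 (Sup k) - y2 (Inf k))))"
      by (simp add: sum_distrib_left sum.distrib distrib_left)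
    also have "\<dots> \<le> C * (e' + e')"
      using d1(2)[OF D] d2(2)[OF D] len \<open>C \<ge> 0\<close> by (intro mult_left_mono add_mono) auto
    finally show "(\<Sum>k\<in>\<D>. norm (z (Sup k) - z (Inf k))) < e" using e'(2) by linarith
  qed (use d1 d2 in auto)
qed

text \<open>
  Exceptional sets are easier to combine as explicit negligible sets than through the almost
  everywhere quantifier.
\<close>

lemma has_ac_derivative_on_iff:
  assumes "I \<in> sets lebesgue"
  shows "has_ac_derivative_on I y v \<longleftrightarrow> (\<forall>a b. {a..b} \<subseteq> I \<longrightarrow> abs_continuous_on {a..b} y) \<and>
     (\<exists>N. negligible N \<and> (\<forall>t\<in>I - N. (y has_vector_derivative v t) (at t within I)))"
proof -
  have "(AE t in lebesgue_on I. (y has_vector_derivative v t) (at t within I)) \<longleftrightarrow>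
     (\<exists>N. negligible N \<and> (\<forall>t\<in>I - N. (y has_vector_derivative v t) (at t within I)))"
    (is "?L \<longleftrightarrow> ?R")
  proof
    assume ?L
    then have "AE t in lebesgue. t \<in> I \<longrightarrow> (y has_vector_derivative v t) (at t within I)"
      using assms by (simp add: AE_restrict_space_iff)
    then obtain N where "N \<in> null_sets lebesgue"
        "{t \<in> space lebesgue. \<not> (t \<in> I \<longrightarrow> (y has_vector_derivative v t) (at t within I))} \<subseteq> N"
      unfolding eventually_ae_filter by auto
    then show ?R by (intro exI[of _ N]) (auto simp: negligible_iff_null_sets)
  next
    assume ?R
    then obtain N where N: "N \<in> null_sets lebesgue" "\<forall>t\<in>I - N. (y has_vector_derivative v t) (at t within I)"
      by (auto simp: negligible_iff_null_sets)
    then have "AE t in lebesgue. t \<in> I \<longrightarrow> (y has_vector_derivative v t) (at t within I)"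
      by (intro AE_I'[of N]) auto
    then show ?L using assms by (simp add: AE_restrict_space_iff)
  qed
  then show ?thesis unfolding has_ac_derivative_on_def by simp
qed

lemma has_ac_derivative_on_has_integral:
  fixes y :: "real \<Rightarrow> 'a::euclidean_space"
  assumes y: "has_ac_derivative_on I y v" and I: "I \<in> sets lebesgue" "{a..b} \<subseteq> I" and "a \<le> b"
  shows "(v has_integral (y b - y a)) {a..b}"
proof -
  obtain N where "negligible N" "\<forall>t\<in>I - N. (y has_vector_derivative v t) (at t within I)"
    using y I(1) by (auto simp: has_ac_derivative_on_iff)
  moreover have "abs_continuous_on {a..b} y" using y I(2) by (auto simp: has_ac_derivative_on_def)
  ultimately show ?thesis
    using \<open>a \<le> b\<close> I(2) has_vector_derivative_within_subset[OF _ I(2)]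
    by (intro has_integral_ac_derivative[of a b y N v]) blast+
qed

lemma has_ac_derivative_on_combine:
  fixes y1 y2 :: "real \<Rightarrow> 'a::euclidean_space"
  assumes 1: "has_ac_derivative_on I y1 v1" and 2: "has_ac_derivative_on J y2 v2"
    and I: "K \<subseteq> I" "K \<subseteq> J" "I \<in> sets lebesgue" "J \<in> sets lebesgue" "K \<in> sets lebesgue"
  shows "has_ac_derivative_on K (\<lambda>t. y1 t + y2 t) (\<lambda>t. v1 t + v2 t)" (is ?A)
    and "has_ac_derivative_on K (\<lambda>t. y1 t - y2 t) (\<lambda>t. v1 t - v2 t)" (is ?B)
proof -
  obtain N1 where N1: "negligible N1" "\<forall>t\<in>I - N1. (y1 has_vector_derivative v1 t) (at t within I)"
    using 1 I by (auto simp: has_ac_derivative_on_iff)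
  obtain N2 where N2: "negligible N2" "\<forall>t\<in>J - N2. (y2 has_vector_derivative v2 t) (at t within J)"
    using 2 I by (auto simp: has_ac_derivative_on_iff)
  have N: "negligible (N1 \<union> N2)" using N1 N2 by auto
  have ac: "abs_continuous_on {a..b} y1" "abs_continuous_on {a..b} y2" if "{a..b} \<subseteq> K" for a b
    using 1 2 I that by (auto simp: has_ac_derivative_on_def)
  have d: "(y1 has_vector_derivative v1 t) (at t within K)" "(y2 has_vector_derivative v2 t) (at t within K)"
    if "t \<in> K - (N1 \<union> N2)" for t
    using N1 N2 I that by (auto intro: has_vector_derivative_within_subset)
  have "abs_continuous_on {a..b} (\<lambda>t. y1 t + y2 t)" if "{a..b} \<subseteq> K" for a b
  proof (rule abs_continuous_on_dominated[OF ac[OF that], of 1])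
    fix s t
    have "y1 s + y2 s - (y1 t + y2 t) = (y1 s - y1 t) + (y2 s - y2 t)" by simp
    then show "norm (y1 s + y2 s - (y1 t + y2 t)) \<le> 1 * (norm (y1 s - y1 t) + norm (y2 s - y2 t))"
      by (metis mult_1 norm_triangle_ineq)
  qed simp
  then show ?A using has_vector_derivative_add[OF d] N
    unfolding has_ac_derivative_on_iff[OF I(5)] by blast
  have "abs_continuous_on {a..b} (\<lambda>t. y1 t - y2 t)" if "{a..b} \<subseteq> K" for a b
  proof (rule abs_continuous_on_dominated[OF ac[OF that], of 1])
    fix s t
    have "y1 s - y2 s - (y1 t - y2 t) = (y1 s - y1 t) - (y2 s - y2 t)" by simp
    then show "norm (y1 s - y2 s - (y1 t - y2 t)) \<le> 1 * (norm (y1 s - y1 t) + norm (y2 s - y2 t))"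
      by (metis mult_1 norm_triangle_ineq4)
  qed simp
  then show ?B using has_vector_derivative_diff[OF d] N
    unfolding has_ac_derivative_on_iff[OF I(5)] by blast
qed

lemma has_ac_derivative_on_power2_norm:
  fixes y :: "real \<Rightarrow> 'a::euclidean_space"
  assumes y: "has_ac_derivative_on I y v" and cont: "continuous_on I y" and I: "I \<in> sets lebesgue"
  shows "has_ac_derivative_on I (\<lambda>t. (norm (y t))\<^sup>2) (\<lambda>t. 2 * inner (y t) (v t))"
proof -
  obtain N where N: "negligible N" "\<forall>t\<in>I - N. (y has_vector_derivative v t) (at t within I)"
    using y I by (auto simp: has_ac_derivative_on_iff)
  have "((\<lambda>t. (norm (y t))\<^sup>2) has_vector_derivative 2 * inner (y t) (v t)) (at t within I)" if "t \<in> I - N" for t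
  proof -
    have "((\<lambda>t. inner (y t) (y t)) has_derivative (\<lambda>h. inner (y t) (h *\<^sub>R v t) + inner (h *\<^sub>R v t) (y t))) (at t within I)"
      using N that unfolding has_vector_derivative_def by (intro has_derivative_inner) auto
    then show ?thesis
      unfolding has_vector_derivative_def power2_norm_eq_inner
      by (rule has_derivative_eq_rhs) (auto simp: inner_commute)
  qed
  moreover have "abs_continuous_on {a..b} (\<lambda>t. (norm (y t))\<^sup>2)" if ab: "{a..b} \<subseteq> I" for a b
  proof -
    have "compact (y ` {a..b})"
      using cont ab by (intro compact_continuous_image) (auto intro: continuous_on_subset)
    then obtain C where C: "C > 0" "\<And>t. t \<in> {a..b} \<Longrightarrow> norm (y t) \<le> C"
      using compact_imp_bounded bounded_pos by (metis image_eqI)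
    have ac: "abs_continuous_on {a..b} y" using y ab by (auto simp: has_ac_derivative_on_def)
    show ?thesis
    proof (rule abs_continuous_on_dominated[OF ac ac, of C])
      fix s t assume st: "s \<in> {a..b}" "t \<in> {a..b}"
      have "norm ((norm (y s))\<^sup>2 - (norm (y t))\<^sup>2) = \<bar>norm (y s) - norm (y t)\<bar> * (norm (y s) + norm (y t))"
        by (simp add: power2_eq_square square_diff_square_factored abs_mult mult.commute)
      also have "\<dots> \<le> norm (y s - y t) * (C + C)"
        using C(2) st by (intro mult_mono add_mono norm_triangle_ineq3) auto
      finally show "norm ((norm (y s))\<^sup>2 - (norm (y t))\<^sup>2) \<le> C * (norm (y s - y t) + norm (y s - y t))"
        by (simp add: algebra_simps)
    qed (use C in auto)
  qed
  ultimately show ?thesis using N(1) I by (auto simp: has_ac_derivative_on_iff)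
qed

text \<open>
  The integral of a bounded function is Lipschitz, hence absolutely continuous. The left end point
  of the half-open interval joins the exceptional set, because Lebesgue differentiation is two-sided.
\<close>

lemma has_ac_derivative_on_indefinite_integral:
  fixes q :: "real \<Rightarrow> 'a::euclidean_space"
  assumes ab: "a < b" and q: "q integrable_on {a..b}" and C: "\<And>t. t \<in> {a..b} \<Longrightarrow> norm (q t) \<le> C"
  shows "has_ac_derivative_on {a..<b} (\<lambda>t. c + integral {a..t} q) q"
proof -
  have C0: "C \<ge> 0" using C[of a] ab by (auto intro: order_trans[OF norm_ge_zero])
  have lip: "norm (integral {a..s} q - integral {a..t} q) \<le> C * \<bar>s - t\<bar>" if st: "a \<le> t" "t \<le> s" "s \<le> b" for s t
  proof -
    have i: "q integrable_on {u..w}" if "a \<le> u" "w \<le> b" for u w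
      using q that by (auto intro: integrable_on_subinterval)
    have "integral {a..s} q - integral {a..t} q = integral {t..s} q"
      using Henstock_Kurzweil_Integration.integral_combine[of a t s q] i[of a s] st by (simp add: algebra_simps)
    also have "norm \<dots> \<le> integral {t..s} (\<lambda>_. C)"
      using st i[of t s] C by (intro Henstock_Kurzweil_Integration.integral_norm_bound_integral) auto
    finally show ?thesis using st by (simp add: mult.commute)
  qed
  have ac: "abs_continuous_on {u..w} (\<lambda>t. c + integral {a..t} q)" if "{u..w} \<subseteq> {a..<b}" for u w
  proof (rule abs_continuous_on_dominated[OF abs_continuous_on_ident abs_continuous_on_ident C0])
    fix s t assume "s \<in> {u..w}" "t \<in> {u..w}"
    then have "s \<in> {a..b}" "t \<in> {a..b}" using that by auto
    then have "norm (integral {a..s} q - integral {a..t} q) \<le> C * \<bar>s - t\<bar>"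
      using lip[of t s] lip[of s t] by (cases "t \<le> s") (auto simp: norm_minus_commute abs_minus_commute)
    also have "\<dots> \<le> C * (norm (s - t) + norm (s - t))" using C0 by (intro mult_left_mono) auto
    finally show "norm (c + integral {a..s} q - (c + integral {a..t} q)) \<le> C * (norm (s - t) + norm (s - t))"
      by simp
  qed
  let ?N = "insert a {t \<in> {a<..<b}. \<not> ((\<lambda>t. integral {a..t} q) has_vector_derivative q t) (at t)}"
  have "negligible ?N" using indefinite_integral_ae_differentiable[OF q] by simp
  moreover have "((\<lambda>t. c + integral {a..t} q) has_vector_derivative q t) (at t within {a..<b})" if "t \<in> {a..<b} - ?N" for t
  proof -
    have "((\<lambda>t. integral {a..t} q) has_vector_derivative q t) (at t within {a..<b})"
      using that by (auto intro: has_vector_derivative_at_within)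
    then show ?thesis using has_vector_derivative_add[OF has_vector_derivative_const] by fastforce
  qed
  ultimately show ?thesis using ac by (subst has_ac_derivative_on_iff) (auto intro!: exI[of _ ?N])
qed

lemma has_ac_derivative_on_cong:
  assumes y: "has_ac_derivative_on I y v" and I: "I \<in> sets lebesgue"
    and eq: "\<And>t. t \<in> I \<Longrightarrow> y' t = y t" "\<And>t. t \<in> I \<Longrightarrow> v' t = v t"
  shows "has_ac_derivative_on I y' v'"
proof -
  obtain N where N: "negligible N" "\<forall>t\<in>I - N. (y has_vector_derivative v t) (at t within I)"
    using y I by (auto simp: has_ac_derivative_on_iff)
  have "(y' has_vector_derivative v' t) (at t within I)" if "t \<in> I - N" for t
    using has_vector_derivative_transform[of t I y' y "v t"] N(2) that eq by auto
  moreover have "abs_continuous_on {a..b} y'" if "{a..b} \<subseteq> I" for a b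
  proof -
    have ac: "abs_continuous_on {a..b} y" using y that by (auto simp: has_ac_derivative_on_def)
    show ?thesis
    proof (rule abs_continuous_on_dominated[OF ac ac, of 1])
      fix s t assume "s \<in> {a..b}" "t \<in> {a..b}"
      then have "y' s - y' t = y s - y t" using eq(1)[of s] eq(1)[of t] that by (simp add: subset_iff)
      then show "norm (y' s - y' t) \<le> 1 * (norm (y s - y t) + norm (y s - y t))" by simp
    qed simp
  qed
  ultimately show ?thesis using N(1) I by (auto simp: has_ac_derivative_on_iff)
qed

section \<open>Histories and measurability along continuous paths\<close>

lemma apply_history:
  assumes "0 < r" "continuous_on {-r..} x" "0 \<le> t"
  shows "apply_bcontfun (history r x t) \<theta> = x (t + max (-r) (min \<theta> 0))"
proof -
  have "continuous_on {-r..0} (\<lambda>\<theta>. x (t + \<theta>))"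
    using assms by (intro continuous_on_compose2[OF assms(2)] continuous_intros) auto
  then show ?thesis unfolding history_def by (simp add: apply_ext_cont assms)
qed

lemma history_in_C0:
  assumes "0 < r" "continuous_on {-r..} x" "0 \<le> t"
  shows "history r x t \<in> C0 r"
proof -
  have "continuous_on {-r..0} (\<lambda>\<theta>. x (t + \<theta>))"
    using assms by (intro continuous_on_compose2[OF assms(2)] continuous_intros) auto
  then show ?thesis unfolding history_def C0_def by blast
qed

text \<open>
  Makes the difference of two solutions accessible to the Gronwall argument, which is stated for the
  history of a single function.
\<close>

lemma history_diff:
  assumes "0 < r" "continuous_on {-r..} x" "continuous_on {-r..} y" "0 \<le> t"
  shows "history r (\<lambda>s. x s - y s) t = history r x t - history r y t"
  using assms by (intro bcontfun_eqI) (simp add: apply_history continuous_on_diff)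

lemma norm_history_le:
  assumes "0 < r" "continuous_on {-r..} x" "0 \<le> t" "\<And>s. s \<in> {t-r..t} \<Longrightarrow> norm (x s) \<le> M"
  shows "norm (history r x t) \<le> M"
  using assms by (intro norm_bound) (auto simp: apply_history)

lemma history_0_eq_iff:
  assumes "0 < r" "continuous_on {-r..} x" "continuous_on {-r..} y"
  shows "history r x 0 = history r y 0 \<longleftrightarrow> (\<forall>s\<in>{-r..0}. x s = y s)"
proof
  assume eq: "history r x 0 = history r y 0"
  show "\<forall>s\<in>{-r..0}. x s = y s"
  proof
    fix s assume "s \<in> {-r..0}"
    then show "x s = y s" using arg_cong[OF eq, of "\<lambda>f. apply_bcontfun f s"] assms by (simp add: apply_history)
  qed
next
  assume "\<forall>s\<in>{-r..0}. x s = y s"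
  then show "history r x 0 = history r y 0"
    using assms by (intro bcontfun_eqI) (auto simp: apply_history)
qed

text \<open>
  In the sup norm this is uniform continuity of \<open>x\<close> on a compact interval.
\<close>

lemma continuous_on_history:
  assumes "0 < r" and x: "continuous_on {-r..} x"
  shows "continuous_on {0..} (history r x)"
  unfolding continuous_on_iff
proof (intro ballI allI impI)
  fix t e :: real assume t: "t \<in> {0..}" and "0 < e"
  have "uniformly_continuous_on {-r..t + 1} x"
    using x by (intro compact_uniformly_continuous) (auto intro: continuous_on_subset)
  then obtain d where d: "d > 0" "\<And>s s'. s \<in> {-r..t+1} \<Longrightarrow> s' \<in> {-r..t+1} \<Longrightarrow> dist s' s < d \<Longrightarrow> dist (x s') (x s) < e / 2"
    using \<open>0 < e\<close> unfolding uniformly_continuous_on_def by (metis half_gt_zero)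
  have "dist (history r x t') (history r x t) < e" if t': "t' \<in> {0..}" "dist t' t < min d 1" for t'
  proof -
    have "dist (history r x t') (history r x t) \<le> e / 2"
    proof (rule dist_bound)
      fix \<theta>
      show "dist (apply_bcontfun (history r x t') \<theta>) (apply_bcontfun (history r x t) \<theta>) \<le> e / 2"
      proof -
        define m where "m = max (-r) (min \<theta> 0)"
        have "m \<in> {-r..0}" using \<open>0 < r\<close> by (auto simp: m_def)
        then have "dist (x (t' + m)) (x (t + m)) < e / 2"
          using t t' by (intro d(2)) (auto simp: dist_real_def)
        then show ?thesis
          using t t' unfolding m_def by (subst (1 2) apply_history[OF assms]) auto
      qed
    qed
    then show ?thesis using \<open>0 < e\<close> by simp
  qed
  then show "\<exists>d>0. \<forall>t'\<in>{0..}. dist t' t < d \<longrightarrow> dist (history r x t') (history r x t) < e"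
    using d(1) by (intro exI[of _ "min d 1"]) auto
qed

lemma bounded_history_image:
  assumes "0 < r" "continuous_on {-r..} x"
  shows "bounded (history r x ` {0..T})"
  using assms by (intro compact_imp_bounded compact_continuous_image)
    (auto intro: continuous_on_subset[OF continuous_on_history])

text \<open>
  The type of histories is not second countable, so the pair of a path and an input need not be
  measurable for the Borel sets of the product. But along a continuous path \<open>\<phi>\<close> the first argument can be frozen on the cells of a grid of mesh \<open>1 / (n + 1)\<close>,
  which leaves a countable case distinction among functions of \<open>p t\<close> alone; the limit
  \<open>n \<rightarrow> \<infinity>\<close> follows from continuity.
\<close>

lemma borel_measurable_along_path:
  fixes \<phi> :: "real \<Rightarrow> 'c::metric_space" and p :: "real \<Rightarrow> 'p::topological_space"
    and G :: "'c \<times> 'p \<Rightarrow> 'g::metric_space"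
  assumes \<phi>: "continuous_on {0..} \<phi>" "\<And>t. t \<ge> 0 \<Longrightarrow> \<phi> t \<in> C"
    and p: "p \<in> borel_measurable (lebesgue_on {0..})" "\<And>t. t \<ge> 0 \<Longrightarrow> p t \<in> P"
    and G: "continuous_on (C \<times> P) G"
  shows "(\<lambda>t. G (\<phi> t, p t)) \<in> borel_measurable (lebesgue_on {0..})"
proof -
  define grid where "grid n t = real_of_int \<lfloor>real (Suc n) * t\<rfloor> / real (Suc n)" for n t
  have grid0: "grid n t \<ge> 0" if "t \<ge> 0" for n t using that by (simp add: grid_def)
  have grid_lim: "(\<lambda>n. grid n t) \<longlonglongrightarrow> t" for t
  proof (rule tendsto_sandwich)
    show "\<forall>\<^sub>F n in sequentially. t - 1 / real (Suc n) \<le> grid n t"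
    proof (intro always_eventually allI)
      fix n
      have "real (Suc n) * t - 1 \<le> real_of_int \<lfloor>real (Suc n) * t\<rfloor>" by linarith
      then have "(real (Suc n) * t - 1) / real (Suc n) \<le> grid n t"
        unfolding grid_def by (intro divide_right_mono) auto
      moreover have "(real (Suc n) * t - 1) / real (Suc n) = t - 1 / real (Suc n)"
        unfolding diff_divide_distrib by (metis nonzero_mult_div_cancel_left of_nat_neq_0)
      ultimately show "t - 1 / real (Suc n) \<le> grid n t" by linarith
    qed
    show "\<forall>\<^sub>F n in sequentially. grid n t \<le> t"
    proof (intro always_eventually allI)
      fix n
      have "real_of_int \<lfloor>real (Suc n) * t\<rfloor> \<le> real (Suc n) * t" by linarith
      then show "grid n t \<le> t" unfolding grid_def by (simp add: field_simps)
    qed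
    show "(\<lambda>n. t - 1 / real (Suc n)) \<longlonglongrightarrow> t"
      using tendsto_diff[OF tendsto_const LIMSEQ_inverse_real_of_nat, of t] by (simp add: inverse_eq_divide)
  qed simp
  have 1: "(\<lambda>t. G (c, p t)) \<in> borel_measurable (lebesgue_on {0..})" if "c \<in> C" for c
  proof -
    have "continuous_on P (\<lambda>v. G (c, v))"
      using that by (intro continuous_on_compose2[OF G] continuous_intros) auto
    then have "(\<lambda>v. G (c, v)) \<in> borel_measurable (restrict_space borel P)"
      by (rule borel_measurable_continuous_on_restrict)
    moreover have "p \<in> measurable (lebesgue_on {0..}) (restrict_space borel P)"
      using p by (intro measurable_restrict_space2) auto
    ultimately show ?thesis by (rule measurable_compose[rotated])
  qed
  have 2: "(\<lambda>t. \<lfloor>real (Suc n) * t\<rfloor>) \<in> measurable (lebesgue_on {0..}) (count_space UNIV)" for n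
  proof -
    have "(\<lambda>t::real. \<lfloor>real (Suc n) * t\<rfloor>) \<in> measurable borel (count_space UNIV)" by measurable
    then have "(\<lambda>t::real. \<lfloor>real (Suc n) * t\<rfloor>) \<in> measurable lebesgue (count_space UNIV)"
      by (intro measurable_completion) simp
    then show ?thesis by (rule measurable_restrict_space1)
  qed
  have "(\<lambda>t. (\<lambda>i t. G (\<phi> (max 0 (real_of_int i / real (Suc n))), p t)) \<lfloor>real (Suc n) * t\<rfloor> t) \<in> borel_measurable (lebesgue_on {0..})" for n
    by (rule measurable_compose_countable[where f = "\<lambda>i t. G (\<phi> (max 0 (real_of_int i / real (Suc n))), p t)"
          and g = "\<lambda>t. \<lfloor>real (Suc n) * t\<rfloor>", OF 1[OF \<phi>(2)] 2]) simp
  \<comment> \<open>The maximum with 0 keeps the path inside its domain for the grid indices that do not occur.\<close>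
  then have 3: "(\<lambda>t. G (\<phi> (max 0 (grid n t)), p t)) \<in> borel_measurable (lebesgue_on {0..})" for n
    unfolding grid_def by simp
  show ?thesis
  proof (rule borel_measurable_LIMSEQ_metric[OF 3])
    fix t assume "t \<in> space (lebesgue_on {0::real..})"
    then have t: "t \<ge> 0" by simp
    have "(\<lambda>n. \<phi> (max 0 (grid n t))) \<longlonglongrightarrow> \<phi> (max 0 t)"
      by (rule continuous_on_tendsto_compose[OF \<phi>(1) tendsto_max[OF tendsto_const grid_lim]]) auto
    then have "(\<lambda>n. (\<phi> (max 0 (grid n t)), p t)) \<longlonglongrightarrow> (\<phi> t, p t)"
      using t by (intro tendsto_Pair tendsto_const) simp
    then show "(\<lambda>n. G (\<phi> (max 0 (grid n t)), p t)) \<longlonglongrightarrow> G (\<phi> t, p t)"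
      by (rule continuous_on_tendsto_compose[OF G]) (use t \<phi>(2) p(2) in auto)
  qed
qed

section \<open>Measurable and locally bounded inputs\<close>

lemma Linf_locD:
  assumes "d \<in> Linf_loc D"
  shows "d \<in> borel_measurable (lebesgue_on {0..})" "t \<ge> 0 \<Longrightarrow> d t \<in> D" "\<exists>M\<ge>0. \<forall>t\<in>{0..T}. norm (d t) \<le> M"
proof -
  show "d \<in> borel_measurable (lebesgue_on {0..})" "t \<ge> 0 \<Longrightarrow> d t \<in> D"
    using assms by (auto simp: Linf_loc_def)
  have "bounded (d ` {0..T})" using assms by (cases "T \<ge> 0") (auto simp: Linf_loc_def)
  then obtain M where "M > 0" "\<forall>y\<in>d ` {0..T}. norm y \<le> M" by (auto simp: bounded_pos)
  then show "\<exists>M\<ge>0. \<forall>t\<in>{0..T}. norm (d t) \<le> M" by (intro exI[of _ M]) auto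
qed

lemma Linf_locI:
  assumes "d \<in> borel_measurable (lebesgue_on {0..})" "\<And>t. t \<ge> 0 \<Longrightarrow> d t \<in> D"
    "\<And>T. T \<ge> 0 \<Longrightarrow> \<exists>M. \<forall>t\<in>{0..T}. norm (d t) \<le> M"
  shows "d \<in> Linf_loc D"
  using assms by (auto simp: Linf_loc_def bounded_iff)

lemma Linf_loc_Pair:
  assumes "u \<in> Linf_loc A" "d \<in> Linf_loc B"
  shows "(\<lambda>t. (u t, d t)) \<in> Linf_loc (A \<times> B)"
proof (rule Linf_locI)
  show "(\<lambda>t. (u t, d t)) \<in> borel_measurable (lebesgue_on {0..})"
    using Linf_locD(1)[OF assms(1)] Linf_locD(1)[OF assms(2)] by (rule borel_measurable_Pair)
  show "(u t, d t) \<in> A \<times> B" if "t \<ge> 0" for t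
    by (simp add: Linf_locD(2)[OF assms(1) that] Linf_locD(2)[OF assms(2) that])
  show "\<exists>M. \<forall>t\<in>{0..T}. norm (u t, d t) \<le> M" for T
  proof -
    obtain M1 M2 where "\<forall>t\<in>{0..T}. norm (u t) \<le> M1" "\<forall>t\<in>{0..T}. norm (d t) \<le> M2"
      using Linf_locD(3)[OF assms(1), of T] Linf_locD(3)[OF assms(2), of T] by auto
    then have "\<forall>t\<in>{0..T}. norm (u t, d t) \<le> M1 + M2"
      by (intro ballI order_trans[OF norm_Pair_le] add_mono) simp_all
    then show ?thesis by blast
  qed
qed

lemma Linf_loc_add:
  assumes "u \<in> Linf_loc UNIV" "d \<in> Linf_loc UNIV"
  shows "(\<lambda>t. u t + d t) \<in> Linf_loc UNIV"
proof (rule Linf_locI)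
  show "(\<lambda>t. u t + d t) \<in> borel_measurable (lebesgue_on {0..})"
    using Linf_locD(1)[OF assms(1)] Linf_locD(1)[OF assms(2)] by (rule borel_measurable_add)
  show "\<exists>M. \<forall>t\<in>{0..T}. norm (u t + d t) \<le> M" for T
  proof -
    obtain M1 M2 where "\<forall>t\<in>{0..T}. norm (u t) \<le> M1" "\<forall>t\<in>{0..T}. norm (d t) \<le> M2"
      using Linf_locD(3)[OF assms(1), of T] Linf_locD(3)[OF assms(2), of T] by auto
    then have "\<forall>t\<in>{0..T}. norm (u t + d t) \<le> M1 + M2"
      by (auto intro: norm_triangle_mono)
    then show ?thesis by blast
  qed
qed simp

lemma continuous_on_imp_Linf_loc:
  fixes y :: "real \<Rightarrow> 'a::euclidean_space"
  assumes "continuous_on {0..} y"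
  shows "y \<in> Linf_loc UNIV"
proof (rule Linf_locI)
  show "y \<in> borel_measurable (lebesgue_on {0..})"
    using assms by (intro continuous_imp_measurable_on_sets_lebesgue) auto
  show "\<exists>M. \<forall>t\<in>{0..T}. norm (y t) \<le> M" for T
  proof -
    have "bounded (y ` {0..T})"
      using assms by (intro compact_imp_bounded compact_continuous_image) (auto intro: continuous_on_subset)
    then show ?thesis by (auto simp: bounded_iff)
  qed
qed simp

lemma integrable_on_interval_if_bounded:
  fixes f :: "real \<Rightarrow> 'a::euclidean_space"
  assumes "f \<in> borel_measurable (lebesgue_on {0..})" "0 \<le> a" "\<And>t. t \<in> {a..b} \<Longrightarrow> norm (f t) \<le> M"
  shows "f integrable_on {a..b}"
proof (rule measurable_bounded_by_integrable_imp_integrable)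
  show "f \<in> borel_measurable (lebesgue_on {a..b})"
    by (rule measurable_restrict_mono[OF assms(1)]) (use \<open>0 \<le> a\<close> in auto)
  show "(\<lambda>_. M) integrable_on {a..b}" by (simp add: integrable_const_ivl)
qed (use assms in auto)

section \<open>Dependence of delay equations on their inputs\<close>

text \<open>
  Lets signals be exchanged inside a delay equation when they agree for nonnegative times.
\<close>

lemma delay_solution_cong:
  assumes "\<And>\<phi> t. 0 \<le> t \<Longrightarrow> G \<phi> t = G' \<phi> t"
  shows "delay_solution r G x0 x \<longleftrightarrow> delay_solution r G' x0 x"
proof -
  have "(AE t in lebesgue_on {0..}. (x has_vector_derivative G (history r x t) t) (at t within {0..})) \<longleftrightarrow>
      (AE t in lebesgue_on {0..}. (x has_vector_derivative G' (history r x t) t) (at t within {0..}))"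
    by (rule AE_cong) (simp add: assms)
  then show ?thesis unfolding delay_solution_def has_ac_derivative_on_def by simp
qed

text \<open>
  A Gronwall inequality for the squared norm, which is where a one-sided Lipschitz condition acts.
  The delay is absorbed by an exponential weight: if \<open>n\<close> is the maximum of
  \<open>exp (- l * s) * (norm (y s))^2\<close>, then also the history at \<open>s\<close> has squared norm at most
  \<open>n * exp (l * s)\<close>, since earlier times carry a smaller weight. Integrating up to the maximiser \<open>m\<close>
  bounds \<open>(norm (y m))^2\<close> by half of itself plus twice the integral of \<open>c\<close>, once \<open>l\<close> is large compared with \<open>\<Lambda>\<close>.
\<close>

lemma history_gronwall:
  fixes y v :: "real \<Rightarrow> 'a::euclidean_space"
  assumes r: "0 < r" and y: "continuous_on {-r..} y" and y0: "\<And>s. s \<in> {-r..0} \<Longrightarrow> y s = 0"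
    and ac: "has_ac_derivative_on {0..} y v" and "\<Lambda> \<ge> 0" and N: "negligible N"
    and ineq: "\<And>t. t \<in> {0..T} - N \<Longrightarrow> inner (y t) (v t) \<le> \<Lambda> * (norm (history r y t))\<^sup>2 + c t"
    and c: "c integrable_on {0..T}" "\<And>t. t \<in> {0..T} \<Longrightarrow> 0 \<le> c t"
    and t: "t \<in> {0..T}"
  shows "(norm (y t))\<^sup>2 \<le> 4 * integral {0..T} c * exp (4 * (\<Lambda> + 1) * T)"
proof -
  \<comment> \<open>Large enough for \<open>2 * \<Lambda> / l \<le> 1 / 2\<close>, and positive even for \<open>\<Lambda> = 0\<close>.\<close>
  define l where "l = 4 * (\<Lambda> + 1)"
  have l: "l > 0" "2 * \<Lambda> / l \<le> 1 / 2" using \<open>\<Lambda> \<ge> 0\<close> by (auto simp: l_def field_simps)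
  have T: "0 \<le> T" using t by auto
  have yc: "continuous_on {0..T} y" using y r by (auto intro: continuous_on_subset)
  then have "continuous_on {0..T} (\<lambda>s. exp (- l * s) * (norm (y s))\<^sup>2)"
    by (intro continuous_intros)
  then obtain m where m: "m \<in> {0..T}" "\<And>s. s \<in> {0..T} \<Longrightarrow> exp (- l * s) * (norm (y s))\<^sup>2 \<le> exp (- l * m) * (norm (y m))\<^sup>2"
    using continuous_attains_sup[of "{0..T}" "\<lambda>s. exp (- l * s) * (norm (y s))\<^sup>2"] T by auto
  define n where "n = exp (- l * m) * (norm (y m))\<^sup>2"
  have n0: "n \<ge> 0" by (simp add: n_def)
  have yn: "(norm (y s))\<^sup>2 \<le> n * exp (l * s)" if "s \<in> {0..T}" for s
  proof -
    have "(norm (y s))\<^sup>2 = exp (l * s) * (exp (- l * s) * (norm (y s))\<^sup>2)"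
      by (simp add: mult.assoc[symmetric] exp_add[symmetric])
    also have "\<dots> \<le> exp (l * s) * n" unfolding n_def using m(2)[OF that] by (intro mult_left_mono) auto
    finally show ?thesis by (simp add: mult.commute)
  qed
  have hn: "(norm (history r y s))\<^sup>2 \<le> n * exp (l * s)" if s: "s \<in> {0..T}" for s
  proof -
    have "norm (history r y s) \<le> sqrt (n * exp (l * s))"
    proof (rule norm_history_le[OF r y])
      fix s' assume s': "s' \<in> {s-r..s}"
      show "norm (y s') \<le> sqrt (n * exp (l * s))"
      proof (cases "s' \<le> 0")
        case True
        then show ?thesis using y0[of s'] s s' n0 by auto
      next
        case False
        have "(norm (y s'))\<^sup>2 \<le> n * exp (l * s')" using False s s' by (intro yn) auto
        also have "\<dots> \<le> n * exp (l * s)" using s' n0 l by (intro mult_left_mono) auto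
        finally show ?thesis by (rule real_le_rsqrt)
      qed
    qed (use s in auto)
    then have "(norm (history r y s))\<^sup>2 \<le> (sqrt (n * exp (l * s)))\<^sup>2" by (intro power_mono) auto
    then show ?thesis using n0 by simp
  qed
  have "has_ac_derivative_on {0..} (\<lambda>t. (norm (y t))\<^sup>2) (\<lambda>t. 2 * inner (y t) (v t))"
    using ac y r by (intro has_ac_derivative_on_power2_norm) (auto intro: continuous_on_subset)
  from has_ac_derivative_on_has_integral[OF this, of 0 m] m y0[of 0] r
  have 1: "((\<lambda>s. 2 * inner (y s) (v s)) has_integral (norm (y m))\<^sup>2) {0..m}" by auto
  have 2: "((\<lambda>s. if s \<in> N then 0 else 2 * inner (y s) (v s)) has_integral (norm (y m))\<^sup>2) {0..m}"
    by (rule has_integral_spike[OF N _ 1]) auto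
  have "((\<lambda>s. exp (l * s)) has_integral (exp (l * m) / l - exp (l * 0) / l)) {0..m}"
    using m l by (intro fundamental_theorem_of_calculus)
      (auto intro!: derivative_eq_intros simp: has_real_derivative_iff_has_vector_derivative[symmetric])
  then have 3: "((\<lambda>s. 2 * \<Lambda> * n * exp (l * s) + 2 * c s) has_integral
      (2 * \<Lambda> * n * (exp (l * m) / l - exp (l * 0) / l) + 2 * integral {0..m} c)) {0..m}"
    using m by (intro has_integral_add has_integral_mult_right integrable_integral integrable_on_subinterval[OF c(1)]) auto
  have "(norm (y m))\<^sup>2 \<le> 2 * \<Lambda> * n * (exp (l * m) / l - exp (l * 0) / l) + 2 * integral {0..m} c"
  proof (rule has_integral_le[OF 2 3])
    fix s assume s: "s \<in> {0..m}"
    then have s': "s \<in> {0..T}" using m by auto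
    show "(if s \<in> N then 0 else 2 * inner (y s) (v s)) \<le> 2 * \<Lambda> * n * exp (l * s) + 2 * c s"
    proof (cases "s \<in> N")
      case True
      then show ?thesis using c(2)[OF s'] \<open>\<Lambda> \<ge> 0\<close> n0 by simp
    next
      case False
      have "inner (y s) (v s) \<le> \<Lambda> * (norm (history r y s))\<^sup>2 + c s" using s' False by (intro ineq) auto
      also have "\<dots> \<le> \<Lambda> * (n * exp (l * s)) + c s"
        using hn[OF s'] \<open>\<Lambda> \<ge> 0\<close> by (intro add_mono mult_left_mono) auto
      finally show ?thesis using False by simp
    qed
  qed
  also have "2 * \<Lambda> * n * (exp (l * m) / l - exp (l * 0) / l) \<le> n * exp (l * m) / 2"
  proof -
    have "2 * \<Lambda> * n * (exp (l * m) / l - exp (l * 0) / l) \<le> 2 * \<Lambda> * n * (exp (l * m) / l)"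
      using \<open>\<Lambda> \<ge> 0\<close> n0 l by (intro mult_left_mono) auto
    also have "\<dots> = (2 * \<Lambda> / l) * (n * exp (l * m))" by simp
    also have "\<dots> \<le> (1 / 2) * (n * exp (l * m))" using l n0 by (intro mult_right_mono) auto
    finally show ?thesis by simp
  qed
  also have "n * exp (l * m) = (norm (y m))\<^sup>2"
    unfolding n_def by (simp add: mult.commute mult.left_commute exp_add[symmetric] mult.assoc[symmetric])
  finally have "(norm (y m))\<^sup>2 \<le> 4 * integral {0..m} c" by simp
  also have "integral {0..m} c \<le> integral {0..T} c"
    using m c by (intro integral_subset_le integrable_on_subinterval[OF c(1)]) auto
  finally have ym: "(norm (y m))\<^sup>2 \<le> 4 * integral {0..T} c" by simp
  have "n \<le> 1 * (norm (y m))\<^sup>2" unfolding n_def using m l by (intro mult_right_mono) auto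
  then have n4: "n \<le> 4 * integral {0..T} c" using ym by simp
  have "(norm (y t))\<^sup>2 \<le> n * exp (l * t)" by (rule yn[OF t])
  also have "\<dots> \<le> n * exp (l * T)" using n0 t l by (intro mult_left_mono) auto
  also have "\<dots> \<le> 4 * integral {0..T} c * exp (l * T)" using n4 by (intro mult_right_mono) auto
  finally show ?thesis by (simp add: l_def)
qed

text \<open>
  The Lipschitz bound acts in the unit tube around \<open>z\<close>, which \<open>z'\<close> cannot leave: if \<open>z'\<close> did, then at the
  first time \<open>m\<close> with \<open>norm (z' m - z m) = 1\<close> the Gronwall bound, valid up to \<open>m\<close>, would be
  below one. So the bound on \<open>z'\<close> comes from \<open>z\<close>. This matters for observer trajectories, because
  the observer estimate bounds \<open>\<Psi> (z_t)\<close> but not \<open>z_t\<close>.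
\<close>

lemma delay_solution_stability:
  fixes G :: "(real \<Rightarrow>\<^sub>C 'a::euclidean_space) \<times> 'p \<Rightarrow> 'a"
  assumes r: "0 < r"
    and z: "delay_solution r (\<lambda>\<phi> t. G (\<phi>, p t)) z0 z" and z': "delay_solution r (\<lambda>\<phi> t. G (\<phi>, p' t)) z0 z'"
    and "\<Lambda> \<ge> 0" and lip: "\<And>t \<phi>. t \<in> {0..T} \<Longrightarrow> \<phi> \<in> C0 r \<Longrightarrow> norm (\<phi> - history r z t) \<le> 1 \<Longrightarrow>
        inner (apply_bcontfun \<phi> 0 - z t) (G (\<phi>, p' t) - G (history r z t, p' t)) \<le> \<Lambda> * (norm (\<phi> - history r z t))\<^sup>2"
    and c: "c integrable_on {0..T}" "\<And>t. t \<in> {0..T} \<Longrightarrow> 0 \<le> c t" and N: "negligible N"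
      "\<And>t. t \<in> {0..T} - N \<Longrightarrow> norm (G (history r z t, p' t) - G (history r z t, p t)) \<le> c t"
    and small: "4 * integral {0..T} c * exp (4 * (\<Lambda> + 1) * T) < 1"
    and t: "t \<in> {0..T}"
  shows "(norm (z' t - z t))\<^sup>2 \<le> 4 * integral {0..T} c * exp (4 * (\<Lambda> + 1) * T)"
proof -
  define y where "y t = z' t - z t" for t
  define v where "v t = G (history r z' t, p' t) - G (history r z t, p t)" for t
  have zc: "continuous_on {-r..} z" "continuous_on {-r..} z'" and h0: "history r z' 0 = history r z 0"
    using z z' by (auto simp: delay_solution_def)
  have yc: "continuous_on {-r..} y" unfolding y_def by (intro continuous_intros zc)
  have y0: "y s = 0" if "s \<in> {-r..0}" for s
    using h0 that unfolding y_def history_0_eq_iff[OF r zc(2) zc(1)] by auto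
  have ac: "has_ac_derivative_on {0..} y v"
    unfolding y_def v_def using z z' by (intro has_ac_derivative_on_combine(2)) (auto simp: delay_solution_def)
  have hy: "history r y t = history r z' t - history r z t" if "t \<ge> 0" for t
    unfolding y_def using r zc that by (intro history_diff) auto
  have ineq: "inner (y t) (v t) \<le> \<Lambda> * (norm (history r y t))\<^sup>2 + c t"
    if t: "t \<in> {0..T} - N" and tube: "\<And>s. s \<in> {0..t} \<Longrightarrow> norm (y s) \<le> 1" for t
  proof -
    have t0: "t \<ge> 0" using t by auto
    have "norm (history r y t) \<le> 1"
    proof (rule norm_history_le[OF r yc t0])
      fix s assume "s \<in> {t-r..t}"
      then show "norm (y s) \<le> 1" using tube[of s] y0[of s] t0 by (cases "s \<le> 0") auto
    qed
    then have 1: "inner (y t) (G (history r z' t, p' t) - G (history r z t, p' t)) \<le> \<Lambda> * (norm (history r y t))\<^sup>2"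
      using lip[of t "history r z' t"] t t0 hy history_in_C0[OF r zc(2) t0]
      by (simp add: apply_history r zc y_def)
    have "inner (y t) (G (history r z t, p' t) - G (history r z t, p t))
        \<le> norm (y t) * norm (G (history r z t, p' t) - G (history r z t, p t))"
      by (rule norm_cauchy_schwarz)
    also have "\<dots> \<le> 1 * c t" using tube[of t] t0 N(2)[OF t] by (intro mult_mono) auto
    finally have 2: "inner (y t) (G (history r z t, p' t) - G (history r z t, p t)) \<le> c t" by simp
    have "inner (y t) (v t) = inner (y t) (G (history r z' t, p' t) - G (history r z t, p' t))
        + inner (y t) (G (history r z t, p' t) - G (history r z t, p t))"
      unfolding v_def inner_add_right[symmetric] by simp
    then show ?thesis using 1 2 by linarith
  qed
  let ?B = "\<lambda>T. 4 * integral {0..T} c * exp (4 * (\<Lambda> + 1) * T)"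
  have gron: "(norm (y t))\<^sup>2 \<le> ?B T" if S: "S \<in> {0..T}" "\<And>s. s \<in> {0..S} \<Longrightarrow> norm (y s) \<le> 1" "t \<in> {0..S}" for S t
  proof -
    have "(norm (y t))\<^sup>2 \<le> ?B S"
    proof (rule history_gronwall[OF r yc y0 ac \<open>\<Lambda> \<ge> 0\<close> N(1)])
      show "inner (y t) (v t) \<le> \<Lambda> * (norm (history r y t))\<^sup>2 + c t" if "t \<in> {0..S} - N" for t
        using that S by (intro ineq) auto
    qed (use S c in \<open>auto intro: integrable_on_subinterval\<close>)
    also have "\<dots> \<le> ?B T"
      using S c \<open>\<Lambda> \<ge> 0\<close>
      by (intro mult_mono mult_nonneg_nonneg integral_subset_le Henstock_Kurzweil_Integration.integral_nonneg)
         (auto intro: integrable_on_subinterval)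
    finally show ?thesis .
  qed
  have tube: "norm (y t1) \<le> 1" if t1: "t1 \<in> {0..T}" for t1
  proof (rule ccontr)
    assume "\<not> norm (y t1) \<le> 1"
    have nc: "continuous_on {0..t1} (\<lambda>s. norm (y s))"
      using yc r by (intro continuous_intros) (auto intro: continuous_on_subset)
    have hit: "\<exists>s'\<in>{0..s}. norm (y s') = 1" if "s \<in> {0..t1}" "norm (y s) > 1" for s
    proof -
      have "\<exists>x\<ge>0. x \<le> s \<and> norm (y x) = 1"
        using that y0[of 0] r by (intro IVT') (auto intro: continuous_on_subset[OF nc])
      then show ?thesis by auto
    qed
    define A where "A = {s \<in> {0..t1}. norm (y s) = 1}"
    have "A \<noteq> {}" using hit[of t1] t1 \<open>\<not> norm (y t1) \<le> 1\<close> by (auto simp: A_def)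
    moreover have "compact A"
    proof -
      have "A = {0..t1} \<inter> (\<lambda>s. norm (y s)) -` {1}" by (auto simp: A_def)
      moreover have "closed ({0..t1} \<inter> (\<lambda>s. norm (y s)) -` {1})"
        using nc by (rule continuous_closed_preimage) auto
      moreover have "bounded A" by (rule bounded_subset[of "{0..t1}"]) (auto simp: A_def)
      ultimately show ?thesis by (simp add: compact_eq_bounded_closed)
    qed
    ultimately obtain m where m: "m \<in> A" "\<And>s. s \<in> A \<Longrightarrow> m \<le> s"
      using compact_attains_inf[of A] by auto
    have "norm (y s) \<le> 1" if s: "s \<in> {0..m}" for s
    proof (rule ccontr)
      assume "\<not> norm (y s) \<le> 1"
      then obtain s' where s': "s' \<in> {0..s}" "norm (y s') = 1" using hit[of s] s m by (auto simp: A_def)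
      then have "s' \<in> A" using s m by (auto simp: A_def)
      then have "s' = s" using m(2)[of s'] s s' by auto
      then show False using s' \<open>\<not> norm (y s) \<le> 1\<close> by auto
    qed
    then have "(norm (y m))\<^sup>2 \<le> ?B T" using m t1 by (intro gron[of m]) (auto simp: A_def)
    then show False using m small by (auto simp: A_def)
  qed
  show ?thesis using gron[of T t] tube t unfolding y_def by auto
qed

text \<open>
  By dominated convergence the integral of \<open>norm (G (z_t, pk t) - G (z_t, p t))\<close>, taken along the
  fixed solution \<open>z\<close>, tends to zero; stability turns this into convergence of the solutions.
\<close>

lemma delay_solution_continuous_dependence:
  fixes G :: "(real \<Rightarrow>\<^sub>C 'a::euclidean_space) \<times> 'p::euclidean_space \<Rightarrow> 'a"
  assumes r: "0 < r" and G: "continuous_on (C0 r \<times> P) G" "bounded_on_bounded (C0 r \<times> P) G"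
      "one_sided_lipschitz_on_bounded (C0 r \<times> P) G"
    and z: "delay_solution r (\<lambda>\<phi> t. G (\<phi>, p t)) z0 z" and p: "p \<in> Linf_loc P"
    and zk: "\<And>k. delay_solution r (\<lambda>\<phi> t. G (\<phi>, pk k t)) z0 (zk k)" and pk: "\<And>k. pk k \<in> Linf_loc P"
    and M: "\<And>k t. t \<in> {0..T} \<Longrightarrow> norm (pk k t) \<le> M"
    and conv: "\<And>t. t \<in> {0..<T} \<Longrightarrow> (\<lambda>k. pk k t) \<longlonglongrightarrow> p t"
    and t: "t \<in> {0..T}"
  shows "(\<lambda>k. history r (zk k) t) \<longlonglongrightarrow> history r z t"
proof -
  have T: "0 \<le> T" using t by auto
  have zc: "continuous_on {-r..} z" using z by (auto simp: delay_solution_def)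
  obtain K where K: "\<And>t. t \<in> {0..T} \<Longrightarrow> norm (history r z t) \<le> K"
    using bounded_history_image[OF r zc, of T] unfolding bounded_iff by (metis imageI)
  obtain M1 where M1: "\<And>t. t \<in> {0..T} \<Longrightarrow> norm (p t) \<le> M1"
    using Linf_locD(3)[OF p, of T] by metis
  \<comment> \<open>The unit tube around \<open>z\<close>, with all input values that occur.\<close>
  define S :: "((real \<Rightarrow>\<^sub>C 'a) \<times> 'p) set" where "S = {(\<phi>, q). \<phi> \<in> C0 r \<and> q \<in> P \<and> norm \<phi> \<le> K + 1 \<and> norm q \<le> max M M1}"
  have "S \<subseteq> cball 0 (K + 1) \<times> cball 0 (max M M1)" by (auto simp: S_def)
  then have S: "S \<subseteq> C0 r \<times> P" "bounded S"
    by (auto simp: S_def intro: bounded_subset[OF bounded_Times[OF bounded_cball bounded_cball]])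
  obtain Bd where Bd: "\<And>x. x \<in> S \<Longrightarrow> norm (G x) \<le> Bd"
    using G(2) S unfolding bounded_on_bounded_def bounded_iff by (metis imageI)
  obtain \<Lambda> where \<Lambda>: "\<Lambda> \<ge> 0" "\<And>\<phi> \<psi> q. (\<phi>, q) \<in> S \<Longrightarrow> (\<psi>, q) \<in> S \<Longrightarrow>
           inner (apply_bcontfun \<phi> 0 - apply_bcontfun \<psi> 0) (G (\<phi>, q) - G (\<psi>, q)) \<le> \<Lambda> * (norm (\<phi> - \<psi>))\<^sup>2"
    using G(3) S unfolding one_sided_lipschitz_on_bounded_def by metis
  have hz: "history r z t \<in> C0 r" if "t \<in> {0..T}" for t
    using that by (intro history_in_C0[OF r zc]) auto
  have S1: "(history r z t, pk k t) \<in> S" "(history r z t, p t) \<in> S" if "t \<in> {0..T}" for t k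
    using K[OF that] M[OF that, of k] M1[OF that] hz[OF that] Linf_locD(2)[OF p, of t] Linf_locD(2)[OF pk[of k], of t] that
    by (auto simp: S_def)
  have meas: "(\<lambda>t. G (history r z t, q t)) \<in> borel_measurable (lebesgue_on {0..})" if "q \<in> Linf_loc P" for q
    using that by (intro borel_measurable_along_path[OF continuous_on_history[OF r zc] _ _ _ G(1)] history_in_C0[OF r zc])
      (auto dest: Linf_locD)
  define g where "g k t = norm (G (history r z t, pk k t) - G (history r z t, p t))" for k t
  \<comment> \<open>The inputs may differ at the end point, so that inputs agreeing before \<open>T\<close> give solutions agreeing at \<open>T\<close>.\<close>
  define c where "c k t = (if t = T then 0 else g k t)" for k t
  have g2: "norm (g k t) \<le> Bd + Bd" if "t \<in> {0..T}" for k t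
    unfolding g_def using Bd[OF S1(1)[OF that, of k]] Bd[OF S1(2)[OF that]]
    by (auto intro: order_trans[OF norm_triangle_ineq4] add_mono)
  have gi: "g k integrable_on {0..T}" for k
  proof (rule integrable_on_interval_if_bounded)
    show "g k \<in> borel_measurable (lebesgue_on {0..})"
      unfolding g_def
      by (rule measurable_compose[OF borel_measurable_diff[OF meas[OF pk[of k]] meas[OF p]]]) measurable
  qed (use g2 in auto)
  have ci: "c k integrable_on {0..T}" for k
    by (rule integrable_spike_finite[OF _ _ gi[of k], of "{T}"]) (auto simp: c_def)
  have c2: "norm (c k t) \<le> Bd + Bd" if "t \<in> {0..T}" for k t
    using g2[OF that, of k] by (auto simp: c_def intro: order_trans[OF norm_ge_zero])
  have c0: "0 \<le> c k t" for k t by (simp add: c_def g_def)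
  have clim: "(\<lambda>k. c k t) \<longlonglongrightarrow> 0" if t: "t \<in> {0..T}" for t
  proof (cases "t = T")
    case False
    then have "(\<lambda>k. (history r z t, pk k t)) \<longlonglongrightarrow> (history r z t, p t)"
      using conv[of t] t by (intro tendsto_intros) auto
    then have "(\<lambda>k. G (history r z t, pk k t)) \<longlonglongrightarrow> G (history r z t, p t)"
      by (rule continuous_on_tendsto_compose[OF G(1)]) (use S1[OF t] S(1) in \<open>blast intro: always_eventually\<close>)+
    then have "(\<lambda>k. g k t) \<longlonglongrightarrow> 0" unfolding g_def by (intro tendsto_norm_zero LIM_zero)
    then show ?thesis using False by (simp add: c_def)
  qed (simp add: c_def)
  have "(\<lambda>k. integral {0..T} (c k)) \<longlonglongrightarrow> integral {0..T} (\<lambda>_. 0)"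
    by (rule dominated_convergence(2)[where h = "\<lambda>_. Bd + Bd"]) (use ci c2 clim in \<open>auto simp: integrable_const_ivl\<close>)
  then have lim: "(\<lambda>k. 4 * integral {0..T} (c k) * exp (4 * (\<Lambda> + 1) * T)) \<longlonglongrightarrow> 0"
    by (auto intro!: tendsto_eq_intros)
  have est: "norm (history r (zk k) t - history r z t) \<le> e"
    if e: "e > 0" and k: "4 * integral {0..T} (c k) * exp (4 * (\<Lambda> + 1) * T) < min 1 (e\<^sup>2)" for k e
  proof -
    have zkc: "continuous_on {-r..} (zk k)" using zk[of k] by (auto simp: delay_solution_def)
    have "history r (zk k) 0 = history r z 0" using zk[of k] z by (auto simp: delay_solution_def)
    then have init: "zk k s = z s" if "s \<in> {-r..0}" for s
      using that history_0_eq_iff[OF r zkc zc] by auto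
    have D: "norm (zk k s - z s) \<le> e" if s: "s \<in> {0..T}" for s
    proof -
      have "(norm (zk k s - z s))\<^sup>2 \<le> 4 * integral {0..T} (c k) * exp (4 * (\<Lambda> + 1) * T)"
      proof (rule delay_solution_stability[OF r z zk[of k] \<Lambda>(1) _ ci c0 negligible_sing[of T] _ _ s])
        fix t \<phi> assume a: "t \<in> {0..T}" "\<phi> \<in> C0 r" "norm (\<phi> - history r z t) \<le> 1"
        have "norm \<phi> \<le> norm (\<phi> - history r z t) + norm (history r z t)"
          using norm_triangle_sub[of \<phi> "history r z t"] by simp
        then have "(\<phi>, pk k t) \<in> S" using a K[of t] S1(1)[OF a(1), of k] by (auto simp: S_def)
        from \<Lambda>(2)[OF this S1(1)[OF a(1), of k]]
        show "inner (apply_bcontfun \<phi> 0 - z t) (G (\<phi>, pk k t) - G (history r z t, pk k t)) \<le> \<Lambda> * (norm (\<phi> - history r z t))\<^sup>2"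
          using a r by (simp add: apply_history[OF r zc])
      next
        show "4 * integral {0..T} (c k) * exp (4 * (\<Lambda> + 1) * T) < 1" using k by simp
        show "norm (G (history r z t, pk k t) - G (history r z t, p t)) \<le> c k t" if "t \<in> {0..T} - {T}" for t
          using that by (simp add: c_def g_def)
      qed
      also have "\<dots> \<le> e\<^sup>2" using k by simp
      finally show ?thesis using e by (meson less_imp_le power2_le_imp_le)
    qed
    have "norm (history r (\<lambda>s. zk k s - z s) t) \<le> e"
    proof (rule norm_history_le[OF r])
      show "continuous_on {-r..} (\<lambda>s. zk k s - z s)" by (intro continuous_intros zkc zc)
      fix s assume "s \<in> {t-r..t}"
      then show "norm (zk k s - z s) \<le> e" using D[of s] init[of s] t e by (cases "s \<le> 0") auto
    qed (use t in auto)
    then show ?thesis using history_diff[OF r zkc zc, of t] t by simp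
  qed
  show ?thesis
  proof (rule tendstoI)
    fix e :: real assume e: "0 < e"
    have "\<forall>\<^sub>F k in sequentially. 4 * integral {0..T} (c k) * exp (4 * (\<Lambda> + 1) * T) < min 1 ((e/2)\<^sup>2)"
      using e by (intro order_tendstoD(2)[OF lim]) auto
    then show "\<forall>\<^sub>F k in sequentially. dist (history r (zk k) t) (history r z t) < e"
    proof eventually_elim
      case (elim k)
      then show ?case using est[of "e/2" k] e by (simp add: dist_norm)
    qed
  qed
qed

text \<open>
  Continuous dependence applied to a constant sequence. It expresses uniqueness and causality at once:
  the history at \<open>T\<close> is determined by the input before \<open>T\<close>.
\<close>

lemma delay_solution_unique:
  fixes G :: "(real \<Rightarrow>\<^sub>C 'a::euclidean_space) \<times> 'p::euclidean_space \<Rightarrow> 'a"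
  assumes r: "0 < r" and G: "continuous_on (C0 r \<times> P) G" "bounded_on_bounded (C0 r \<times> P) G"
      "one_sided_lipschitz_on_bounded (C0 r \<times> P) G"
    and z: "delay_solution r (\<lambda>\<phi> t. G (\<phi>, p t)) z0 z" and p: "p \<in> Linf_loc P"
    and z': "delay_solution r (\<lambda>\<phi> t. G (\<phi>, p' t)) z0 z'" and p': "p' \<in> Linf_loc P"
    and eq: "\<And>t. t \<in> {0..<T} \<Longrightarrow> p' t = p t"
    and t: "t \<in> {0..T}"
  shows "history r z' t = history r z t"
proof -
  obtain M where "\<And>t. t \<in> {0..T} \<Longrightarrow> norm (p' t) \<le> M" using Linf_locD(3)[OF p'] by metis
  then have "(\<lambda>k::nat. history r z' t) \<longlonglongrightarrow> history r z t"
    using eq by (intro delay_solution_continuous_dependence[OF r G z p z' p' _ _ t]) auto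
  then show ?thesis by (simp add: LIMSEQ_const_iff)
qed

section \<open>The small-gain estimate\<close>

text \<open>
  Lets the suprema of \<open>g\<close> and of \<open>\<kappa>\<close> along the disturbance be merged into one supremum of their
  combination: both are estimated at the supremum of the disturbance, where continuity recovers the
  supremum of the combination.
\<close>

lemma apply_SUP_le_SUP_apply:
  fixes \<rho> D :: "real \<Rightarrow> real"
  assumes \<rho>: "continuous_on {0..} \<rho>" and A: "A \<noteq> {}" "bdd_above (D ` A)" "\<And>s. s \<in> A \<Longrightarrow> 0 \<le> D s"
    and bdd: "bdd_above ((\<lambda>s. \<rho> (D s)) ` A)"
  shows "\<rho> (SUP s\<in>A. D s) \<le> (SUP s\<in>A. \<rho> (D s))"
proof -
  have cl: "closure (D ` A) \<subseteq> {0..}" using A(3) by (intro closure_minimal) auto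
  have "\<rho> ` closure (D ` A) \<subseteq> {..(SUP s\<in>A. \<rho> (D s))}"
    by (rule image_closure_subset) (use \<rho> cl bdd in \<open>auto intro: continuous_on_subset cSUP_upper\<close>)
  moreover have "(SUP s\<in>A. D s) \<in> closure (D ` A)"
    using A by (intro closure_contains_Sup) auto
  ultimately show ?thesis by blast
qed

text \<open>
  The loop inequality. Here \<open>E\<close> is the estimation error, \<open>n\<close> the size of the predicted output error,
  and \<open>q\<close> its rate, which may have been integrated over only a part of the time since the last
  sample. With \<open>M\<close> the maximum of \<open>E s * exp (\<omega> * s)\<close> on \<open>{0..t}\<close>, the hypothesis \<open>pred\<close> bounds
  \<open>n s * exp (\<omega> * s)\<close> by \<open>Q\<close>, which contains \<open>M\<close> with the factor \<open>L * (exp (\<omega> * \<delta>) - 1) / \<omega>\<close>;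
  inserting this into \<open>obs\<close> at the maximiser gives a bound on \<open>(1 - B) * M\<close>. Continuity of \<open>E\<close>
  makes \<open>M\<close> finite, so that \<open>B * M\<close> may be subtracted.
\<close>

lemma sampled_small_gain_estimate:
  fixes E n X D :: "real \<Rightarrow> real" and q :: "real \<Rightarrow> 'k::euclidean_space"
  assumes pos: "0 < \<omega>" "\<omega> \<le> \<sigma>" "0 < \<delta>" "0 < \<gamma>" "0 \<le> L" "0 \<le> a0"
    and B: "B = \<gamma> * L * ((exp (\<omega> * \<delta>) - 1) / \<omega>)" "B < 1"
    and E: "continuous_on {0..} E" "\<And>s. 0 \<le> s \<Longrightarrow> 0 \<le> E s"
    and n: "\<And>s. 0 \<le> s \<Longrightarrow> 0 \<le> n s"
    and X: "\<And>s. 0 \<le> s \<Longrightarrow> 0 \<le> X s" "bdd_above (X ` {0..t})"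
    and D: "\<And>s. 0 \<le> s \<Longrightarrow> 0 \<le> D s" "bdd_above (D ` {0..t})"
    and K: "g \<in> class_K" "\<kappa> \<in> class_K"
    and q: "\<And>s. s \<in> {0..t} \<Longrightarrow> norm (q s) \<le> L * E s + \<kappa> (D s)" "q integrable_on {0..t}"
    and obs: "\<And>t. 0 \<le> t \<Longrightarrow> E t \<le> exp (- \<sigma> * t) * a0 + \<gamma> * (SUP s\<in>{0..t}. n s * exp (- \<sigma> * (t - s)))
        + (SUP s\<in>{0..t}. g (D s))"
    and pred: "\<And>s. 0 \<le> s \<Longrightarrow> \<exists>\<tau>0 \<tau>1. 0 \<le> \<tau>0 \<and> \<tau>0 \<le> \<tau>1 \<and> \<tau>1 \<le> s \<and> s \<le> \<tau>0 + \<delta> \<and>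
        n s \<le> X \<tau>0 + norm (integral {\<tau>0..\<tau>1} q)"
    and t: "0 \<le> t"
  shows "E t \<le> inverse (1 - B) * exp (- \<omega> * t) * a0
      + inverse (1 - B) * \<gamma> * exp (\<omega> * \<delta>) * (SUP s\<in>{0..t}. X s * exp (- \<omega> * (t - s)))
      + (SUP s\<in>{0..t}. inverse (1 - B) * (g (D s) + \<gamma> * \<delta> * \<kappa> (D s)))"
proof -
  have mono: "\<rho> u \<le> \<rho> v" "0 \<le> \<rho> u" if "\<rho> \<in> class_K" "0 \<le> u" "u \<le> v" for \<rho> u v
  proof -
    have sm: "strict_mono_on {0..} \<rho>" "\<rho> 0 = 0" using that(1) by (auto simp: class_K_def)
    show "\<rho> u \<le> \<rho> v" using strict_mono_on_leD[OF sm(1), of u v] that by auto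
    show "0 \<le> \<rho> u" using strict_mono_on_leD[OF sm(1), of 0 u] that sm(2) by auto
  qed
  define Dm where "Dm = (SUP s\<in>{0..t}. D s)"
  have Ds: "D s \<le> Dm" if "s \<in> {0..t}" for s unfolding Dm_def using that D(2) by (intro cSUP_upper) auto
  have Dm0: "0 \<le> Dm" using Ds[of 0] D(1)[of 0] t by auto
  have bX: "bdd_above ((\<lambda>s. X s * exp (- \<omega> * (t - s))) ` {0..t})"
  proof -
    obtain b where b: "\<And>s. s \<in> {0..t} \<Longrightarrow> X s \<le> b" using X(2) unfolding bdd_above_def by (metis imageI)
    have "X s * exp (- \<omega> * (t - s)) \<le> b * 1" if "s \<in> {0..t}" for s
      using b[OF that] X(1)[of s] that pos by (intro mult_mono) (auto intro: order_trans)
    then show ?thesis by (intro bdd_aboveI[of _ "b * 1"]) auto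
  qed
  define Y where "Y = (SUP s\<in>{0..t}. X s * exp (- \<omega> * (t - s)))"
  have Xs: "X s \<le> Y * exp (\<omega> * (t - s))" if "s \<in> {0..t}" for s
  proof -
    have "X s * exp (- \<omega> * (t - s)) \<le> Y" unfolding Y_def using that bX by (intro cSUP_upper) auto
    then have "X s * exp (- \<omega> * (t - s)) * exp (\<omega> * (t - s)) \<le> Y * exp (\<omega> * (t - s))" by (intro mult_right_mono) auto
    then show ?thesis by (simp add: mult.assoc exp_add[symmetric])
  qed
  have Y0: "0 \<le> Y" using Xs[of t] X(1)[of t] t by auto
  have "continuous_on {0..t} (\<lambda>s. E s * exp (\<omega> * s))"
    using E(1) by (intro continuous_intros) (auto intro: continuous_on_subset)
  then obtain m where m: "m \<in> {0..t}" "\<And>s. s \<in> {0..t} \<Longrightarrow> E s * exp (\<omega> * s) \<le> E m * exp (\<omega> * m)"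
    using continuous_attains_sup[of "{0..t}" "\<lambda>s. E s * exp (\<omega> * s)"] t by auto
  define M where "M = E m * exp (\<omega> * m)"
  have M0: "0 \<le> M" unfolding M_def using E(2) m(1) by auto
  have Es: "E s \<le> M * exp (- \<omega> * s)" if "s \<in> {0..t}" for s
  proof -
    have "E s * exp (\<omega> * s) * exp (- \<omega> * s) \<le> M * exp (- \<omega> * s)"
      using m(2)[OF that] unfolding M_def by (intro mult_right_mono) auto
    then show ?thesis by (simp add: mult.assoc exp_add[symmetric])
  qed
  define Q where "Q = exp (\<omega> * \<delta>) * Y * exp (\<omega> * t) + L * M * ((exp (\<omega> * \<delta>) - 1) / \<omega>) + exp (\<omega> * t) * \<delta> * \<kappa> Dm"
  have nQ: "n s * exp (\<omega> * s) \<le> Q" if s: "s \<in> {0..t}" for s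
  proof -
    obtain \<tau>0 \<tau>1 where \<tau>: "0 \<le> \<tau>0" "\<tau>0 \<le> \<tau>1" "\<tau>1 \<le> s" "s \<le> \<tau>0 + \<delta>" "n s \<le> X \<tau>0 + norm (integral {\<tau>0..\<tau>1} q)"
      using pred[of s] s by auto
    let ?I = "L * M * ((exp (- \<omega> * \<tau>0) - exp (- \<omega> * \<tau>1)) / \<omega>) + \<kappa> Dm * (\<tau>1 - \<tau>0)"
    have "((\<lambda>p. exp (- \<omega> * p)) has_integral (- exp (- \<omega> * \<tau>1) / \<omega> - (- exp (- \<omega> * \<tau>0) / \<omega>))) {\<tau>0..\<tau>1}"
      using \<tau> pos by (intro fundamental_theorem_of_calculus)
        (auto intro!: derivative_eq_intros simp: has_real_derivative_iff_has_vector_derivative[symmetric])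
    then have "((\<lambda>p. exp (- \<omega> * p)) has_integral ((exp (- \<omega> * \<tau>0) - exp (- \<omega> * \<tau>1)) / \<omega>)) {\<tau>0..\<tau>1}"
      by (simp add: diff_divide_distrib)
    moreover have "((\<lambda>_. \<kappa> Dm) has_integral \<kappa> Dm * (\<tau>1 - \<tau>0)) {\<tau>0..\<tau>1}"
      using has_integral_const_real[of "\<kappa> Dm" \<tau>0 \<tau>1] \<tau> by (simp add: mult.commute)
    ultimately have hi: "((\<lambda>p. L * M * exp (- \<omega> * p) + \<kappa> Dm) has_integral ?I) {\<tau>0..\<tau>1}"
      by (intro has_integral_add has_integral_mult_right)
    have "norm (integral {\<tau>0..\<tau>1} q) \<le> integral {\<tau>0..\<tau>1} (\<lambda>p. L * M * exp (- \<omega> * p) + \<kappa> Dm)"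
    proof (rule Henstock_Kurzweil_Integration.integral_norm_bound_integral)
      show "q integrable_on {\<tau>0..\<tau>1}" using \<tau> s by (intro integrable_on_subinterval[OF q(2)]) auto
      fix p assume p: "p \<in> {\<tau>0..\<tau>1}"
      then have p': "p \<in> {0..t}" using \<tau> s by auto
      have "norm (q p) \<le> L * E p + \<kappa> (D p)" by (rule q(1)[OF p'])
      also have "\<dots> \<le> L * (M * exp (- \<omega> * p)) + \<kappa> Dm"
        using Es[OF p'] Ds[OF p'] D(1)[of p] p' pos by (intro add_mono mult_left_mono mono(1)[OF K(2)]) auto
      finally show "norm (q p) \<le> L * M * exp (- \<omega> * p) + \<kappa> Dm" by (simp add: mult.assoc)
    qed (use hi in \<open>auto simp: has_integral_integrable_integral\<close>)
    also have "\<dots> = ?I" using hi by (rule integral_unique)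
    finally have "n s \<le> X \<tau>0 + ?I" using \<tau>(5) by simp
    then have "n s * exp (\<omega> * s) \<le> (X \<tau>0 + ?I) * exp (\<omega> * s)" by (intro mult_right_mono) auto
    also have "\<dots> = X \<tau>0 * exp (\<omega> * s) + L * M * ((exp (- \<omega> * \<tau>0) - exp (- \<omega> * \<tau>1)) * exp (\<omega> * s) / \<omega>)
        + \<kappa> Dm * (\<tau>1 - \<tau>0) * exp (\<omega> * s)"
      by (simp add: algebra_simps)
    also have "\<dots> \<le> Q"
      unfolding Q_def
    proof (intro add_mono)
      have "X \<tau>0 * exp (\<omega> * s) \<le> Y * exp (\<omega> * (t - \<tau>0)) * exp (\<omega> * s)"
        using \<tau> s by (intro mult_right_mono Xs) auto
      also have "\<dots> = exp (\<omega> * (s - \<tau>0)) * Y * exp (\<omega> * t)"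
      proof -
        have "exp (\<omega> * (t - \<tau>0)) * exp (\<omega> * s) = exp (\<omega> * (s - \<tau>0)) * exp (\<omega> * t)"
          by (simp add: exp_add[symmetric] algebra_simps)
        then show ?thesis by (simp add: mult.assoc mult.left_commute)
      qed
      also have "\<dots> \<le> exp (\<omega> * \<delta>) * Y * exp (\<omega> * t)"
        using \<tau> pos Y0 by (intro mult_right_mono) auto
      finally show "X \<tau>0 * exp (\<omega> * s) \<le> exp (\<omega> * \<delta>) * Y * exp (\<omega> * t)" .
      have "(exp (- \<omega> * \<tau>0) - exp (- \<omega> * \<tau>1)) * exp (\<omega> * s) \<le> (exp (- \<omega> * \<tau>0) - exp (- \<omega> * s)) * exp (\<omega> * s)"
        using \<tau> pos by (intro mult_right_mono) auto
      also have "\<dots> = exp (\<omega> * (s - \<tau>0)) - 1"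
        by (simp add: left_diff_distrib exp_add[symmetric] algebra_simps)
      also have "\<dots> \<le> exp (\<omega> * \<delta>) - 1" using \<tau> pos by auto
      finally show "L * M * ((exp (- \<omega> * \<tau>0) - exp (- \<omega> * \<tau>1)) * exp (\<omega> * s) / \<omega>) \<le> L * M * ((exp (\<omega> * \<delta>) - 1) / \<omega>)"
        using pos M0 by (intro mult_left_mono divide_right_mono) auto
      have "\<kappa> Dm * (\<tau>1 - \<tau>0) * exp (\<omega> * s) \<le> \<kappa> Dm * \<delta> * exp (\<omega> * t)"
        using \<tau> s pos mono(2)[OF K(2) Dm0 order_refl] by (intro mult_mono) auto
      then show "\<kappa> Dm * (\<tau>1 - \<tau>0) * exp (\<omega> * s) \<le> exp (\<omega> * t) * \<delta> * \<kappa> Dm"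
        by (simp add: mult.commute mult.left_commute)
    qed
    finally show ?thesis .
  qed
  have m0: "0 \<le> m" "m \<le> t" using m by auto
  have "(SUP s\<in>{0..m}. n s * exp (- \<sigma> * (m - s))) \<le> Q * exp (- \<omega> * m)"
  proof (rule cSUP_least)
    fix s assume s: "s \<in> {0..m}"
    have "n s * exp (- \<sigma> * (m - s)) \<le> n s * exp (- \<omega> * (m - s))"
      using s n[of s] pos by (intro mult_left_mono) (auto intro: mult_right_mono)
    also have "\<dots> = n s * exp (\<omega> * s) * exp (- \<omega> * m)"
      by (simp add: mult.assoc exp_add[symmetric] algebra_simps)
    also have "\<dots> \<le> Q * exp (- \<omega> * m)" using s m0 by (intro mult_right_mono nQ) auto
    finally show "n s * exp (- \<sigma> * (m - s)) \<le> Q * exp (- \<omega> * m)" .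
  qed (use m0 in auto)
  moreover have "(SUP s\<in>{0..m}. g (D s)) \<le> g Dm"
    using m0 Ds D(1) by (intro cSUP_least mono(1)[OF K(1)]) auto
  moreover have "exp (- \<sigma> * m) * a0 \<le> exp (- \<omega> * m) * a0"
    using m0 pos by (intro mult_right_mono) (auto intro: mult_right_mono)
  ultimately have "E m \<le> exp (- \<omega> * m) * a0 + \<gamma> * (Q * exp (- \<omega> * m)) + g Dm"
    using mult_left_mono[of "SUP s\<in>{0..m}. n s * exp (- \<sigma> * (m - s))" "Q * exp (- \<omega> * m)" \<gamma>] pos
    by (intro order_trans[OF obs[OF m0(1)]] add_mono) auto
  then have "M \<le> (exp (- \<omega> * m) * a0 + \<gamma> * (Q * exp (- \<omega> * m)) + g Dm) * exp (\<omega> * m)"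
    unfolding M_def by (intro mult_right_mono) auto
  also have "\<dots> = a0 * (exp (- \<omega> * m) * exp (\<omega> * m)) + \<gamma> * Q * (exp (- \<omega> * m) * exp (\<omega> * m)) + g Dm * exp (\<omega> * m)"
    by (simp add: algebra_simps)
  also have "\<dots> = a0 + \<gamma> * Q + g Dm * exp (\<omega> * m)"
    by (simp add: exp_add[symmetric])
  also have "\<dots> \<le> a0 + \<gamma> * Q + g Dm * exp (\<omega> * t)"
    using m0 pos mono(2)[OF K(1) Dm0 order_refl] by (intro add_left_mono mult_left_mono) auto
  also have "\<gamma> * Q = B * M + \<gamma> * exp (\<omega> * \<delta>) * Y * exp (\<omega> * t) + \<gamma> * \<delta> * \<kappa> Dm * exp (\<omega> * t)"
    unfolding Q_def B by (simp add: algebra_simps)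
  finally have "(1 - B) * M \<le> a0 + \<gamma> * exp (\<omega> * \<delta>) * Y * exp (\<omega> * t) + (g Dm + \<gamma> * \<delta> * \<kappa> Dm) * exp (\<omega> * t)"
    (is "_ \<le> ?R")
    by (simp add: algebra_simps)
  then have "inverse (1 - B) * ((1 - B) * M) \<le> inverse (1 - B) * ?R"
    using B(2) by (intro mult_left_mono) auto
  then have M': "M \<le> inverse (1 - B) * ?R" using B(2) by (simp add: mult.assoc[symmetric])
  have "E t \<le> M * exp (- \<omega> * t)" using t by (intro Es) auto
  also have "\<dots> \<le> inverse (1 - B) * ?R * exp (- \<omega> * t)" using M' by (intro mult_right_mono) auto
  also have "\<dots> = inverse (1 - B) * (exp (- \<omega> * t) * a0)
      + inverse (1 - B) * (\<gamma> * exp (\<omega> * \<delta>) * Y) * (exp (\<omega> * t) * exp (- \<omega> * t))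
      + inverse (1 - B) * (g Dm + \<gamma> * \<delta> * \<kappa> Dm) * (exp (\<omega> * t) * exp (- \<omega> * t))"
    by (simp add: distrib_left distrib_right mult_ac)
  also have "\<dots> = inverse (1 - B) * exp (- \<omega> * t) * a0 + inverse (1 - B) * \<gamma> * exp (\<omega> * \<delta>) * Y
      + inverse (1 - B) * (g Dm + \<gamma> * \<delta> * \<kappa> Dm)"
    by (simp add: exp_add[symmetric] mult.assoc)
  finally have fin: "E t \<le> inverse (1 - B) * exp (- \<omega> * t) * a0 + inverse (1 - B) * \<gamma> * exp (\<omega> * \<delta>) * Y
      + inverse (1 - B) * (g Dm + \<gamma> * \<delta> * \<kappa> Dm)" .
  have "inverse (1 - B) * (g Dm + \<gamma> * \<delta> * \<kappa> Dm) \<le> (SUP s\<in>{0..t}. inverse (1 - B) * (g (D s) + \<gamma> * \<delta> * \<kappa> (D s)))"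
    unfolding Dm_def
  proof (rule apply_SUP_le_SUP_apply[where \<rho> = "\<lambda>v. inverse (1 - B) * (g v + \<gamma> * \<delta> * \<kappa> v)"])
    show "continuous_on {0..} (\<lambda>v. inverse (1 - B) * (g v + \<gamma> * \<delta> * \<kappa> v))"
      using K by (intro continuous_intros) (auto simp: class_K_def)
    show "bdd_above ((\<lambda>s. inverse (1 - B) * (g (D s) + \<gamma> * \<delta> * \<kappa> (D s))) ` {0..t})"
    proof (rule bdd_aboveI2)
      fix s assume "s \<in> {0..t}"
      then show "inverse (1 - B) * (g (D s) + \<gamma> * \<delta> * \<kappa> (D s)) \<le> inverse (1 - B) * (g Dm + \<gamma> * \<delta> * \<kappa> Dm)"
        using B(2) pos Ds[of s] D(1)[of s] by (intro mult_left_mono add_mono mono(1)[OF K(1)] mono(1)[OF K(2)]) auto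
    qed
  qed (use t D in auto)
  then show ?thesis using fin unfolding Y_def by linarith
qed

section \<open>Delayed fixed points and their compactness\<close>

text \<open>
  The iterates of \<open>P\<close> stabilise on ever longer intervals: each application extends agreement by \<open>\<epsilon>\<close>.
  The fixed point is read off the stabilised values.
\<close>

lemma causal_fixed_point:
  fixes P :: "(real \<Rightarrow> 'k::euclidean_space) \<Rightarrow> real \<Rightarrow> 'k"
  assumes "0 < \<epsilon>" and maps: "\<And>e. e \<in> Linf_loc UNIV \<Longrightarrow> P e \<in> Linf_loc UNIV"
    and causal: "\<And>e e' T. \<lbrakk>e \<in> Linf_loc UNIV; e' \<in> Linf_loc UNIV; 0 \<le> T; \<forall>t\<in>{0..<T}. e t = e' t\<rbrakk>
      \<Longrightarrow> \<forall>t\<in>{0..<T + \<epsilon>}. P e t = P e' t"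
  shows "\<exists>e\<in>Linf_loc UNIV. \<forall>t\<ge>0. P e t = e t"
proof -
  define W where "W j = (P ^^ j) (\<lambda>_. 0)" for j
  have W: "W j \<in> Linf_loc UNIV" for j
    by (induction j) (auto simp: W_def maps intro: continuous_on_imp_Linf_loc)
  have step: "\<forall>t\<in>{0..<real j * \<epsilon>}. W (Suc j) t = W j t" for j
  proof (induction j)
    case (Suc j)
    have "\<forall>t\<in>{0..<real j * \<epsilon> + \<epsilon>}. P (W (Suc j)) t = P (W j) t"
      using W Suc \<open>0 < \<epsilon>\<close> by (intro causal) auto
    then show ?case by (simp add: W_def algebra_simps)
  qed simp
  have stable: "W (j + i) t = W j t" if "t \<in> {0..<real j * \<epsilon>}" for i j t
  proof (induction i)
    case (Suc i)
    have "real j * \<epsilon> \<le> real (j + i) * \<epsilon>" using \<open>0 < \<epsilon>\<close> by (intro mult_right_mono) auto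
    then have "t \<in> {0..<real (j + i) * \<epsilon>}" using that by auto
    then show ?case using step[of "j + i"] Suc by auto
  qed simp
  define N where "N t = nat \<lfloor>t / \<epsilon>\<rfloor> + 1" for t
  have N: "t < real (N t) * \<epsilon>" if "0 \<le> t" for t
  proof -
    have "t / \<epsilon> < real (N t)" unfolding N_def using that \<open>0 < \<epsilon>\<close> by simp linarith
    then show ?thesis using \<open>0 < \<epsilon>\<close> by (simp add: field_simps)
  qed
  define e where "e t = W (N t) t" for t
  have eW: "e t = W j t" if "t \<in> {0..<real j * \<epsilon>}" for j t
  proof (cases "N t \<le> j")
    case True
    then show ?thesis using stable[of t "N t" "j - N t"] N[of t] that by (simp add: e_def)
  next
    case False
    then show ?thesis using stable[of t j "N t - j"] that by (simp add: e_def)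
  qed
  have big: "\<exists>j. t < real j * \<epsilon>" for t
    using N[of "max 0 t"] by (intro exI[of _ "N (max 0 t)"]) auto
  have "e \<in> Linf_loc UNIV"
  proof (rule Linf_locI)
    show "e \<in> borel_measurable (lebesgue_on {0..})"
    proof (rule borel_measurable_LIMSEQ_metric)
      show "W j \<in> borel_measurable (lebesgue_on {0..})" for j using W by (rule Linf_locD)
      fix t assume "t \<in> space (lebesgue_on {0::real..})"
      then have t: "0 \<le> t" by simp
      have "\<forall>\<^sub>F j in sequentially. W j t = e t"
        using eventually_ge_at_top[of "N t"]
      proof eventually_elim
        case (elim j)
        then have "real (N t) * \<epsilon> \<le> real j * \<epsilon>" using \<open>0 < \<epsilon>\<close> by (intro mult_right_mono) auto
        then show ?case using eW[of t j] N[OF t] t by auto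
      qed
      then show "(\<lambda>j. W j t) \<longlonglongrightarrow> e t" by (rule tendsto_eventually)
    qed
    fix T :: real assume "0 \<le> T"
    obtain j where j: "T < real j * \<epsilon>" using big by blast
    obtain M where "\<forall>t\<in>{0..T}. norm (W j t) \<le> M" using Linf_locD(3)[OF W] by blast
    then show "\<exists>M. \<forall>t\<in>{0..T}. norm (e t) \<le> M" using eW[of _ j] j by auto
  qed simp
  moreover have "P e t = e t" if t: "0 \<le> t" for t
  proof -
    let ?j = "N t"
    have "\<forall>t\<in>{0..<real ?j * \<epsilon> + \<epsilon>}. P e t = P (W ?j) t"
      using eW \<open>0 < \<epsilon>\<close> W \<open>e \<in> Linf_loc UNIV\<close> by (intro causal) auto
    then have "P e t = W (Suc ?j) t" using N[OF t] t \<open>0 < \<epsilon>\<close> by (simp add: W_def)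
    also have "\<dots> = W ?j t" using step N[OF t] t by auto
    finally show ?thesis by (simp add: e_def)
  qed
  ultimately show ?thesis by blast
qed

text \<open>
  A diagonal subsequence converges at all rationals, and the common Lipschitz constants carry the
  Cauchy property over to all other points.
\<close>

lemma locally_equi_lipschitz_subsequence:
  fixes V :: "nat \<Rightarrow> real \<Rightarrow> 'a::euclidean_space"
  assumes V0: "\<And>k. V k 0 = 0"
    and lip: "\<And>T. \<exists>C\<ge>0. \<forall>k. \<forall>s\<in>{0..T}. \<forall>t\<in>{0..T}. norm (V k s - V k t) \<le> C * \<bar>s - t\<bar>"
  shows "\<exists>\<phi> :: nat \<Rightarrow> nat. strict_mono \<phi> \<and> (\<forall>t\<ge>0. convergent (\<lambda>k. V (\<phi> k) t))"
proof -
  obtain C where C: "\<And>T. 0 \<le> C T" "\<And>T k s t. \<lbrakk>s \<in> {0..T}; t \<in> {0..T}\<rbrakk> \<Longrightarrow> norm (V k s - V k t) \<le> C T * \<bar>s - t\<bar>"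
    using lip by metis
  \<comment> \<open>The bounds on \<open>V\<close> grow with \<open>x\<close>; the scaling makes the family uniformly bounded.\<close>
  define f where "f k x = V k x /\<^sub>R (1 + C x * x)" for k x
  define S where "S = \<rat> \<inter> {0::real..}"
  have pos: "1 + C x * x > 0" if "0 \<le> x" for x using C(1)[of x] that by (simp add: add_pos_nonneg)
  have "norm (f k x) \<le> 1" if "x \<in> S" for k x
  proof -
    have x: "0 \<le> x" using that by (simp add: S_def)
    have "norm (V k x) \<le> C x * x" using C(2)[of x x 0 k] x V0 by auto
    then show ?thesis using pos[OF x] by (simp add: f_def divide_inverse[symmetric] mult.commute[of "inverse _"])
  qed
  moreover have "countable S" unfolding S_def using countable_rat by blast
  ultimately obtain \<phi> :: "nat \<Rightarrow> nat" where \<phi>: "strict_mono \<phi>" "\<And>x. x \<in> S \<Longrightarrow> \<exists>l. (\<lambda>k. f (\<phi> k) x) \<longlonglongrightarrow> l"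
    using function_convergent_subsequence[of S f 1] by blast
  have conv: "Cauchy (\<lambda>k. V (\<phi> k) x)" if x: "x \<in> S" for x
  proof -
    obtain l where l: "(\<lambda>k. f (\<phi> k) x) \<longlonglongrightarrow> l" using \<phi>(2)[OF x] by blast
    have "(\<lambda>k. (1 + C x * x) *\<^sub>R f (\<phi> k) x) \<longlonglongrightarrow> (1 + C x * x) *\<^sub>R l" by (intro tendsto_intros l)
    moreover have "(1 + C x * x) *\<^sub>R f (\<phi> k) x = V (\<phi> k) x" for k
      using pos[of x] x by (simp add: f_def S_def)
    ultimately show ?thesis by (simp add: LIMSEQ_imp_Cauchy)
  qed
  have "convergent (\<lambda>k. V (\<phi> k) t)" if t: "0 \<le> t" for t
  proof (rule Cauchy_convergent, rule metric_CauchyI)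
    fix e :: real assume e: "0 < e"
    define c where "c = C (t + 1)"
    have c0: "0 \<le> c" by (simp add: c_def C)
    define d where "d = min 1 (e / (3 * (c + 1)))"
    have d: "d > 0" "c * d < e / 3" "d \<le> 1"
    proof -
      show "d > 0" "d \<le> 1" using e c0 by (auto simp: d_def)
      have "c * d \<le> c * (e / (3 * (c + 1)))" using c0 by (intro mult_left_mono) (auto simp: d_def)
      also have "\<dots> = (e / 3) * (c / (c + 1))" by simp
      also have "\<dots> < (e / 3) * 1" using e c0 by (intro mult_strict_left_mono) (auto simp: divide_less_eq)
      finally show "c * d < e / 3" by simp
    qed
    obtain x where x: "x \<in> \<rat>" "t < x" "x < t + d" using Rats_dense_in_real[of t "t + d"] d by auto
    then have xS: "x \<in> S" using t by (auto simp: S_def)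
    obtain K where K: "\<And>m n. m \<ge> K \<Longrightarrow> n \<ge> K \<Longrightarrow> dist (V (\<phi> m) x) (V (\<phi> n) x) < e / 3"
      using metric_CauchyD[OF conv[OF xS], of "e / 3"] e by auto
    have near: "dist (V k t) (V k x) < e / 3" for k
    proof -
      have "dist (V k t) (V k x) \<le> c * \<bar>t - x\<bar>"
        unfolding dist_norm c_def using x t d by (intro C(2)) auto
      also have "\<dots> \<le> c * d" using x c0 by (intro mult_left_mono) auto
      finally show ?thesis using d by simp
    qed
    show "\<exists>K. \<forall>m\<ge>K. \<forall>n\<ge>K. dist (V (\<phi> m) t) (V (\<phi> n) t) < e"
    proof (intro exI allI impI)
      fix m n assume "K \<le> m" "K \<le> n"
      then show "dist (V (\<phi> m) t) (V (\<phi> n) t) < e"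
        using K[of m n] near[of "\<phi> m"] near[of "\<phi> n"]
          dist_triangle[of "V (\<phi> m) t" "V (\<phi> n) t" "V (\<phi> m) x"] dist_triangle[of "V (\<phi> m) x" "V (\<phi> n) t" "V (\<phi> n) x"]
        by (simp add: dist_commute)
    qed
  qed
  then show ?thesis using \<phi>(1) by blast
qed

section \<open>Sampling sequences\<close>

locale sampling_sequence =
  fixes \<tau> :: "nat \<Rightarrow> real" and \<delta> :: real
  assumes \<tau>_0: "\<tau> 0 = 0" and \<tau>_lim: "filterlim \<tau> at_top sequentially"
    and \<tau>_step: "\<And>i. \<tau> i < \<tau> (Suc i)" "\<And>i. \<tau> (Suc i) \<le> \<tau> i + \<delta>"
begin

definition sample_index :: "real \<Rightarrow> nat" where
  "sample_index t = (LEAST i. t < \<tau> (Suc i))"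

definition last_sample :: "real \<Rightarrow> real" where
  "last_sample t = \<tau> (sample_index t)"

lemma \<tau>_mono: "i \<le> j \<Longrightarrow> \<tau> i \<le> \<tau> j"
  using lift_Suc_mono_le[of \<tau>] \<tau>_step(1) less_imp_le by blast

lemma \<tau>_nonneg: "0 \<le> \<tau> i"
  using \<tau>_mono[of 0 i] \<tau>_0 by simp

lemma sample_index_eq:
  assumes "t \<in> {\<tau> i..<\<tau> (Suc i)}"
  shows "sample_index t = i"
  unfolding sample_index_def
proof (rule Least_equality)
  show "t < \<tau> (Suc i)" using assms by simp
  fix j assume "t < \<tau> (Suc j)"
  show "i \<le> j"
  proof (rule ccontr)
    assume "\<not> i \<le> j"
    then have "\<tau> (Suc j) \<le> \<tau> i" by (intro \<tau>_mono) auto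
    then show False using assms \<open>t < \<tau> (Suc j)\<close> by auto
  qed
qed

lemma last_sample_eq: "t \<in> {\<tau> i..<\<tau> (Suc i)} \<Longrightarrow> last_sample t = \<tau> i"
  by (simp add: last_sample_def sample_index_eq)

lemma sample_index_interval:
  assumes "0 \<le> t"
  shows "t \<in> {\<tau> (sample_index t)..<\<tau> (Suc (sample_index t))}"
proof -
  obtain n where n: "t < \<tau> n"
    using \<tau>_lim by (metis filterlim_at_top_dense eventually_sequentially order_refl)
  then have ex: "t < \<tau> (Suc n)" using \<tau>_step(1)[of n] by linarith
  have 1: "t < \<tau> (Suc (sample_index t))" unfolding sample_index_def using ex by (rule LeastI[of "\<lambda>i. t < \<tau> (Suc i)"])
  have "\<tau> (sample_index t) \<le> t"
  proof (cases "sample_index t")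
    case 0
    then show ?thesis using \<tau>_0 assms by simp
  next
    case (Suc j)
    then have "\<not> t < \<tau> (Suc j)" unfolding sample_index_def by (metis lessI not_less_Least)
    then show ?thesis using Suc by simp
  qed
  with 1 show ?thesis by simp
qed

lemma last_sample:
  assumes "0 \<le> t"
  shows "0 \<le> last_sample t" "last_sample t \<le> t" "t \<le> last_sample t + \<delta>"
  using sample_index_interval[OF assms] \<tau>_step(2)[of "sample_index t"] \<tau>_nonneg
  by (auto simp: last_sample_def intro: order_trans)

lemma measurable_sample_index: "sample_index \<in> measurable (lebesgue_on {0..}) (count_space UNIV)"
proof (subst measurable_count_space_eq2_countable, intro conjI ballI)
  fix i
  have "sample_index -` {i} \<inter> space (lebesgue_on {0..}) = {\<tau> i..<\<tau> (Suc i)}"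
    using sample_index_interval sample_index_eq \<tau>_nonneg[of i] by auto
  moreover have "{\<tau> i..<\<tau> (Suc i)} \<in> sets (lebesgue_on {0..})"
    using \<tau>_nonneg[of i] by (auto simp: sets_restrict_space_iff)
  ultimately show "sample_index -` {i} \<inter> space (lebesgue_on {0..}) \<in> sets (lebesgue_on {0..})" by simp
qed auto

text \<open>
  Admissibility of the predicted output errors as measurement noise. Here \<open>\<rho> t\<close> is either \<open>t\<close> itself or
  the earlier time at which a delayed prediction stops integrating. The integral is a difference of values of
  one continuous primitive at measurable times.
\<close>

lemma Linf_loc_sampled_integral:
  fixes q :: "real \<Rightarrow> 'k::euclidean_space"
  assumes \<xi>: "\<xi> \<in> Linf_loc UNIV" and q: "q \<in> Linf_loc UNIV"
    and \<rho>: "\<rho> \<in> borel_measurable (lebesgue_on {0..})" "\<And>t. 0 \<le> t \<Longrightarrow> last_sample t \<le> \<rho> t \<and> \<rho> t \<le> t"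
  shows "(\<lambda>t. \<xi> (last_sample t) + integral {last_sample t..\<rho> t} q) \<in> Linf_loc UNIV"
proof (rule Linf_locI)
  have qi: "q integrable_on {a..b}" if "0 \<le> a" for a b
  proof -
    obtain M where "\<forall>t\<in>{0..b}. norm (q t) \<le> M" using Linf_locD(3)[OF q] by blast
    then show ?thesis using that Linf_locD(1)[OF q] by (intro integrable_on_interval_if_bounded) auto
  qed
  define V where "V t = integral {0..t} q" for t
  have split: "integral {a..b} q = V b - V a" if "0 \<le> a" "a \<le> b" for a b
    using Henstock_Kurzweil_Integration.integral_combine[OF that qi] by (simp add: V_def algebra_simps)
  have "continuous_on {0..} V"
  proof -
    have "continuous (at t within {0..}) V" if "t \<in> {0..}" for t
    proof -
      have "continuous_on {0..t+1} V"
        unfolding V_def using qi by (intro indefinite_integral_continuous_1) auto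
      then have "continuous (at t within {0..t+1}) V" using that by (auto simp: continuous_on_eq_continuous_within)
      moreover have "at t within {0..t+1} = at t within {0..}"
        by (rule at_within_nhd[of _ "{..<t+1}"]) auto
      ultimately show ?thesis by simp
    qed
    then show ?thesis by (simp add: continuous_on_eq_continuous_within)
  qed
  then have Vm: "V \<in> borel_measurable (restrict_space borel {0..})"
    by (rule borel_measurable_continuous_on_restrict)
  have comp: "(\<lambda>t. V (\<sigma> t)) \<in> borel_measurable (lebesgue_on {0..})"
    if "\<sigma> \<in> borel_measurable (lebesgue_on {0..})" "\<And>t. 0 \<le> t \<Longrightarrow> 0 \<le> \<sigma> t" for \<sigma>
    by (rule measurable_compose[OF measurable_restrict_space2 Vm]) (use that in auto)
  have lm: "(\<lambda>t. \<psi> (last_sample t)) \<in> borel_measurable (lebesgue_on {0..})" for \<psi> :: "real \<Rightarrow> 'b::topological_space"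
    unfolding last_sample_def by (rule measurable_compose[OF measurable_sample_index]) simp
  have "(\<lambda>t. \<xi> (last_sample t) + (V (\<rho> t) - V (last_sample t))) \<in> borel_measurable (lebesgue_on {0..})"
    using \<rho> last_sample by (intro borel_measurable_add borel_measurable_diff comp lm) (auto intro: order_trans)
  then show "(\<lambda>t. \<xi> (last_sample t) + integral {last_sample t..\<rho> t} q) \<in> borel_measurable (lebesgue_on {0..})"
    by (rule measurable_cong[THEN iffD1, rotated]) (use split \<rho>(2) last_sample in auto)
  fix T :: real assume "0 \<le> T"
  obtain M where M: "\<And>t. t \<in> {0..T} \<Longrightarrow> norm (q t) \<le> M" "M \<ge> 0" using Linf_locD(3)[OF q] by metis
  obtain X where X: "\<And>t. t \<in> {0..T} \<Longrightarrow> norm (\<xi> t) \<le> X" using Linf_locD(3)[OF \<xi>] by metis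
  have "norm (\<xi> (last_sample t) + integral {last_sample t..\<rho> t} q) \<le> X + M * T" if t: "t \<in> {0..T}" for t
  proof -
    have l: "0 \<le> last_sample t" "last_sample t \<le> \<rho> t" "\<rho> t \<le> t" using last_sample[of t] \<rho>(2)[of t] t by auto
    have "norm (integral {last_sample t..\<rho> t} q) \<le> integral {last_sample t..\<rho> t} (\<lambda>_. M)"
      using l t by (intro Henstock_Kurzweil_Integration.integral_norm_bound_integral qi M) auto
    also have "\<dots> = M * (\<rho> t - last_sample t)" using l by simp
    also have "\<dots> \<le> M * T" using l t M(2) by (intro mult_left_mono) auto
    finally show ?thesis using X[of "last_sample t"] l t by (intro norm_triangle_mono) auto
  qed
  then show "\<exists>M. \<forall>t\<in>{0..T}. norm (\<xi> (last_sample t) + integral {last_sample t..\<rho> t} q) \<le> M" by blast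
qed simp

end

section \<open>The observer driven by predicted outputs\<close>

text \<open>
  One run of the closed loop: sampling times, inputs, initial histories and the plant trajectory \<open>x\<close>
  are fixed, so that only the observer trajectory and the predictor remain unknown.
\<close>

locale sampled_observer = sampling_sequence \<tau> \<delta>
  for \<tau> :: "nat \<Rightarrow> real" and \<delta> :: real +
  fixes U :: "(real^'m) set" and D :: "(real^'q) set" and r :: real
    and f :: "(real \<Rightarrow>\<^sub>C (real^'n)) \<times> (real^'m) \<times> (real^'q) \<Rightarrow> (real^'n)"
    and h :: "(real \<Rightarrow>\<^sub>C (real^'n)) \<Rightarrow> (real^'k)"
    and R :: "(real \<Rightarrow>\<^sub>C (real^'n)) \<times> (real^'m) \<times> (real^'q) \<Rightarrow> (real^'k)"
    and F :: "(real \<Rightarrow>\<^sub>C (real^'l)) \<times> (real^'k) \<times> (real^'m) \<Rightarrow> (real^'l)"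
    and \<Psi> :: "(real \<Rightarrow>\<^sub>C (real^'l)) \<Rightarrow> (real \<Rightarrow>\<^sub>C (real^'n))"
    and L \<gamma> \<sigma> \<omega> B :: real and \<kappa> g a :: "real \<Rightarrow> real"
    and u :: "real \<Rightarrow> real^'m" and d :: "real \<Rightarrow> real^'q" and \<xi> :: "real \<Rightarrow> real^'k"
    and x0 :: "real \<Rightarrow>\<^sub>C (real^'n)" and z0 :: "real \<Rightarrow>\<^sub>C (real^'l)" and x :: "real \<Rightarrow> real^'n"
  assumes r: "0 < r" and D0: "0 \<in> D"
    and f: "continuous_on (C0 r \<times> U \<times> D) f" "bounded_on_bounded (C0 r \<times> U \<times> D) f"
      "one_sided_lipschitz_on_bounded (C0 r \<times> U \<times> D) f"
    and h: "continuous_on (C0 r) h"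
    and R: "continuous_on (C0 r \<times> U \<times> D) R"
    and output_ac: "has_ac_derivative_on {0..} (\<lambda>t. h (history r x t)) (\<lambda>t. R (history r x t, u t, d t))"
    and L: "0 \<le> L" and \<kappa>: "\<kappa> \<in> class_K"
    and R_lip: "\<And>\<phi> \<psi> v e. \<lbrakk>\<phi> \<in> C0 r; \<psi> \<in> C0 r; v \<in> U; e \<in> D\<rbrakk> \<Longrightarrow>
           norm (R (\<psi>, v, 0) - R (\<phi>, v, e)) \<le> L * norm (\<psi> - \<phi>) + \<kappa> (norm e)"
    and reo: "robust_exponential_observer r U D f h F \<Psi> \<gamma> \<sigma> g a"
    and \<delta>: "0 < \<delta>" and \<omega>: "0 < \<omega>" "\<omega> \<le> \<sigma>"
    and B: "B = \<gamma> * L * ((exp (\<omega> * \<delta>) - 1) / \<omega>)" "B < 1"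
    and x0: "x0 \<in> C0 r" and z0: "z0 \<in> C0 r"
    and u: "u \<in> Linf_loc U" and d: "d \<in> Linf_loc D" and \<xi>: "\<xi> \<in> Linf_loc UNIV"
    and x: "delay_solution r (\<lambda>\<phi> t. f (\<phi>, u t, d t)) x0 x"
begin

lemma F: "continuous_on (C0 r \<times> UNIV \<times> U) F" "bounded_on_bounded (C0 r \<times> UNIV \<times> U) F"
    "one_sided_lipschitz_on_bounded (C0 r \<times> UNIV \<times> U) F"
  and \<Psi>: "continuous_on (C0 r) \<Psi>" "\<And>\<phi>. \<phi> \<in> C0 r \<Longrightarrow> \<Psi> \<phi> \<in> C0 r"
  and gains: "0 < \<gamma>" "g \<in> class_K" "a \<in> class_K_infinity"
  using reo unfolding robust_exponential_observer_def by auto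

lemma x_cont: "continuous_on {-r..} x"
  using x by (simp add: delay_solution_def)

lemma x_C0: "0 \<le> t \<Longrightarrow> history r x t \<in> C0 r"
  using history_in_C0[OF r x_cont] .

text \<open>
  The observer property speaks about some plant trajectory for each noise signal; by uniqueness it is always
  the given \<open>x\<close>.
\<close>

lemma plant_unique:
  assumes "delay_solution r (\<lambda>\<phi> t. f (\<phi>, u t, d t)) x0 x'" "0 \<le> t"
  shows "history r x' t = history r x t"
  using delay_solution_unique[OF r f x Linf_loc_Pair[OF u d] assms(1) Linf_loc_Pair[OF u d], of t t] assms(2)
  by simp

lemma output_Linf_loc: "(\<lambda>t. h (history r x t)) \<in> Linf_loc UNIV"
  by (intro continuous_on_imp_Linf_loc continuous_on_compose2[OF h continuous_on_history[OF r x_cont]])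
    (auto intro: x_C0)

text \<open>
  The observer trajectory \<open>z\<close> when the output of the plant is corrupted by \<open>e\<close>. The predictor \<open>w\<close>
  corresponds to \<open>e t = w t - h (x_t)\<close>.
\<close>

definition observes :: "(real \<Rightarrow> real^'k) \<Rightarrow> (real \<Rightarrow> real^'l) \<Rightarrow> bool" where
  "observes e z \<longleftrightarrow> delay_solution r (\<lambda>\<phi> t. F (\<phi>, h (history r x t) + e t, u t)) z0 z"

text \<open>
  The rate of change of the predicted output error between samples.
\<close>

definition drift :: "(real \<Rightarrow> real^'l) \<Rightarrow> real \<Rightarrow> real^'k" where
  "drift z t = R (\<Psi> (history r z t), u t, 0) - R (history r x t, u t, d t)"

definition error :: "(real \<Rightarrow> real^'l) \<Rightarrow> real \<Rightarrow> real" where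
  "error z t = norm (\<Psi> (history r z t) - history r x t)"

text \<open>
  The right-hand side of the final estimate, with the disturbance gain written out.
\<close>

definition error_bound :: "real \<Rightarrow> real" where
  "error_bound t = inverse (1 - B) * exp (- \<omega> * t) * a (norm x0 + norm z0)
      + inverse (1 - B) * \<gamma> * exp (\<omega> * \<delta>) * (SUP s\<in>{0..t}. norm (\<xi> s) * exp (- \<omega> * (t - s)))
      + (SUP s\<in>{0..t}. inverse (1 - B) * (g (norm (d s)) + \<gamma> * \<delta> * \<kappa> (norm (d s))))"

lemma observesD:
  assumes "observes e z"
  shows "continuous_on {-r..} z" "0 \<le> t \<Longrightarrow> history r z t \<in> C0 r" "continuous_on {0..} (history r z)"
  using assms history_in_C0[OF r, of z] continuous_on_history[OF r, of z]
  by (auto simp: observes_def delay_solution_def)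

lemma observed_input_Linf_loc:
  assumes "e \<in> Linf_loc UNIV"
  shows "(\<lambda>t. (h (history r x t) + e t, u t)) \<in> Linf_loc (UNIV \<times> U)"
  by (intro Linf_loc_Pair Linf_loc_add output_Linf_loc assms u)

lemma ex_observes:
  assumes e: "e \<in> Linf_loc UNIV"
  shows "\<exists>z. observes e z"
proof -
  obtain x' z where xz: "delay_solution r (\<lambda>\<phi> t. f (\<phi>, u t, d t)) x0 x'"
      "delay_solution r (\<lambda>\<phi> t. F (\<phi>, h (history r x' t) + e t, u t)) z0 z"
    using reo x0 z0 u d e unfolding robust_exponential_observer_def Let_def by blast
  have "observes e z"
    unfolding observes_def
    by (rule delay_solution_cong[THEN iffD1, OF _ xz(2)]) (simp add: plant_unique[OF xz(1)])
  then show ?thesis by blast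
qed

lemma observes_estimate:
  assumes e: "e \<in> Linf_loc UNIV" and z: "observes e z" and "0 \<le> t"
  shows "error z t \<le> exp (- \<sigma> * t) * a (norm x0 + norm z0)
      + \<gamma> * (SUP s\<in>{0..t}. norm (e s) * exp (- \<sigma> * (t - s))) + (SUP s\<in>{0..t}. g (norm (d s)))"
  using reo x0 z0 u d e x z \<open>0 \<le> t\<close> unfolding robust_exponential_observer_def Let_def observes_def error_def by blast

text \<open>
  The reason why an integral that stops \<open>\<epsilon>\<close> before the present defines a causal map with gain \<open>\<epsilon>\<close>.
\<close>

lemma observes_causal:
  assumes "e \<in> Linf_loc UNIV" "observes e z" "e' \<in> Linf_loc UNIV" "observes e' z'"
    and "\<And>t. t \<in> {0..<T} \<Longrightarrow> e t = e' t" and "t \<in> {0..T}"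
  shows "history r z t = history r z' t"
  using delay_solution_unique[OF r F assms(4)[unfolded observes_def] observed_input_Linf_loc[OF assms(3)]
      assms(2)[unfolded observes_def] observed_input_Linf_loc[OF assms(1)], of T t] assms(5,6)
  by simp

lemma continuous_on_error:
  assumes "observes e z"
  shows "continuous_on {0..} (error z)"
  unfolding error_def
  by (intro continuous_intros continuous_on_compose2[OF \<Psi>(1)] continuous_on_history[OF r x_cont]
      observesD(3)[OF assms]) (auto intro: observesD(2)[OF assms])

lemma norm_drift_le:
  assumes "observes e z" "0 \<le> t"
  shows "norm (drift z t) \<le> L * error z t + \<kappa> (norm (d t))"
  unfolding drift_def error_def
  using assms by (intro R_lip \<Psi>(2) observesD(2) x_C0 Linf_locD(2)[OF u] Linf_locD(2)[OF d])

lemma \<kappa>_mono: "\<lbrakk>0 \<le> s; s \<le> t\<rbrakk> \<Longrightarrow> \<kappa> s \<le> \<kappa> t"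
  using \<kappa> strict_mono_on_leD[of "{0..}" \<kappa> s t] by (auto simp: class_K_def)

lemma drift_Linf_loc:
  assumes z: "observes e z"
  shows "drift z \<in> Linf_loc UNIV"
proof (rule Linf_locI)
  have "(\<lambda>t. R (\<Psi> (history r z t), u t, 0)) \<in> borel_measurable (lebesgue_on {0..})"
    by (rule borel_measurable_along_path[where p = "\<lambda>t. (u t, 0)" and C = "C0 r" and P = "U \<times> D", OF _ _ _ _ R])
      (use D0 in \<open>auto intro!: continuous_on_compose2[OF \<Psi>(1) observesD(3)[OF z]] observesD(2)[OF z] \<Psi>(2)
        borel_measurable_Pair Linf_locD[OF u]\<close>)
  moreover have "(\<lambda>t. R (history r x t, u t, d t)) \<in> borel_measurable (lebesgue_on {0..})"
    by (rule borel_measurable_along_path[where p = "\<lambda>t. (u t, d t)" and C = "C0 r" and P = "U \<times> D", OF _ _ _ _ R])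
      (auto intro!: continuous_on_history[OF r x_cont] x_C0 borel_measurable_Pair Linf_locD[OF u] Linf_locD[OF d])
  ultimately show "drift z \<in> borel_measurable (lebesgue_on {0..})"
    unfolding drift_def by (rule borel_measurable_diff)
  fix T :: real assume "0 \<le> T"
  obtain M where M: "\<And>t. t \<in> {0..T} \<Longrightarrow> norm (d t) \<le> M" using Linf_locD(3)[OF d] by metis
  obtain C where C: "\<And>t. t \<in> {0..T} \<Longrightarrow> norm (error z t) \<le> C"
    using Linf_locD(3)[OF continuous_on_imp_Linf_loc[OF continuous_on_error[OF z]]] by metis
  have "norm (drift z t) \<le> L * C + \<kappa> M" if t: "t \<in> {0..T}" for t
  proof -
    have "norm (drift z t) \<le> L * error z t + \<kappa> (norm (d t))" using t by (intro norm_drift_le[OF z]) auto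
    also have "\<dots> \<le> L * C + \<kappa> M"
      using C[OF t] M[OF t] L by (intro add_mono mult_left_mono \<kappa>_mono) auto
    finally show ?thesis .
  qed
  then show "\<exists>M. \<forall>t\<in>{0..T}. norm (drift z t) \<le> M" by blast
qed simp

lemma drift_integrable:
  assumes "observes e z" "0 \<le> s"
  shows "drift z integrable_on {s..t}"
proof -
  obtain M where "\<forall>t\<in>{0..t}. norm (drift z t) \<le> M" using Linf_locD(3)[OF drift_Linf_loc[OF assms(1)]] by blast
  then show ?thesis
    using assms(2) Linf_locD(1)[OF drift_Linf_loc[OF assms(1)]] by (intro integrable_on_interval_if_bounded) auto
qed

text \<open>
  Covers the exact prediction, \<open>\<rho> s = s\<close>, and the delayed predictions, so the same bound
  yields the final estimate and the compactness needed for existence.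
\<close>

lemma sampled_error_estimate:
  assumes e: "e \<in> Linf_loc UNIV" and z: "observes e z"
    and pred: "\<And>s. 0 \<le> s \<Longrightarrow> last_sample s \<le> \<rho> s \<and> \<rho> s \<le> s \<and>
        e s = \<xi> (last_sample s) + integral {last_sample s..\<rho> s} (drift z)"
    and t: "0 \<le> t"
  shows "error z t \<le> error_bound t"
  unfolding error_bound_def
proof (rule sampled_small_gain_estimate[OF \<omega> \<delta> gains(1) L _ B continuous_on_error[OF z],
      where n = "\<lambda>s. norm (e s)" and q = "drift z"])
  have "norm x0 + norm z0 \<ge> 0" by simp
  then show "0 \<le> a (norm x0 + norm z0)"
    using gains(3) strict_mono_on_leD[of "{0..}" a 0 "norm x0 + norm z0"]
    by (auto simp: class_K_infinity_def class_K_def)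
  have bdd: "bdd_above ((\<lambda>s. norm (y s)) ` {0..t})" if "y \<in> Linf_loc A" for y :: "real \<Rightarrow> 'b::euclidean_space" and A
    using Linf_locD(3)[OF that, of t] by (auto intro: bdd_aboveI2)
  show "bdd_above ((\<lambda>s. norm (\<xi> s)) ` {0..t})" by (rule bdd[OF \<xi>])
  show "bdd_above ((\<lambda>s. norm (d s)) ` {0..t})" by (rule bdd[OF d])
  show "\<exists>\<tau>0 \<tau>1. 0 \<le> \<tau>0 \<and> \<tau>0 \<le> \<tau>1 \<and> \<tau>1 \<le> s \<and> s \<le> \<tau>0 + \<delta> \<and>
      norm (e s) \<le> norm (\<xi> \<tau>0) + norm (integral {\<tau>0..\<tau>1} (drift z))" if s: "0 \<le> s" for s
    using pred[OF s] last_sample[OF s]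
    by (intro exI[of _ "last_sample s"] exI[of _ "\<rho> s"]) (auto intro: norm_triangle_ineq)
  show "norm (drift z s) \<le> L * error z s + \<kappa> (norm (d s))" if "s \<in> {0..t}" for s
    using that by (intro norm_drift_le[OF z]) auto
  show "error z t \<le> exp (- \<sigma> * t) * a (norm x0 + norm z0)
      + \<gamma> * (SUP s\<in>{0..t}. norm (e s) * exp (- \<sigma> * (t - s))) + (SUP s\<in>{0..t}. g (norm (d s)))" if "0 \<le> t" for t
    by (rule observes_estimate[OF e z that])
qed (use gains \<kappa> t drift_integrable[OF z] in \<open>auto simp: error_def\<close>)

lemma error_bound_bounded: "\<exists>C. \<forall>t\<in>{0..T}. error_bound t \<le> C"
proof -
  obtain X where X: "\<And>t. t \<in> {0..T} \<Longrightarrow> norm (\<xi> t) \<le> X" "0 \<le> X" using Linf_locD(3)[OF \<xi>] by metis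
  obtain M where M: "\<And>t. t \<in> {0..T} \<Longrightarrow> norm (d t) \<le> M" "0 \<le> M" using Linf_locD(3)[OF d] by metis
  have iB: "0 \<le> inverse (1 - B)" using B(2) by simp
  have a0: "0 \<le> a (norm x0 + norm z0)"
    using gains(3) strict_mono_on_leD[of "{0..}" a 0 "norm x0 + norm z0"]
    by (auto simp: class_K_infinity_def class_K_def)
  have g_mono: "g s \<le> g t" if "0 \<le> s" "s \<le> t" for s t
    using gains(2) strict_mono_on_leD[of "{0..}" g s t] that by (auto simp: class_K_def)
  have "error_bound t \<le> inverse (1 - B) * 1 * a (norm x0 + norm z0) + inverse (1 - B) * \<gamma> * exp (\<omega> * \<delta>) * X
      + inverse (1 - B) * (g M + \<gamma> * \<delta> * \<kappa> M)" if t: "t \<in> {0..T}" for t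
    unfolding error_bound_def
  proof (intro add_mono)
    show "inverse (1 - B) * exp (- \<omega> * t) * a (norm x0 + norm z0) \<le> inverse (1 - B) * 1 * a (norm x0 + norm z0)"
      using t iB a0 \<omega> by (intro mult_right_mono mult_left_mono) auto
    have "(SUP s\<in>{0..t}. norm (\<xi> s) * exp (- \<omega> * (t - s))) \<le> X"
    proof (rule cSUP_least)
      fix s assume s: "s \<in> {0..t}"
      have "norm (\<xi> s) * exp (- \<omega> * (t - s)) \<le> X * 1"
        using s t X \<omega> by (intro mult_mono) auto
      then show "norm (\<xi> s) * exp (- \<omega> * (t - s)) \<le> X" by simp
    qed (use t in auto)
    then show "inverse (1 - B) * \<gamma> * exp (\<omega> * \<delta>) * (SUP s\<in>{0..t}. norm (\<xi> s) * exp (- \<omega> * (t - s)))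
        \<le> inverse (1 - B) * \<gamma> * exp (\<omega> * \<delta>) * X"
      using iB gains(1) by (intro mult_left_mono) auto
    show "(SUP s\<in>{0..t}. inverse (1 - B) * (g (norm (d s)) + \<gamma> * \<delta> * \<kappa> (norm (d s)))) \<le> inverse (1 - B) * (g M + \<gamma> * \<delta> * \<kappa> M)"
    proof (rule cSUP_least)
      fix s assume s: "s \<in> {0..t}"
      then show "inverse (1 - B) * (g (norm (d s)) + \<gamma> * \<delta> * \<kappa> (norm (d s))) \<le> inverse (1 - B) * (g M + \<gamma> * \<delta> * \<kappa> M)"
        using t M(1)[of s] iB gains(1) \<delta> by (intro mult_left_mono add_mono g_mono \<kappa>_mono) auto
    qed (use t in auto)
  qed
  then show ?thesis by blast
qed

lemma ex_delayed_prediction: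
  assumes "0 < \<epsilon>"
  shows "\<exists>e z. e \<in> Linf_loc UNIV \<and> observes e z \<and>
      (\<forall>t\<ge>0. e t = \<xi> (last_sample t) + integral {last_sample t..max (last_sample t) (t - \<epsilon>)} (drift z))"
proof -
  define Z where "Z e = (SOME z. observes e z)" for e
  have Z: "observes e (Z e)" if "e \<in> Linf_loc UNIV" for e
    unfolding Z_def using ex_observes[OF that] by (rule someI_ex)
  define P where "P e = (\<lambda>t. \<xi> (last_sample t) + integral {last_sample t..max (last_sample t) (t - \<epsilon>)} (drift (Z e)))" for e
  have ls: "last_sample \<in> borel_measurable (lebesgue_on {0..})"
    unfolding last_sample_def[abs_def] by (rule measurable_compose[OF measurable_sample_index]) simp
  have "\<exists>e\<in>Linf_loc UNIV. \<forall>t\<ge>0. P e t = e t"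
  proof (rule causal_fixed_point[OF assms])
    show "P e \<in> Linf_loc UNIV" if "e \<in> Linf_loc UNIV" for e
      unfolding P_def
    proof (rule Linf_loc_sampled_integral[OF \<xi> drift_Linf_loc[OF Z[OF that]]])
      have "(\<lambda>t. t - \<epsilon>) \<in> borel_measurable (lebesgue_on {0..})"
        by (intro continuous_imp_measurable_on_sets_lebesgue continuous_intros) auto
      then show "(\<lambda>t. max (last_sample t) (t - \<epsilon>)) \<in> borel_measurable (lebesgue_on {0..})"
        using ls by (intro borel_measurable_max)
    qed (use last_sample assms in auto)
    fix e e' :: "real \<Rightarrow> real^'k" and T :: real
    assume e: "e \<in> Linf_loc UNIV" "e' \<in> Linf_loc UNIV" and T: "0 \<le> T" "\<forall>t\<in>{0..<T}. e t = e' t"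
    have same: "drift (Z e) t = drift (Z e') t" if "t \<in> {0..T}" for t
      unfolding drift_def using observes_causal[OF e(1) Z[OF e(1)] e(2) Z[OF e(2)], of T t] T(2) that by simp
    show "\<forall>t\<in>{0..<T + \<epsilon>}. P e t = P e' t"
    proof
      fix t assume t: "t \<in> {0..<T + \<epsilon>}"
      have "integral {last_sample t..max (last_sample t) (t - \<epsilon>)} (drift (Z e))
          = integral {last_sample t..max (last_sample t) (t - \<epsilon>)} (drift (Z e'))"
      proof (cases "last_sample t \<le> t - \<epsilon>")
        case True
        then show ?thesis using t last_sample(1)[of t] by (intro integral_cong same) auto
      next
        case False
        then show ?thesis by simp
      qed
      then show "P e t = P e' t" by (simp add: P_def)
    qed
  qed
  then obtain e where e: "e \<in> Linf_loc UNIV" "\<forall>t\<ge>0. P e t = e t" by blast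
  then show ?thesis using Z[OF e(1)] by (intro exI[of _ e] exI[of _ "Z e"]) (auto simp: P_def)
qed

text \<open>
  The limit of delayed predictions as the delay vanishes. Since the drifts are bounded by constants
  that do not involve the delay, their primitives \<open>V\<close> converge along a subsequence, and with them
  the signals \<open>ek\<close>. Bounded pointwise convergence of the inputs gives convergence of the observer
  histories, hence of the drifts, and dominated convergence identifies the limit of the primitives as
  the primitive of the limiting drift.
\<close>

lemma ex_prediction:
  "\<exists>e z. e \<in> Linf_loc UNIV \<and> observes e z \<and>
      (\<forall>t\<ge>0. e t = \<xi> (last_sample t) + integral {last_sample t..t} (drift z))"
proof -
  define \<epsilon> where "\<epsilon> k = 1 / real (Suc k)" for k
  have \<epsilon>: "0 < \<epsilon> k" for k by (simp add: \<epsilon>_def)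
  obtain ek zk where ek: "\<And>k. ek k \<in> Linf_loc UNIV" and zk: "\<And>k. observes (ek k) (zk k)"
    and ek_eq: "\<And>k t. 0 \<le> t \<Longrightarrow>
        ek k t = \<xi> (last_sample t) + integral {last_sample t..max (last_sample t) (t - \<epsilon> k)} (drift (zk k))"
    using ex_delayed_prediction[OF \<epsilon>] by metis
  have err: "error (zk k) t \<le> error_bound t" if "0 \<le> t" for k t
  proof (rule sampled_error_estimate[OF ek zk _ that])
    fix s :: real assume "0 \<le> s"
    then show "last_sample s \<le> max (last_sample s) (s - \<epsilon> k) \<and> max (last_sample s) (s - \<epsilon> k) \<le> s \<and>
        ek k s = \<xi> (last_sample s) + integral {last_sample s..max (last_sample s) (s - \<epsilon> k)} (drift (zk k))"
      using last_sample[of s] \<epsilon>[of k] ek_eq by auto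
  qed
  have "\<exists>C\<ge>0. \<forall>k. \<forall>t\<in>{0..T}. norm (drift (zk k) t) \<le> C" for T
  proof -
    obtain E where E: "\<And>t. t \<in> {0..T} \<Longrightarrow> error_bound t \<le> E" using error_bound_bounded by blast
    obtain M where M: "\<And>t. t \<in> {0..T} \<Longrightarrow> norm (d t) \<le> M" using Linf_locD(3)[OF d] by metis
    have "norm (drift (zk k) t) \<le> max 0 (L * E + \<kappa> M)" if t: "t \<in> {0..T}" for k t
    proof -
      have "norm (drift (zk k) t) \<le> L * error (zk k) t + \<kappa> (norm (d t))" using t by (intro norm_drift_le[OF zk]) auto
      also have "\<dots> \<le> L * E + \<kappa> M"
        using err[of t k] E[OF t] M[OF t] L t by (intro add_mono mult_left_mono \<kappa>_mono) auto
      finally show ?thesis by simp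
    qed
    then show ?thesis by (intro exI[of _ "max 0 (L * E + \<kappa> M)"]) auto
  qed
  then obtain C where C: "\<And>T. 0 \<le> C T" "\<And>T k t. t \<in> {0..T} \<Longrightarrow> norm (drift (zk k) t) \<le> C T"
    by metis
  define V where "V k t = integral {0..t} (drift (zk k))" for k t
  have split: "integral {s..t} (drift (zk k)) = V k t - V k s" if "0 \<le> s" "s \<le> t" for k s t
    using Henstock_Kurzweil_Integration.integral_combine[OF that drift_integrable[OF zk]] by (simp add: V_def algebra_simps)
  have int_le: "norm (integral {s..t} (drift (zk k))) \<le> C T * (t - s)" if "0 \<le> s" "s \<le> t" "t \<le> T" for k s t T
  proof -
    have "norm (integral {s..t} (drift (zk k))) \<le> integral {s..t} (\<lambda>_. C T)"
      using that C by (intro Henstock_Kurzweil_Integration.integral_norm_bound_integral drift_integrable[OF zk]) auto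
    then show ?thesis using that by (simp add: mult.commute)
  qed
  have lip: "norm (V k s - V k t) \<le> C T * \<bar>s - t\<bar>" if "s \<in> {0..T}" "t \<in> {0..T}" for k s t T
    using int_le[of s t T k] int_le[of t s T k] split[of s t k] split[of t s k] that
    by (cases "s \<le> t") (auto simp: norm_minus_commute)
  obtain \<phi> :: "nat \<Rightarrow> nat" where \<phi>: "strict_mono \<phi>" "\<And>t. 0 \<le> t \<Longrightarrow> convergent (\<lambda>k. V (\<phi> k) t)"
  proof -
    have "\<exists>\<phi> :: nat \<Rightarrow> nat. strict_mono \<phi> \<and> (\<forall>t\<ge>0. convergent (\<lambda>k. V (\<phi> k) t))"
    proof (rule locally_equi_lipschitz_subsequence)
      show "V k 0 = 0" for k by (simp add: V_def)
      show "\<exists>B\<ge>0. \<forall>k. \<forall>s\<in>{0..T}. \<forall>t\<in>{0..T}. norm (V k s - V k t) \<le> B * \<bar>s - t\<bar>" for T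
        using C(1)[of T] lip[of _ T] by (intro exI[of _ "C T"] conjI allI ballI)
    qed
    then show ?thesis using that by blast
  qed
  define W where "W t = lim (\<lambda>k. V (\<phi> k) t)" for t
  have W: "(\<lambda>k. V (\<phi> k) t) \<longlonglongrightarrow> W t" if "0 \<le> t" for t
    using \<phi>(2)[OF that] unfolding W_def convergent_LIMSEQ_iff .
  have \<epsilon>\<phi>: "(\<lambda>k. \<epsilon> (\<phi> k)) \<longlonglongrightarrow> 0"
    using LIMSEQ_subseq_LIMSEQ[OF LIMSEQ_inverse_real_of_nat \<phi>(1)] by (simp add: \<epsilon>_def o_def inverse_eq_divide)
  define e where "e t = \<xi> (last_sample t) + (W t - W (last_sample t))" for t
  have ek_lim: "(\<lambda>k. ek (\<phi> k) t) \<longlonglongrightarrow> e t" if t: "0 \<le> t" for t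
  proof -
    let ?m = "\<lambda>k. max (last_sample t) (t - \<epsilon> (\<phi> k))"
    note l = last_sample[OF t]
    have near: "norm (V (\<phi> k) (?m k) - V (\<phi> k) t) \<le> C t * \<epsilon> (\<phi> k)" for k
    proof -
      have "norm (V (\<phi> k) (?m k) - V (\<phi> k) t) \<le> C t * \<bar>?m k - t\<bar>"
        using l \<epsilon>[of "\<phi> k"] by (intro lip) auto
      also have "\<dots> \<le> C t * \<epsilon> (\<phi> k)" using l \<epsilon>[of "\<phi> k"] C(1)[of t] by (intro mult_left_mono) auto
      finally show ?thesis .
    qed
    have "(\<lambda>k. C t * \<epsilon> (\<phi> k)) \<longlonglongrightarrow> 0" using tendsto_mult_left[OF \<epsilon>\<phi>, of "C t"] by simp
    then have "(\<lambda>k. V (\<phi> k) (?m k) - V (\<phi> k) t) \<longlonglongrightarrow> 0"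
      by (rule Lim_null_comparison[OF always_eventually[OF allI[OF near]]])
    then have "(\<lambda>k. \<xi> (last_sample t) + ((V (\<phi> k) (?m k) - V (\<phi> k) t) + (V (\<phi> k) t - V (\<phi> k) (last_sample t))))
        \<longlonglongrightarrow> \<xi> (last_sample t) + (0 + (W t - W (last_sample t)))"
      using t l by (intro tendsto_intros W) auto
    moreover have "ek (\<phi> k) t = \<xi> (last_sample t) + ((V (\<phi> k) (?m k) - V (\<phi> k) t) + (V (\<phi> k) t - V (\<phi> k) (last_sample t)))" for k
      using ek_eq[OF t, of "\<phi> k"] split[of "last_sample t" "?m k" "\<phi> k"] l by simp
    ultimately show ?thesis by (simp add: e_def)
  qed
  have ek_bd: "\<exists>M. \<forall>k. \<forall>t\<in>{0..T}. norm (ek k t) \<le> M" for T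
  proof -
    obtain X where X: "\<And>t. t \<in> {0..T} \<Longrightarrow> norm (\<xi> t) \<le> X" using Linf_locD(3)[OF \<xi>] by metis
    have "norm (ek k t) \<le> X + C T * T" if t: "t \<in> {0..T}" for k t
    proof -
      note l = last_sample[of t]
      have "norm (integral {last_sample t..max (last_sample t) (t - \<epsilon> k)} (drift (zk k)))
          \<le> C T * (max (last_sample t) (t - \<epsilon> k) - last_sample t)"
        using l t \<epsilon>[of k] by (intro int_le) auto
      also have "\<dots> \<le> C T * T" using l t \<epsilon>[of k] C(1) by (intro mult_left_mono) auto
      finally show ?thesis using ek_eq[of t k] X[of "last_sample t"] l t by (auto intro: norm_triangle_mono)
    qed
    then show ?thesis by blast
  qed
  have e: "e \<in> Linf_loc UNIV"
  proof (rule Linf_locI)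
    show "e \<in> borel_measurable (lebesgue_on {0..})"
      by (rule borel_measurable_LIMSEQ_metric[of "\<lambda>k. ek (\<phi> k)"]) (use ek_lim Linf_locD(1)[OF ek] in auto)
    fix T :: real assume "0 \<le> T"
    obtain M where "\<forall>k. \<forall>t\<in>{0..T}. norm (ek k t) \<le> M" using ek_bd by blast
    then have "norm (e t) \<le> M" if "t \<in> {0..T}" for t
      using that by (intro LIMSEQ_le_const2[OF tendsto_norm[OF ek_lim[of t]]]) auto
    then show "\<exists>M. \<forall>t\<in>{0..T}. norm (e t) \<le> M" by blast
  qed simp
  obtain z where z: "observes e z" using ex_observes[OF e] by blast
  have hist_lim: "(\<lambda>k. history r (zk (\<phi> k)) t) \<longlonglongrightarrow> history r z t" if t: "0 \<le> t" for t
  proof -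
    obtain M1 where M1: "\<And>k s. s \<in> {0..t} \<Longrightarrow> norm (ek k s) \<le> M1" using ek_bd by metis
    obtain M2 where M2: "\<And>s. s \<in> {0..t} \<Longrightarrow> norm (h (history r x s)) \<le> M2" using Linf_locD(3)[OF output_Linf_loc] by metis
    obtain M3 where M3: "\<And>s. s \<in> {0..t} \<Longrightarrow> norm (u s) \<le> M3" using Linf_locD(3)[OF u] by metis
    show ?thesis
    proof (rule delay_solution_continuous_dependence[OF r F z[unfolded observes_def] observed_input_Linf_loc[OF e]
          zk[unfolded observes_def] observed_input_Linf_loc[OF ek], where M = "M2 + M1 + M3" and T = t])
      show "norm (h (history r x s) + ek (\<phi> k) s, u s) \<le> M2 + M1 + M3" if "s \<in> {0..t}" for k s
        using M1[OF that] M2[OF that] M3[OF that]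
        by (intro order_trans[OF norm_Pair_le] add_mono norm_triangle_mono) auto
      show "(\<lambda>k. (h (history r x s) + ek (\<phi> k) s, u s)) \<longlonglongrightarrow> (h (history r x s) + e s, u s)" if "s \<in> {0..<t}" for s
        using that by (intro tendsto_intros ek_lim) auto
    qed (use t in auto)
  qed
  have drift_lim: "(\<lambda>k. drift (zk (\<phi> k)) t) \<longlonglongrightarrow> drift z t" if t: "0 \<le> t" for t
  proof -
    have "(\<lambda>k. \<Psi> (history r (zk (\<phi> k)) t)) \<longlonglongrightarrow> \<Psi> (history r z t)"
      by (rule continuous_on_tendsto_compose[OF \<Psi>(1) hist_lim[OF t]])
        (use t observesD(2)[OF zk] observesD(2)[OF z] in auto)
    then have "(\<lambda>k. (\<Psi> (history r (zk (\<phi> k)) t), u t, 0)) \<longlonglongrightarrow> (\<Psi> (history r z t), u t, 0)"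
      by (intro tendsto_intros)
    then have "(\<lambda>k. R (\<Psi> (history r (zk (\<phi> k)) t), u t, 0)) \<longlonglongrightarrow> R (\<Psi> (history r z t), u t, 0)"
      by (rule continuous_on_tendsto_compose[OF R])
        (use t observesD(2)[OF zk] observesD(2)[OF z] \<Psi>(2) D0 Linf_locD(2)[OF u] in auto)
    then show ?thesis unfolding drift_def by (intro tendsto_diff tendsto_const)
  qed
  have W_eq: "W t = integral {0..t} (drift z)" if t: "0 \<le> t" for t
  proof -
    have "(\<lambda>k. V (\<phi> k) t) \<longlonglongrightarrow> integral {0..t} (drift z)"
      unfolding V_def
      by (rule dominated_convergence(2)[where h = "\<lambda>_. C t"])
        (use drift_integrable[OF zk] C(2) drift_lim in \<open>auto simp: integrable_const_ivl\<close>)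
    then show ?thesis using W[OF t] LIMSEQ_unique by blast
  qed
  have "e t = \<xi> (last_sample t) + integral {last_sample t..t} (drift z)" if t: "0 \<le> t" for t
    using Henstock_Kurzweil_Integration.integral_combine[OF last_sample(1,2)[OF t] drift_integrable[OF z]]
      W_eq[OF t] W_eq[OF last_sample(1)[OF t]] by (simp add: e_def algebra_simps)
  then show ?thesis using e z by blast
qed

lemma prediction_imp_sampled_solution:
  assumes z: "observes e z"
    and pred: "\<And>t. 0 \<le> t \<Longrightarrow> e t = \<xi> (last_sample t) + integral {last_sample t..t} (drift z)"
  shows "sampled_solution r f h F \<Psi> R \<tau> u d \<xi> x0 z0 x z (\<lambda>t. h (history r x t) + e t)"
  unfolding sampled_solution_def
proof (intro conjI allI x)
  show "delay_solution r (\<lambda>\<phi> t. F (\<phi>, h (history r x t) + e t, u t)) z0 z"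
    using z by (simp add: observes_def)
  fix i
  let ?I = "{\<tau> i..<\<tau> (Suc i)}"
  have sub: "?I \<subseteq> {0..}" using \<tau>_nonneg[of i] by auto
  obtain C where "\<forall>t\<in>{0..\<tau> (Suc i)}. norm (drift z t) \<le> C" using Linf_locD(3)[OF drift_Linf_loc[OF z]] by blast
  then have "has_ac_derivative_on ?I (\<lambda>t. \<xi> (\<tau> i) + integral {\<tau> i..t} (drift z)) (drift z)"
    using \<tau>_nonneg[of i] by (intro has_ac_derivative_on_indefinite_integral[OF \<tau>_step(1) drift_integrable[OF z]]) auto
  from has_ac_derivative_on_combine(1)[OF output_ac this sub]
  have "has_ac_derivative_on ?I (\<lambda>t. h (history r x t) + (\<xi> (\<tau> i) + integral {\<tau> i..t} (drift z)))
      (\<lambda>t. R (history r x t, u t, d t) + drift z t)" by simp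
  then show "has_ac_derivative_on ?I (\<lambda>t. h (history r x t) + e t) (\<lambda>t. R (\<Psi> (history r z t), u t, 0))"
    by (rule has_ac_derivative_on_cong) (use sub pred last_sample_eq in \<open>auto simp: drift_def\<close>)
  have "last_sample (\<tau> i) = \<tau> i" using \<tau>_step(1) by (intro last_sample_eq) auto
  then show "h (history r x (\<tau> i)) + e (\<tau> i) = h (history r x (\<tau> i)) + \<xi> (\<tau> i)"
    using pred[OF \<tau>_nonneg[of i]] by simp
qed

text \<open>
  On each sampling interval \<open>e\<close> is the difference of two absolutely continuous functions, so it is the
  integral of its derivative. The resulting formula also shows that \<open>w\<close> stays bounded towards the right end of
  the interval, which its differential equation on compact subintervals does not show by itself.
\<close>

lemma sampled_solution_imp_prediction:
  assumes sol: "sampled_solution r f h F \<Psi> R \<tau> u d \<xi> x0 z0 x z w"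
  defines "e \<equiv> \<lambda>t. w t - h (history r x t)"
  shows "e \<in> Linf_loc UNIV" "observes e z"
    "0 \<le> t \<Longrightarrow> e t = \<xi> (last_sample t) + integral {last_sample t..t} (drift z)"
proof -
  have w: "\<And>i. has_ac_derivative_on {\<tau> i..<\<tau> (Suc i)} w (\<lambda>t. R (\<Psi> (history r z t), u t, 0))"
      "\<And>i. w (\<tau> i) = h (history r x (\<tau> i)) + \<xi> (\<tau> i)"
      "delay_solution r (\<lambda>\<phi> t. F (\<phi>, w t, u t)) z0 z"
    using sol by (auto simp: sampled_solution_def)
  show z: "observes e z" using w(3) by (simp add: observes_def e_def)
  have pred: "e t = \<xi> (last_sample t) + integral {last_sample t..t} (drift z)" if t: "0 \<le> t" for t
  proof -
    define i where "i = sample_index t"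
    have i: "t \<in> {\<tau> i..<\<tau> (Suc i)}" unfolding i_def by (rule sample_index_interval[OF t])
    have sub: "{\<tau> i..<\<tau> (Suc i)} \<subseteq> {0..}" using \<tau>_nonneg[of i] by auto
    have "has_ac_derivative_on {\<tau> i..<\<tau> (Suc i)} e (drift z)"
      unfolding e_def drift_def by (rule has_ac_derivative_on_combine(2)[OF w(1) output_ac _ sub]) auto
    moreover have "{\<tau> i..t} \<subseteq> {\<tau> i..<\<tau> (Suc i)}" using i by auto
    ultimately have "(drift z has_integral (e t - e (\<tau> i))) {\<tau> i..t}"
      using i by (intro has_ac_derivative_on_has_integral) auto
    then have "integral {\<tau> i..t} (drift z) = e t - e (\<tau> i)" by (rule integral_unique)
    moreover have "e (\<tau> i) = \<xi> (\<tau> i)" by (simp add: e_def w(2))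
    ultimately show ?thesis using last_sample_eq[OF i] by simp
  qed
  then show "0 \<le> t \<Longrightarrow> e t = \<xi> (last_sample t) + integral {last_sample t..t} (drift z)" .
  have L: "(\<lambda>t. \<xi> (last_sample t) + integral {last_sample t..t} (drift z)) \<in> Linf_loc UNIV"
  proof (rule Linf_loc_sampled_integral[OF \<xi> drift_Linf_loc[OF z]])
    show "(\<lambda>t. t) \<in> borel_measurable (lebesgue_on {0::real..})"
      by (intro continuous_imp_measurable_on_sets_lebesgue continuous_intros) auto
  qed (use last_sample in auto)
  show "e \<in> Linf_loc UNIV"
  proof (rule Linf_locI)
    show "e \<in> borel_measurable (lebesgue_on {0..})"
      by (rule measurable_cong[THEN iffD1, OF _ Linf_locD(1)[OF L]]) (simp add: pred)
    show "\<exists>M. \<forall>t\<in>{0..T}. norm (e t) \<le> M" if "0 \<le> T" for T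
    proof -
      obtain M where "\<forall>t\<in>{0..T}. norm (\<xi> (last_sample t) + integral {last_sample t..t} (drift z)) \<le> M"
        using Linf_locD(3)[OF L] by blast
      then show ?thesis using pred by auto
    qed
  qed simp
qed

lemma ex_sampled_solution: "\<exists>z w. sampled_solution r f h F \<Psi> R \<tau> u d \<xi> x0 z0 x z w"
  using ex_prediction prediction_imp_sampled_solution by blast

lemma sampled_solution_estimate:
  assumes sol: "sampled_solution r f h F \<Psi> R \<tau> u d \<xi> x0 z0 x z w" and t: "0 \<le> t"
  shows "error z t \<le> error_bound t"
proof (rule sampled_error_estimate[OF sampled_solution_imp_prediction(1,2)[OF sol] _ t])
  fix s :: real assume s: "0 \<le> s"
  show "last_sample s \<le> s \<and> s \<le> s \<and>
      w s - h (history r x s) = \<xi> (last_sample s) + integral {last_sample s..s} (drift z)"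
    using last_sample(2)[OF s] sampled_solution_imp_prediction(3)[OF sol s] by simp
qed

end

section \<open>The sampled-data observer\<close>

text \<open>
  The sampling bound on \<open>\<delta>\<close> is exactly the statement that the loop gain \<open>B\<close> is below one.
\<close>

lemma loop_gain_less_one:
  fixes L \<gamma> \<delta> \<omega> :: real
  assumes "0 \<le> L" "0 < \<gamma>" "0 < \<omega>" and \<delta>: "L = 0 \<or> \<delta> < 1 / \<omega> * ln (1 + \<omega> / (\<gamma> * L))"
  shows "\<gamma> * L * ((exp (\<omega> * \<delta>) - 1) / \<omega>) < 1"
proof (cases "L = 0")
  case False
  then have gL: "0 < \<gamma> * L" using assms by simp
  have "\<omega> * \<delta> < \<omega> * (1 / \<omega> * ln (1 + \<omega> / (\<gamma> * L)))"
    using \<delta> False \<open>0 < \<omega>\<close> by (intro mult_strict_left_mono) auto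
  then have "\<omega> * \<delta> < ln (1 + \<omega> / (\<gamma> * L))" using \<open>0 < \<omega>\<close> by simp
  then have "exp (\<omega> * \<delta>) < exp (ln (1 + \<omega> / (\<gamma> * L)))" by simp
  also have "\<dots> = 1 + \<omega> / (\<gamma> * L)" using gL \<open>0 < \<omega>\<close> by (intro exp_ln add_pos_pos divide_pos_pos) auto
  finally have "exp (\<omega> * \<delta>) - 1 < \<omega> / (\<gamma> * L)" by simp
  then have "\<gamma> * L * (exp (\<omega> * \<delta>) - 1) < \<omega>" using gL by (simp add: pos_less_divide_eq mult.commute)
  then show ?thesis using \<open>0 < \<omega>\<close> by (simp add: pos_divide_less_eq)
qed simp

theorem theorem2p2:
  fixes U :: "(real^'m) set" and D :: "(real^'q) set" and r :: real
    and f :: "(real \<Rightarrow>\<^sub>C (real^'n)) \<times> (real^'m) \<times> (real^'q) \<Rightarrow> (real^'n)"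
    and h :: "(real \<Rightarrow>\<^sub>C (real^'n)) \<Rightarrow> (real^'k)"
    and R :: "(real \<Rightarrow>\<^sub>C (real^'n)) \<times> (real^'m) \<times> (real^'q) \<Rightarrow> (real^'k)"
    and F :: "(real \<Rightarrow>\<^sub>C (real^'l)) \<times> (real^'k) \<times> (real^'m) \<Rightarrow> (real^'l)"
    and \<Psi> :: "(real \<Rightarrow>\<^sub>C (real^'l)) \<Rightarrow> (real \<Rightarrow>\<^sub>C (real^'n))"
    and L \<gamma> \<sigma> \<delta> \<omega> B :: real and \<kappa> g a gt :: "real \<Rightarrow> real"
  assumes "convex U" "convex D" "0 \<in> U" "0 \<in> D" "r > 0"
    \<comment> \<open>(1)\<close>
    and "continuous_on (C0 r \<times> U \<times> D) f" "continuous_on (C0 r) h" "f (0, 0, 0) = 0" "h 0 = 0"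
    and "bounded_on_bounded (C0 r \<times> U \<times> D) f" "bounded_on_bounded (C0 r) h"
    and "one_sided_lipschitz_on_bounded (C0 r \<times> U \<times> D) f"
    \<comment> \<open>(2)\<close>
    and "\<forall>x0\<in>C0 r. \<forall>u\<in>Linf_loc U. \<forall>d\<in>Linf_loc D.
           \<exists>x. delay_solution r (\<lambda>\<phi> t. f (\<phi>, u t, d t)) x0 x"
    \<comment> \<open>(3); the equation for the output is meant in the absolutely continuous sense, since a singular
       part of the output would not be seen by an almost everywhere derivative\<close>
    and "continuous_on (C0 r \<times> U \<times> D) R"
    and "\<forall>x0\<in>C0 r. \<forall>u\<in>Linf_loc U. \<forall>d\<in>Linf_loc D. \<forall>x.
           delay_solution r (\<lambda>\<phi> t. f (\<phi>, u t, d t)) x0 x \<longrightarrow>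
           has_ac_derivative_on {0..} (\<lambda>t. h (history r x t)) (\<lambda>t. R (history r x t, u t, d t))"
    and "L \<ge> 0" "\<kappa> \<in> class_K"
    and "\<forall>\<phi>\<in>C0 r. \<forall>\<psi>\<in>C0 r. \<forall>v\<in>U. \<forall>e\<in>D.
           norm (R (\<psi>, v, 0) - R (\<phi>, v, e)) \<le> L * norm (\<psi> - \<phi>) + \<kappa> (norm e)"
    \<comment> \<open>(4)\<close>
    and "robust_exponential_observer r U D f h F \<Psi> \<gamma> \<sigma> g a"
    \<comment> \<open>(5)\<close>
    and "\<forall>S. S \<subseteq> C0 r \<times> U \<and> bounded S \<longrightarrow>
           (\<exists>M\<ge>0. \<forall>\<phi> \<psi> v. (\<phi>, v) \<in> S \<longrightarrow> (\<psi>, v) \<in> S \<longrightarrow>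
              norm (R (\<Psi> \<phi>, v, 0) - R (\<Psi> \<psi>, v, 0)) \<le> M * norm (\<phi> - \<psi>))"
    and "\<delta> > 0" "0 < \<omega>" "\<omega> \<le> \<sigma>"
    and "L = 0 \<or> \<delta> < 1 / \<omega> * ln (1 + \<omega> / (\<gamma> * L))"
    and "B = \<gamma> * L * ((exp (\<omega> * \<delta>) - 1) / \<omega>)"
    and "\<forall>s. gt s = inverse (1 - B) * (g s + \<gamma> * \<delta> * \<kappa> s)"
  shows "B < 1 \<and>
    (\<forall>\<tau> :: nat \<Rightarrow> real.
       \<tau> 0 = 0 \<and> filterlim \<tau> at_top sequentially \<and>
       (\<forall>i. 0 < \<tau> (Suc i) - \<tau> i \<and> \<tau> (Suc i) - \<tau> i \<le> \<delta>) \<longrightarrow>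
       (\<forall>x0\<in>C0 r. \<forall>z0\<in>C0 r. \<forall>u\<in>Linf_loc U. \<forall>d\<in>Linf_loc D. \<forall>\<xi>\<in>Linf_loc UNIV.
          (\<exists>x z w. sampled_solution r f h F \<Psi> R \<tau> u d \<xi> x0 z0 x z w) \<and>
          (\<forall>x z w. sampled_solution r f h F \<Psi> R \<tau> u d \<xi> x0 z0 x z w \<longrightarrow>
             (\<forall>t\<ge>0. norm (\<Psi> (history r z t) - history r x t)
                \<le> inverse (1 - B) * exp (- \<omega> * t) * a (norm x0 + norm z0)
                  + inverse (1 - B) * \<gamma> * exp (\<omega> * \<delta>)
                      * (SUP s\<in>{0..t}. norm (\<xi> s) * exp (- \<omega> * (t - s)))
                  + (SUP s\<in>{0..t}. gt (norm (d s)))))))"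
proof -
  have \<gamma>: "0 < \<gamma>" using assms(19) by (simp add: robust_exponential_observer_def)
  have B1: "B < 1"
    unfolding assms(25) using assms(16) \<gamma> assms(22,24) by (rule loop_gain_less_one)
  show ?thesis
  proof (intro conjI allI impI ballI B1)
    fix \<tau> :: "nat \<Rightarrow> real" and x0 :: "real \<Rightarrow>\<^sub>C (real^'n)" and z0 :: "real \<Rightarrow>\<^sub>C (real^'l)"
      and u :: "real \<Rightarrow> real^'m" and d :: "real \<Rightarrow> real^'q" and \<xi> :: "real \<Rightarrow> real^'k"
    assume \<tau>: "\<tau> 0 = 0 \<and> filterlim \<tau> at_top sequentially \<and> (\<forall>i. 0 < \<tau> (Suc i) - \<tau> i \<and> \<tau> (Suc i) - \<tau> i \<le> \<delta>)"
      and init: "x0 \<in> C0 r" "z0 \<in> C0 r" and inputs: "u \<in> Linf_loc U" "d \<in> Linf_loc D" "\<xi> \<in> Linf_loc UNIV"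
    have run: "sampled_observer \<tau> \<delta> U D r f h R F \<Psi> L \<gamma> \<sigma> \<omega> B \<kappa> g a u d \<xi> x0 z0 x"
      if x: "delay_solution r (\<lambda>\<phi> t. f (\<phi>, u t, d t)) x0 x" for x
    proof
      show "\<tau> 0 = 0" "filterlim \<tau> at_top sequentially" using \<tau> by auto
      show "\<tau> i < \<tau> (Suc i)" "\<tau> (Suc i) \<le> \<tau> i + \<delta>" for i
        using \<tau>[THEN conjunct2, THEN conjunct2, rule_format, of i] by auto
      show "has_ac_derivative_on {0..} (\<lambda>t. h (history r x t)) (\<lambda>t. R (history r x t, u t, d t))"
        using assms(15) init inputs x by blast
      show "norm (R (\<psi>, v, 0) - R (\<phi>, v, e)) \<le> L * norm (\<psi> - \<phi>) + \<kappa> (norm e)"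
        if "\<phi> \<in> C0 r" "\<psi> \<in> C0 r" "v \<in> U" "e \<in> D" for \<phi> \<psi> v e
        using assms(18) that by blast
    qed (fact assms init inputs x B1)+
    show "\<exists>x z w. sampled_solution r f h F \<Psi> R \<tau> u d \<xi> x0 z0 x z w"
    proof -
      obtain x where "delay_solution r (\<lambda>\<phi> t. f (\<phi>, u t, d t)) x0 x"
        using assms(13) init inputs by blast
      from sampled_observer.ex_sampled_solution[OF run[OF this]] show ?thesis by blast
    qed
    fix x z w and t :: real
    assume sol: "sampled_solution r f h F \<Psi> R \<tau> u d \<xi> x0 z0 x z w" and t: "0 \<le> t"
    then have x: "delay_solution r (\<lambda>\<phi> t. f (\<phi>, u t, d t)) x0 x"
      by (simp add: sampled_solution_def)
    interpret sampled_observer \<tau> \<delta> U D r f h R F \<Psi> L \<gamma> \<sigma> \<omega> B \<kappa> g a u d \<xi> x0 z0 x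
      by (rule run[OF x])
    show "norm (\<Psi> (history r z t) - history r x t)
                \<le> inverse (1 - B) * exp (- \<omega> * t) * a (norm x0 + norm z0)
                  + inverse (1 - B) * \<gamma> * exp (\<omega> * \<delta>)
                      * (SUP s\<in>{0..t}. norm (\<xi> s) * exp (- \<omega> * (t - s)))
                  + (SUP s\<in>{0..t}. gt (norm (d s)))"
      using sampled_solution_estimate[OF sol t]
      unfolding error_def error_bound_def assms(26)[rule_format] .
  qed
qed

end
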